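(* (i) For every prime $p\ge5$, the values $c_{G,\mathrm{mult}}(p)$ for $G\in\{\mathbb{Z}/2\mathbb{Z},\mathbb{Z}/3\mathbb{Z},\mathbb{Z}/4\mathbb{Z},\mathbb{Z}/2\mathbb{Z}\times\mathbb{Z}/2\mathbb{Z}\}$ are proportional to the numbers of cusps of the corresponding modular curves: there is $\lambda_p>0$ with $c_{G,\mathrm{mult}}(p)=\lambda_p\cdot\#\mathrm{cusps}(X_G)$ for all these $G$. (ii) There is a set $S$ of primes of positive density such that for every $p\in S$ the values $c_{G,\mathrm{mult}}(p)$ for $G\in\{\mathbb{Z}/n\mathbb{Z}\ (n=5,6,7,8,9,10,12),\ \mathbb{Z}/2\mathbb{Z}\times\mathbb{Z}/M\mathbb{Z}\ (M=4,6,8)\}$ are proportional to the numbers of cusps of the corresponding modular curves $X_G$ (with a proportionality factor depending only on $p$).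
   Context: The modular curve $X_G$ corresponding to $G$ is $X_1(N)$ for $G=\mathbb{Z}/N\mathbb{Z}$, $X(2)$ for $G=\mathbb{Z}/2\times\mathbb{Z}/2$, and the modular curve $X_{\Gamma_1(M)\cap\Gamma(2)}$ for $G=\mathbb{Z}/2\times\mathbb{Z}/M$, $M=4,6,8$. For a prime $p\ge5$ and polynomials $(f_G,g_G)$ as below, $W_{G,J}=\{I\in\mathbb{F}_p^2:(f_G,g_G)(I)=J\}$ for $J\in\mathbb{F}_p^2$, and $$c_{G,\mathrm{mult}}(p)=\frac1{p^2}\sum_{J}|W_{G,J}|,$$ where $J=(A,B)$ runs over the pairs in $\mathbb{F}_p^2$ for which $E_J:y^2=x^3+Ax+B$ is nodal, i.e. $4A^3+27B^2=0$ and $J\ne(0,0)$. Groups of order $\le4$, $(f_G,g_G)$: $\mathbb{Z}/2$: $(a,\ b^3+ab)$; $\mathbb{Z}/3$: $(6ab+27a^4,\ b^2-27a^6)$; $\mathbb{Z}/4$: $(-3a^2+6ab^2-2b^4,\ (2a-b^2)(a^2+2ab^2-b^4))$; $\mathbb{Z}/2\times\mathbb{Z}/2$: $(-(a^2+3b^2)/4,\ (b^3-a^2b)/4)$. Groups of order $\ge5$: for the Tate normal form $y^2+(1-v)xy-uy=x^3-ux^2$ put $b_2=(1-v)^2-4u$, $b_4=-u(1-v)$, $b_6=u^2$, $c_4=b_2^2-24b_4$, $c_6=-b_2^3+36b_2b_4-216b_6$. With $u,v,s$ the following functions of $t$, let $F=-27s^4c_4$, $K=-54s^6c_6\in\mathbb{Z}[t]$,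 $f_G(a,b)=b^{\deg F}F(a/b)$, $g_G(a,b)=b^{\deg K}K(a/b)$: - $\mathbb{Z}/5$: $u=v=t$, $s=1$. - $\mathbb{Z}/6$: $u=t+t^2$, $v=t$, $s=1$. - $\mathbb{Z}/7$: $u=t^3-t^2$, $v=t^2-t$, $s=1$. - $\mathbb{Z}/8$: $u=(2t-1)(t-1)$, $v=(2t-1)(t-1)/t$, $s=t$. - $\mathbb{Z}/9$: $u=t^2(t-1)(t^2-t+1)$, $v=t^2(t-1)$, $s=1$. - $\mathbb{Z}/10$: $u=t^3(2t-1)(t-1)/(-t^2+3t-1)^2$, $v=t(2t-1)(t-1)/(-t^2+3t-1)$, $s=-t^2+3t-1$. - $\mathbb{Z}/12$: $u=(3t^2-3t+1)(t-2t^2)(2t-2t^2-1)/(t-1)^4$, $v=(3t^2-3t+1)(t-2t^2)/(t-1)^3$, $s=(t-1)^3$. - $\mathbb{Z}/2\times\mathbb{Z}/8$: $u=(2t+1)(8t^2+4t+1)/(8t^2-1)^2$, $v=(2t+1)(8t^2+4t+1)/(2t(4t+1)(8t^2-1))$, $s=2t(4t+1)(8t^2-1)$. For $\mathbb{Z}/2\times\mathbb{Z}/4$: $f_G=-27a^4-378a^2b^2-27b^4$, $g_G=-54a^6+1782a^4b^2+1782a^2b^4-54b^6$. For $\mathbb{Z}/2\times\mathbb{Z}/6$: $f_G=-27a^8+1296a^6b^2-12960a^4b^4-393984a^2b^6-62208b^8$, $g_G=54a^{12}-3888a^{10}b^2+85536a^8b^4-2363904a^6b^6+43670016a^4b^8+86593536a^2b^{10}-5971968b^{12}$.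 *)

theory Defs
  imports
    "HOL-Analysis.Determinants"
    "HOL-Analysis.Infinite_Sum"
    "HOL-Computational_Algebra.Fraction_Field"
    "HOL-Computational_Algebra.Polynomial"
    "HOL-Computational_Algebra.Primes"
    "HOL-Number_Theory.Cong"
    "HOL-Number_Theory.Modular_Inverse"
begin

datatype torsion_group =
    Z2 | Z3 | Z4 | Z2xZ2
  | Z5 | Z6 | Z7 | Z8 | Z9 | Z10 | Z12
  | Z2xZ4 | Z2xZ6 | Z2xZ8

section \<open>Cusps of modular curves\<close>

definition SL2Z :: "(int^2^2) set" where
  "SL2Z = {g. det g = 1}"

definition Gamma :: "nat \<Rightarrow> (int^2^2) set" where
  "Gamma N = {g \<in> SL2Z.
     [g $ 1 $ 1 = 1] (mod int N) \<and> [g $ 1 $ 2 = 0] (mod int N) \<and>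
     [g $ 2 $ 1 = 0] (mod int N) \<and> [g $ 2 $ 2 = 1] (mod int N)}"

definition Gamma1 :: "nat \<Rightarrow> (int^2^2) set" where
  "Gamma1 N = {g \<in> SL2Z.
     [g $ 1 $ 1 = 1] (mod int N) \<and>
     [g $ 2 $ 1 = 0] (mod int N) \<and> [g $ 2 $ 2 = 1] (mod int N)}"

text \<open>\<^term>\<open>UNIV :: rat option set\<close> is the projective line over the rationals,
  with \<^term>\<open>None\<close> as the point at infinity.\<close>

definition moebius :: "int^2^2 \<Rightarrow> rat option \<Rightarrow> rat option" where
  "moebius g z =
     (let a = of_int (g $ 1 $ 1); b = of_int (g $ 1 $ 2);
          c = of_int (g $ 2 $ 1); d = of_int (g $ 2 $ 2)
      in case z of
           None \<Rightarrow> (if c = 0 then None else Some (a / c))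
         | Some x \<Rightarrow> (if c * x + d = 0 then None else Some ((a * x + b) / (c * x + d))))"

definition cusps :: "(int^2^2) set \<Rightarrow> rat option set set" where
  "cusps \<Gamma> = UNIV // {(z, w). \<exists>g\<in>\<Gamma>. w = moebius g z}"

text \<open>The modular curve attached to a group is the compactified quotient of the upper half plane
  by the following congruence subgroup; its cusps are the orbits of that subgroup on the
  projective line over the rationals.\<close>

primrec modular_group :: "torsion_group \<Rightarrow> (int^2^2) set" where
  "modular_group Z2 = Gamma1 2"
| "modular_group Z3 = Gamma1 3"
| "modular_group Z4 = Gamma1 4"
| "modular_group Z2xZ2 = Gamma 2"
| "modular_group Z5 = Gamma1 5"
| "modular_group Z6 = Gamma1 6"
| "modular_group Z7 = Gamma1 7"
| "modular_group Z8 = Gamma1 8"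
| "modular_group Z9 = Gamma1 9"
| "modular_group Z10 = Gamma1 10"
| "modular_group Z12 = Gamma1 12"
| "modular_group Z2xZ4 = Gamma1 4 \<inter> Gamma 2"
| "modular_group Z2xZ6 = Gamma1 6 \<inter> Gamma 2"
| "modular_group Z2xZ8 = Gamma1 8 \<inter> Gamma 2"

definition num_cusps :: "torsion_group \<Rightarrow> nat" where
  "num_cusps G = card (cusps (modular_group G))"

section \<open>The parametrizing polynomials\<close>

text \<open>The field of rational functions in \<open>t\<close> over the rationals is \<^typ>\<open>int poly fract\<close>.\<close>

definition tvar :: "int poly fract" where
  "tvar = Fraction_Field.Fract [:0, 1:] 1"

definition poly_of_fract :: "int poly fract \<Rightarrow> int poly" where
  "poly_of_fract x = (THE P. Fraction_Field.Fract P 1 = x)"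

text \<open>The invariants of the Tate normal form \<open>y^2 + (1 - v)xy - uy = x^3 - ux^2\<close>.\<close>

definition tate_b2 :: "'a::field \<Rightarrow> 'a \<Rightarrow> 'a" where
  "tate_b2 u v = (1 - v)^2 - 4 * u"

definition tate_b4 :: "'a::field \<Rightarrow> 'a \<Rightarrow> 'a" where
  "tate_b4 u v = - u * (1 - v)"

definition tate_b6 :: "'a::field \<Rightarrow> 'a \<Rightarrow> 'a" where
  "tate_b6 u v = u^2"

definition tate_c4 :: "'a::field \<Rightarrow> 'a \<Rightarrow> 'a" where
  "tate_c4 u v = tate_b2 u v ^ 2 - 24 * tate_b4 u v"

definition tate_c6 :: "'a::field \<Rightarrow> 'a \<Rightarrow> 'a" where
  "tate_c6 u v = - (tate_b2 u v ^ 3) + 36 * tate_b2 u v * tate_b4 u v - 216 * tate_b6 u v"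

text \<open>The form \<open>b^(deg P) P(a/b)\<close>.\<close>

definition homogenize :: "int poly \<Rightarrow> int \<Rightarrow> int \<Rightarrow> rat" where
  "homogenize P a b = of_int (\<Sum>i\<le>degree P. coeff P i * a ^ i * b ^ (degree P - i))"

definition tate_pair ::
    "int poly fract \<Rightarrow> int poly fract \<Rightarrow> int poly fract \<Rightarrow>
     (int \<Rightarrow> int \<Rightarrow> rat) \<times> (int \<Rightarrow> int \<Rightarrow> rat)" where
  "tate_pair u v s =
     (homogenize (poly_of_fract (- 27 * s^4 * tate_c4 u v)),
      homogenize (poly_of_fract (- 54 * s^6 * tate_c6 u v)))"

text \<open>Polynomials over the rationals in two variables are given by their values at integers.\<close>

primrec fg :: "torsion_group \<Rightarrow> (int \<Rightarrow> int \<Rightarrow> rat) \<times> (int \<Rightarrow> int \<Rightarrow> rat)" where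
  "fg Z2 = (\<lambda>a b. of_int a,
            \<lambda>a b. of_int (b^3 + a*b))"
| "fg Z3 = (\<lambda>a b. of_int (6*a*b + 27*a^4),
            \<lambda>a b. of_int (b^2 - 27*a^6))"
| "fg Z4 = (\<lambda>a b. of_int (- 3*a^2 + 6*a*b^2 - 2*b^4),
            \<lambda>a b. of_int ((2*a - b^2) * (a^2 + 2*a*b^2 - b^4)))"
| "fg Z2xZ2 = (\<lambda>a b. - of_int (a^2 + 3*b^2) / 4,
               \<lambda>a b. of_int (b^3 - a^2*b) / 4)"
| "fg Z5 = (let t = tvar in tate_pair t t 1)"
| "fg Z6 = (let t = tvar in tate_pair (t + t^2) t 1)"
| "fg Z7 = (let t = tvar in tate_pair (t^3 - t^2) (t^2 - t) 1)"
| "fg Z8 = (let t = tvar in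
     tate_pair ((2*t - 1) * (t - 1)) ((2*t - 1) * (t - 1) / t) t)"
| "fg Z9 = (let t = tvar in
     tate_pair (t^2 * (t - 1) * (t^2 - t + 1)) (t^2 * (t - 1)) 1)"
| "fg Z10 = (let t = tvar in
     tate_pair (t^3 * (2*t - 1) * (t - 1) / (- (t^2) + 3*t - 1)^2)
               (t * (2*t - 1) * (t - 1) / (- (t^2) + 3*t - 1))
               (- (t^2) + 3*t - 1))"
| "fg Z12 = (let t = tvar in
     tate_pair ((3*t^2 - 3*t + 1) * (t - 2*t^2) * (2*t - 2*t^2 - 1) / (t - 1)^4)
               ((3*t^2 - 3*t + 1) * (t - 2*t^2) / (t - 1)^3)
               ((t - 1)^3))"
| "fg Z2xZ4 =
     (\<lambda>a b. of_int (- 27*a^4 - 378*a^2*b^2 - 27*b^4),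
      \<lambda>a b. of_int (- 54*a^6 + 1782*a^4*b^2 + 1782*a^2*b^4 - 54*b^6))"
| "fg Z2xZ6 =
     (\<lambda>a b. of_int (- 27*a^8 + 1296*a^6*b^2 - 12960*a^4*b^4 - 393984*a^2*b^6 - 62208*b^8),
      \<lambda>a b. of_int (54*a^12 - 3888*a^10*b^2 + 85536*a^8*b^4 - 2363904*a^6*b^6
                    + 43670016*a^4*b^8 + 86593536*a^2*b^10 - 5971968*b^12))"
| "fg Z2xZ8 = (let t = tvar in
     tate_pair ((2*t + 1) * (8*t^2 + 4*t + 1) / (8*t^2 - 1)^2)
               ((2*t + 1) * (8*t^2 + 4*t + 1) / (2*t * (4*t + 1) * (8*t^2 - 1)))
               (2*t * (4*t + 1) * (8*t^2 - 1)))"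

section \<open>Counting over the prime field\<close>

text \<open>The field with \<open>p\<close> elements is represented by the residues \<open>{0..<p}\<close>.\<close>

abbreviation Fp :: "nat \<Rightarrow> int set" where
  "Fp p \<equiv> {0..<int p}"

text \<open>Reduction of a rational number whose denominator is prime to \<open>p\<close>.  It is a ring homomorphism
  on these numbers, so reducing the value of a polynomial at integers amounts to evaluating the
  reduced polynomial at the residues.  The only denominators occurring in \<^const>\<open>fg\<close> divide 4.\<close>

definition reduce_mod :: "nat \<Rightarrow> rat \<Rightarrow> int" where
  "reduce_mod p q =
     (let (m, n) = quotient_of q in (m * modular_inverse (int p) n) mod int p)"

definition W :: "torsion_group \<Rightarrow> nat \<Rightarrow> int \<times> int \<Rightarrow> (int \<times> int) set" where
  "W G p J = {(a, b) \<in> Fp p \<times> Fp p.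
     (reduce_mod p (fst (fg G) a b), reduce_mod p (snd (fg G) a b)) = J}"

text \<open>The pairs \<open>(A, B)\<close> for which \<open>y^2 = x^3 + Ax + B\<close> is nodal.\<close>

definition nodal :: "nat \<Rightarrow> (int \<times> int) set" where
  "nodal p = {(A, B) \<in> Fp p \<times> Fp p.
     [4 * A^3 + 27 * B^2 = 0] (mod int p) \<and> (A, B) \<noteq> (0, 0)}"

definition c_mult :: "torsion_group \<Rightarrow> nat \<Rightarrow> real" where
  "c_mult G p = (\<Sum>J\<in>nodal p. real (card (W G p J))) / (real p)^2"

section \<open>Density of sets of primes\<close>

text \<open>Dirichlet (analytic) density.\<close>

definition has_prime_density :: "nat set \<Rightarrow> real \<Rightarrow> bool" where
  "has_prime_density S \<delta> \<longleftrightarrow>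
     ((\<lambda>s::real. (\<Sum>\<^sub>\<infinity>p\<in>S. real p powr (- s)) /
                 (\<Sum>\<^sub>\<infinity>p\<in>{p. prime p}. real p powr (- s))) \<longlongrightarrow> \<delta>) (at_right 1)"

end

theory Submission
  imports
    Defs
    "HOL-Number_Theory.Number_Theory"
    "HOL-Analysis.Summation_Tests"
    "HOL-Analysis.Complex_Transcendental"
begin

text \<open>
  Let \<open>D = 4 f^3 + 27 g^2\<close> for the pair \<open>(f, g)\<close> of \<open>G\<close>.  For suitable weights of \<open>a\<close> and \<open>b\<close>
  the pair is homogeneous with weights in the ratio 2 to 3, so that the units of the prime field act on the
  pairs \<open>(a, b)\<close> with nodal value.  Over the integers, and up to primes dividing
  the level, \<open>D\<close> is a product of powers of pairwise coprime forms, one for each Galois orbit of cusps of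
  the genus 0 curve \<open>X_G\<close>, and \<open>f\<close> and \<open>D\<close> have only the origin in common.  Every cusp that is rational modulo
  \<open>p\<close> therefore contributes \<open>p - 1\<close> pairs, and \<open>p^2 c_mult G p\<close> is \<open>p - 1\<close> times the number of such
  cusps.  It equals \<open>(p - 1) num_cusps G\<close> precisely when all cusps are rational modulo \<open>p\<close>.

  For the four groups of order at most 4 the forms are linear in one of the variables, so all
  cusps are rational for every \<open>p \<ge> 5\<close>.  For the other ten groups the forms split over the compositum of
  \<open>\<rat>(\<zeta>\<^sub>8)\<close>, \<open>\<rat>(\<zeta>\<^sub>9)\<close>, \<open>\<rat>(\<surd>5)\<close> and the cubic subfield of \<open>\<rat>(\<zeta>\<^sub>7)\<close>, hence modulo every prime \<open>p\<close>
  congruent to 1 modulo 2520: the roots are written down with roots of unity modulo \<open>p\<close>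
  (\<open>cyclotomic_root_mod\<close>, \<open>num_roots_quadratic\<close>, \<open>num_roots_simplest_cubic\<close>).  The set \<open>S\<close> consists of
  these primes, and \<open>c_mult_homogeneous\<close> does the count.

  That \<open>S\<close> has positive density is Dirichlet's theorem for the residue class of 1
  (\<open>prime_density_residue_1\<close>).  Summing \<open>ln |L(s, \<xi>)|\<close> over all characters \<open>\<xi>\<close> modulo \<open>m\<close> isolates the
  primes of that class up to a bounded error, and the principal character contributes the sum over all
  primes up to a bounded error; the density is the inverse of the number of characters as soon as
  the other \<open>L(1, \<xi>)\<close> do not vanish.  For non-real \<open>\<xi>\<close> a zero would occur for the conjugate as well and
  outweigh the simple pole of the principal character; for real \<open>\<xi>\<close> the Lambert series of \<open>\<xi>\<close>, which is
  unbounded near 1, would be bounded (\<open>real_character_sum_nonzero\<close>).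

  Cusps are counted by reducing primitive vectors: two of them are equivalent under
  \<open>{g. g \<equiv> (1 * ; 0 1) mod N, g\<^sub>1\<^sub>2 \<equiv> 0 mod k}\<close> up to sign iff their second entries agree modulo \<open>N\<close> and their
  first entries modulo \<open>gcd (k y) N\<close>, where \<open>y\<close> is the second entry (\<open>orbit_iff_cusp_rel\<close>).  This leaves a
  finite list of representatives.
\<close>

section \<open>Sums by parts\<close>

lemma summation_by_parts:
  fixes c :: "nat \<Rightarrow> 'a :: {comm_ring_1}"
  shows "(\<Sum>k<n. c k * a k) = (\<Sum>k<n. c k) * a n + (\<Sum>k<n. (\<Sum>j<Suc k. c j) * (a k - a (Suc k)))"
  by (induction n) (simp_all add: algebra_simps)

lemma
  fixes c :: "nat \<Rightarrow> 'a :: {real_normed_field, banach}" and a :: "nat \<Rightarrow> real"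
  assumes M: "\<And>n. norm (\<Sum>k<n. c k) \<le> M" and a0: "a \<longlonglongrightarrow> 0"
    and bv: "summable (\<lambda>n. \<bar>a n - a (Suc n)\<bar>)"
  shows summable_bounded_variation: "summable (\<lambda>n. c n * of_real (a n))"
    and norm_suminf_bounded_variation: "norm (\<Sum>n. c n * of_real (a n)) \<le> M * (\<Sum>n. \<bar>a n - a (Suc n)\<bar>)"
proof -
  define d where "d = (\<lambda>k. (\<Sum>j<Suc k. c j) * of_real (a k - a (Suc k)))"
  have M0: "M \<ge> 0" using M[of 0] by simp
  have nd: "norm (d k) \<le> M * \<bar>a k - a (Suc k)\<bar>" for k
    unfolding d_def norm_mult norm_of_real by (intro mult_right_mono M) auto
  have sd': "summable (\<lambda>k. M * \<bar>a k - a (Suc k)\<bar>)" using bv by (rule summable_mult)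
  have sd: "summable (\<lambda>k. norm (d k))"
    by (rule summable_comparison_test'[OF sd', of 0]) (use nd in auto)
  have "(\<lambda>n. (\<Sum>k<n. c k) * of_real (a n)) \<longlonglongrightarrow> 0"
  proof (rule tendsto_norm_zero_cancel, rule tendsto_sandwich[OF _ _ tendsto_const])
    show "\<forall>\<^sub>F n in sequentially. 0 \<le> norm ((\<Sum>k<n. c k) * of_real (a n))" by simp
    show "\<forall>\<^sub>F n in sequentially. norm ((\<Sum>k<n. c k) * of_real (a n)) \<le> M * \<bar>a n\<bar>"
      by (intro always_eventually allI) (auto simp: norm_mult intro!: mult_right_mono M)
    show "(\<lambda>n. M * \<bar>a n\<bar>) \<longlonglongrightarrow> 0"
      using tendsto_mult_right_zero[OF tendsto_rabs_zero[OF a0]] .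
  qed
  moreover have "(\<lambda>n. \<Sum>k<n. d k) \<longlonglongrightarrow> (\<Sum>k. d k)"
    using summable_LIMSEQ[OF summable_norm_cancel[OF sd]] .
  ultimately have "(\<lambda>n. (\<Sum>k<n. c k) * of_real (a n) + (\<Sum>k<n. d k)) \<longlonglongrightarrow> 0 + (\<Sum>k. d k)"
    by (rule tendsto_add)
  then have sums: "(\<lambda>n. c n * of_real (a n)) sums (\<Sum>k. d k)"
    unfolding sums_def summation_by_parts[of c "\<lambda>n. of_real (a n)"] d_def by simp
  then show "summable (\<lambda>n. c n * of_real (a n))" by (rule sums_summable)
  have "norm (\<Sum>n. c n * of_real (a n)) = norm (\<Sum>k. d k)"
    using sums_unique[OF sums] by simp
  also have "\<dots> \<le> (\<Sum>k. norm (d k))" by (rule summable_norm[OF sd])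
  also have "\<dots> \<le> (\<Sum>k. M * \<bar>a k - a (Suc k)\<bar>)" by (rule suminf_le[OF nd sd sd'])
  also have "\<dots> = M * (\<Sum>k. \<bar>a k - a (Suc k)\<bar>)" by (rule suminf_mult[OF bv])
  finally show "norm (\<Sum>n. c n * of_real (a n)) \<le> M * (\<Sum>n. \<bar>a n - a (Suc n)\<bar>)" .
qed

lemma
  fixes c :: "nat \<Rightarrow> 'a :: {real_normed_field, banach}" and a :: "nat \<Rightarrow> real"
  assumes M: "\<And>n. norm (\<Sum>k<n. c k) \<le> M" and a0: "a \<longlonglongrightarrow> 0" and dec: "decseq a"
  shows summable_Dirichlet_test: "summable (\<lambda>n. c n * of_real (a n))"
    and norm_suminf_Dirichlet_test: "norm (\<Sum>n. c n * of_real (a n)) \<le> M * a 0"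
proof -
  have eq: "(\<lambda>n. \<bar>a n - a (Suc n)\<bar>) = (\<lambda>n. a n - a (Suc n))"
    using dec by (auto simp: decseq_Suc_iff fun_eq_iff)
  have tv: "(\<lambda>n. \<bar>a n - a (Suc n)\<bar>) sums a 0"
    using telescope_sums'[OF a0] by (simp add: eq)
  show "summable (\<lambda>n. c n * of_real (a n))"
    using summable_bounded_variation[OF M a0 sums_summable[OF tv]] .
  show "norm (\<Sum>n. c n * of_real (a n)) \<le> M * a 0"
    using norm_suminf_bounded_variation[OF M a0 sums_summable[OF tv]] sums_unique[OF tv] by simp
qed

section \<open>Dirichlet characters\<close>

definition dirichlet_char :: "nat \<Rightarrow> (nat \<Rightarrow> complex) \<Rightarrow> bool" where
  "dirichlet_char m \<xi> \<longleftrightarrow> \<xi> 1 = 1 \<and> (\<forall>a b. \<xi> (a * b) = \<xi> a * \<xi> b) \<and>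
     (\<forall>a. \<xi> (a mod m) = \<xi> a) \<and> (\<forall>a. \<xi> a \<noteq> 0 \<longleftrightarrow> coprime a m)"

definition principal_char :: "nat \<Rightarrow> nat \<Rightarrow> complex" where
  "principal_char m a = (if coprime a m then 1 else 0)"

lemma
  assumes "dirichlet_char m \<xi>"
  shows dirichlet_char_1: "\<xi> (Suc 0) = 1" and dirichlet_char_mult: "\<xi> (a * b) = \<xi> a * \<xi> b"
    and dirichlet_char_mod: "\<xi> (a mod m) = \<xi> a"
    and dirichlet_char_eq_0_iff: "\<xi> a = 0 \<longleftrightarrow> \<not> coprime a m"
  using assms unfolding dirichlet_char_def by auto

lemma dirichlet_char_power: "dirichlet_char m \<xi> \<Longrightarrow> \<xi> (a ^ n) = \<xi> a ^ n"
  by (induction n) (simp_all add: dirichlet_char_1 dirichlet_char_mult)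

lemma dirichlet_char_cong:
  "dirichlet_char m \<xi> \<Longrightarrow> [a = b] (mod m) \<Longrightarrow> \<xi> a = \<xi> b"
  by (metis cong_def dirichlet_char_mod)

text \<open>
  Euler's theorem: the values are roots of unity because \<open>a ^ totient m\<close> is congruent to 1.
\<close>

lemma dirichlet_char_root_of_unity:
  assumes "dirichlet_char m \<xi>" "coprime a m"
  shows "\<xi> a ^ totient m = 1"
  by (metis assms dirichlet_char_cong dirichlet_char_power dirichlet_char_1 euler_theorem One_nat_def)

lemma norm_dirichlet_char:
  assumes "m > 0" "dirichlet_char m \<xi>"
  shows "norm (\<xi> a) = (if coprime a m then 1 else 0)"
proof (cases "coprime a m")
  case True
  have "norm (\<xi> a) ^ totient m = 1"
    using dirichlet_char_root_of_unity[OF assms(2) True] by (metis norm_one norm_power)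
  then have "norm (\<xi> a) = 1"
    using assms(1) by (metis norm_ge_zero power_eq_1_iff totient_gt_0_iff abs_of_nonneg neq0_conv real_norm_def)
  with True show ?thesis by simp
qed (use assms in \<open>simp add: dirichlet_char_eq_0_iff\<close>)

lemma norm_dirichlet_char_le: "m > 0 \<Longrightarrow> dirichlet_char m \<xi> \<Longrightarrow> norm (\<xi> a) \<le> 1"
  by (simp add: norm_dirichlet_char)

lemma dirichlet_char_principal: "m > 0 \<Longrightarrow> dirichlet_char m (principal_char m)"
  by (auto simp: dirichlet_char_def principal_char_def)

lemma dirichlet_char_times:
  "dirichlet_char m \<xi> \<Longrightarrow> dirichlet_char m \<psi> \<Longrightarrow> dirichlet_char m (\<lambda>a. \<xi> a * \<psi> a)"
  by (auto simp: dirichlet_char_def)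

lemma dirichlet_char_cnj: "dirichlet_char m \<xi> \<Longrightarrow> dirichlet_char m (\<lambda>a. cnj (\<xi> a))"
  by (auto simp: dirichlet_char_def)

text \<open>
  A character is determined by its values on one period, which are 0 or roots of unity of order \<open>totient m\<close>.
\<close>

lemma finite_dirichlet_char:
  assumes "m > 0"
  shows "finite {\<xi>. dirichlet_char m \<xi>}"
proof (rule inj_on_finite)
  let ?R = "insert 0 {z::complex. z ^ totient m = 1}"
  let ?r = "\<lambda>\<xi>::nat \<Rightarrow> complex. restrict \<xi> {..<m}"
  show "finite (PiE {..<m} (\<lambda>_. ?R))"
    using assms by (intro finite_PiE finite.insertI finite_roots_unity) (auto simp: Suc_leI)
  show "?r ` {\<xi>. dirichlet_char m \<xi>} \<subseteq> PiE {..<m} (\<lambda>_. ?R)"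
    by (auto simp: dirichlet_char_eq_0_iff dirichlet_char_root_of_unity PiE_def extensional_def)
  show "inj_on ?r {\<xi>. dirichlet_char m \<xi>}"
  proof (rule inj_onI, rule ext)
    fix \<xi> \<psi> a assume *: "\<xi> \<in> {\<xi>. dirichlet_char m \<xi>}" "\<psi> \<in> {\<xi>. dirichlet_char m \<xi>}" "?r \<xi> = ?r \<psi>"
    have "\<xi> (a mod m) = \<psi> (a mod m)"
      using fun_cong[OF *(3), of "a mod m"] assms by simp
    then show "\<xi> a = \<psi> a" using * by (simp add: dirichlet_char_mod)
  qed
qed

text \<open>
  Multiplication by some \<open>b\<close> with \<open>\<xi> b \<noteq> 1\<close> permutes the residues and multiplies the sum by \<open>\<xi> b\<close>.
\<close>

lemma sum_dirichlet_char_period: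
  assumes "m > 0" "dirichlet_char m \<xi>" "\<xi> \<noteq> principal_char m"
  shows "(\<Sum>a<m. \<xi> a) = 0"
proof -
  obtain b where b: "\<xi> b \<noteq> principal_char m b" using assms(3) by auto
  have cop: "coprime b m" and b1: "\<xi> b \<noteq> 1"
    using b assms(2) by (auto simp: principal_char_def dirichlet_char_eq_0_iff split: if_splits)
  have inj: "inj_on (\<lambda>a. b * a mod m) {..<m}"
  proof (rule inj_onI)
    fix x y assume *: "x \<in> {..<m}" "y \<in> {..<m}" "b * x mod m = b * y mod m"
    then have "[x = y] (mod m)"
      using cop by (metis cong_def cong_mult_lcancel_nat coprime_commute)
    then show "x = y" using * by (simp add: cong_def)
  qed
  have "bij_betw (\<lambda>a. b * a mod m) {..<m} {..<m}"
    unfolding bij_betw_def by (intro conjI inj endo_inj_surj) (use assms(1) in auto)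
  then have "(\<Sum>a<m. \<xi> a) = (\<Sum>a<m. \<xi> (b * a mod m))"
    by (rule sum.reindex_bij_betw[symmetric])
  also have "\<dots> = \<xi> b * (\<Sum>a<m. \<xi> a)"
    using assms(2) by (simp add: dirichlet_char_mod dirichlet_char_mult sum_distrib_left)
  finally show ?thesis using b1 by simp
qed

lemma norm_sum_dirichlet_char_le:
  assumes "m > 0" "dirichlet_char m \<xi>" "\<xi> \<noteq> principal_char m"
  shows "norm (\<Sum>a<n. \<xi> a) \<le> real m"
proof -
  have block: "(\<Sum>a<q*m. \<xi> a) = 0" for q
  proof (induction q)
    case (Suc q)
    have "(\<Sum>a<Suc q*m. \<xi> a) = (\<Sum>a<q*m. \<xi> a) + (\<Sum>a<m. \<xi> (q * m + a))"
      using sum.nat_group[of \<xi> m "Suc q"] sum.nat_group[of \<xi> m q]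
      by (simp add: sum.atLeastLessThan_shift_0[of \<xi> "q*m"] atLeast0LessThan add_ac)
    also have "(\<Sum>a<m. \<xi> (q * m + a)) = (\<Sum>a<m. \<xi> a)"
      by (intro sum.cong refl dirichlet_char_cong[OF assms(2)]) (simp add: cong_def)
    finally show ?case using Suc sum_dirichlet_char_period[OF assms] by simp
  qed simp
  define q r where "q = n div m" and "r = n mod m"
  have n: "n = q * m + r" and r: "r < m" using assms(1) by (auto simp: q_def r_def)
  have "(\<Sum>a<n. \<xi> a) = (\<Sum>a<q*m. \<xi> a) + (\<Sum>a\<in>{q*m..<n}. \<xi> a)"
    unfolding n by (subst lessThan_atLeast0, subst sum.atLeastLessThan_concat[of 0 "q*m", symmetric])
      (auto simp: lessThan_atLeast0)
  then have "norm (\<Sum>a<n. \<xi> a) = norm (\<Sum>a\<in>{q*m..<n}. \<xi> a)" using block by simp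
  also have "\<dots> \<le> (\<Sum>a\<in>{q*m..<n}. 1)"
    by (intro order.trans[OF norm_sum] sum_mono norm_dirichlet_char_le[OF assms(1,2)])
  also have "\<dots> \<le> real m" using n r by simp
  finally show ?thesis .
qed

text \<open>
  Orthogonality needs a character with \<open>\<xi> a \<noteq> 1\<close> for each unit \<open>a\<close> other than 1; twisting all
  characters by it permutes them and multiplies the sum by \<open>\<xi> a\<close>.  The existence of such characters is
  kept as a hypothesis, to be met by explicit characters for the modulus at hand.
\<close>

lemma sum_all_dirichlet_chars:
  assumes "m > 1" 
    and sep: "\<And>a. coprime a m \<Longrightarrow> a mod m \<noteq> 1 \<Longrightarrow> \<exists>\<xi>. dirichlet_char m \<xi> \<and> \<xi> a \<noteq> 1"
  shows "(\<Sum>\<xi>\<in>{\<xi>. dirichlet_char m \<xi>}. \<xi> a) =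
    (if a mod m = 1 then of_nat (card {\<xi>. dirichlet_char m \<xi>}) else 0)"
proof (cases "a mod m = 1")
  case True
  have "\<xi> a = 1" if "dirichlet_char m \<xi>" for \<xi>
    using dirichlet_char_mod[OF that, of a] dirichlet_char_1[OF that] True by simp
  then have "(\<Sum>\<xi>\<in>{\<xi>. dirichlet_char m \<xi>}. \<xi> a) = (\<Sum>\<xi>\<in>{\<xi>. dirichlet_char m \<xi>}. 1)"
    by (intro sum.cong) auto
  with True show ?thesis by simp
next
  case False
  show ?thesis
  proof (cases "coprime a m")
    case True
    then obtain \<psi> where \<psi>: "dirichlet_char m \<psi>" "\<psi> a \<noteq> 1" using sep False by auto
    let ?D = "{\<xi>. dirichlet_char m \<xi>}"
    have id: "\<psi> x * (cnj (\<psi> x) * \<xi> x) = \<xi> x" "cnj (\<psi> x) * (\<psi> x * \<xi> x) = \<xi> x" 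
      if "\<xi> \<in> ?D" for \<xi> x
    proof -
      have "\<psi> x * cnj (\<psi> x) * \<xi> x = \<xi> x"
        using norm_dirichlet_char[OF _ \<psi>(1), of x] assms(1) that
        by (cases "coprime x m") (auto simp: complex_norm_square[symmetric] dirichlet_char_eq_0_iff)
      then show "\<psi> x * (cnj (\<psi> x) * \<xi> x) = \<xi> x" "cnj (\<psi> x) * (\<psi> x * \<xi> x) = \<xi> x" 
        by (simp_all add: mult_ac)
    qed
    have "bij_betw (\<lambda>\<xi> x. \<psi> x * \<xi> x) ?D ?D"
      by (rule bij_betwI[where g = "\<lambda>\<xi> x. cnj (\<psi> x) * \<xi> x"])
         (use id \<psi> dirichlet_char_times dirichlet_char_cnj in \<open>auto simp: fun_eq_iff\<close>)
    then have "(\<Sum>\<xi>\<in>?D. \<xi> a) = (\<Sum>\<xi>\<in>?D. \<psi> a * \<xi> a)"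
      by (rule sum.reindex_bij_betw[symmetric, where g = "\<lambda>\<xi>. \<xi> a"])
    also have "\<dots> = \<psi> a * (\<Sum>\<xi>\<in>?D. \<xi> a)" by (simp add: sum_distrib_left)
    finally show ?thesis using \<psi>(2) False by simp
  next
    case nc: False
    then have "(\<Sum>\<xi>\<in>{\<xi>. dirichlet_char m \<xi>}. \<xi> a) = 0"
      by (intro sum.neutral) (auto simp: dirichlet_char_eq_0_iff)
    then show ?thesis using False by simp
  qed
qed

section \<open>Euler products and logarithms of Dirichlet series\<close>

definition dirichlet_L :: "(nat \<Rightarrow> complex) \<Rightarrow> real \<Rightarrow> complex" where
  "dirichlet_L \<xi> s = (\<Sum>n. \<xi> n * of_real (real n powr - s))"

lemma summable_powr: "s > 1 \<Longrightarrow> summable (\<lambda>n. real n powr - s)"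
  using summable_real_powr_iff[of "-s"] by simp

lemma summable_on_powr: "s > 1 \<Longrightarrow> (\<lambda>n. real n powr - s) summable_on A"
  by (rule summable_on_subset[of _ UNIV], subst summable_on_UNIV_nonneg_real_iff)
     (auto intro: summable_powr)

lemma
  assumes "m > 0" "dirichlet_char m \<xi>" "s > 1"
  shows abs_summable_L: "(\<lambda>n. norm (\<xi> n * of_real (real n powr - s))) summable_on A"
    and L_eq_infsum: "dirichlet_L \<xi> s = (\<Sum>\<^sub>\<infinity>n. \<xi> n * of_real (real n powr - s))"
proof -
  have le: "norm (\<xi> n * of_real (real n powr - s)) \<le> real n powr - s" for n
    using norm_dirichlet_char_le[OF assms(1,2), of n] by (simp add: norm_mult mult_left_le_one_le)
  show *: "(\<lambda>n. norm (\<xi> n * of_real (real n powr - s))) summable_on A" for A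
    by (rule summable_on_comparison_test[OF summable_on_powr[OF assms(3)]]) (use le in auto)
  then have "(\<lambda>n. \<xi> n * of_real (real n powr - s)) summable_on UNIV"
    by (rule abs_summable_summable)
  then show "dirichlet_L \<xi> s = (\<Sum>\<^sub>\<infinity>n. \<xi> n * of_real (real n powr - s))"
    unfolding dirichlet_L_def by (intro sums_unique[symmetric] has_sum_imp_sums has_sum_infsum)
qed

lemma L_cnj: 
  assumes "m > 0" "dirichlet_char m \<xi>" "s > 1"
  shows "dirichlet_L (\<lambda>a. cnj (\<xi> a)) s = cnj (dirichlet_L \<xi> s)"
  unfolding L_eq_infsum[OF assms] L_eq_infsum[OF assms(1) dirichlet_char_cnj[OF assms(2)] assms(3)]
  by (subst infsum_cnj[symmetric]) simp

text \<open>
  The sieve behind the Euler product: multiplying by \<open>1 - f q\<close> removes the terms whose index is divisible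
  by \<open>q\<close>, since these are \<open>f q\<close> times the terms of the whole sum.
\<close>

lemma infsum_coprime_insert:
  fixes f :: "nat \<Rightarrow> complex"
  assumes f: "\<And>a b. f (a * b) = f a * f b" "(\<lambda>n. norm (f n)) summable_on UNIV"
    and "finite P" "\<And>q. q \<in> P \<Longrightarrow> prime q" 
  shows "infsum f {n. \<forall>q\<in>P. \<not> q dvd n} = (\<Prod>q\<in>P. 1 - f q) * infsum f UNIV"
  using assms(3,4)
proof (induction P)
  case (insert q P)
  let ?A = "{n. \<forall>q\<in>P. \<not> q dvd n}"
  have q: "prime q" and P: "\<And>q. q \<in> P \<Longrightarrow> prime q" using insert.prems by auto
  have sm: "f summable_on B" for B
    using abs_summable_summable[OF f(2)] by (rule summable_on_subset) simp
  have dvdq: "q' dvd q * n \<longleftrightarrow> q' dvd n" if "q' \<in> P" for q' n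
    using that insert.hyps P q by (metis prime_dvd_multD primes_dvd_imp_eq dvd_mult)
  have split: "?A = {n. \<forall>q\<in>insert q P. \<not> q dvd n} \<union> (*) q ` ?A"
  proof (intro equalityI subsetI)
    fix n assume n: "n \<in> ?A"
    show "n \<in> {n. \<forall>q\<in>insert q P. \<not> q dvd n} \<union> (*) q ` ?A"
    proof (cases "q dvd n")
      case True
      then obtain k where k: "n = q * k" by (elim dvdE)
      have "k \<in> ?A" using n dvdq unfolding k by blast
      then show ?thesis unfolding k by blast
    next
      case False
      then show ?thesis using n by blast
    qed
  next
    fix n assume "n \<in> {n. \<forall>q\<in>insert q P. \<not> q dvd n} \<union> (*) q ` ?A"
    then show "n \<in> ?A" using dvdq by blast
  qed
  have "infsum f ?A = infsum f {n. \<forall>q\<in>insert q P. \<not> q dvd n} + infsum f ((*) q ` ?A)"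
    by (subst split, rule infsum_Un_disjoint) (auto intro: sm)
  moreover have "infsum f ((*) q ` ?A) = infsum (\<lambda>n. f q * f n) ?A"
    using prime_gt_0_nat[OF q] by (subst infsum_reindex) (auto simp: o_def f(1) inj_on_def)
  moreover have "infsum (\<lambda>n. f q * f n) ?A = f q * infsum f ?A"
    by (rule infsum_cmult_right) (rule sm)
  moreover have "infsum f ?A = (\<Prod>q\<in>P. 1 - f q) * infsum f UNIV"
    by (rule insert.IH[OF P])
  moreover have "b = (1 - c) * r * e" if "a = b + d" "d = d'" "d' = c * a" "a = r * e" for a b c d d' r e :: complex
    using that by (metis add_diff_cancel_right' left_diff_distrib mult_1 mult.assoc)
  ultimately have "infsum f {n. \<forall>q\<in>insert q P. \<not> q dvd n} =
    (1 - f q) * (\<Prod>q\<in>P. 1 - f q) * infsum f UNIV" by blast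
  then show ?case using insert.hyps by simp
qed simp

text \<open>
  After sieving by all primes up to \<open>N\<close> there remain the term 1 and terms with index larger than \<open>N\<close>, whose
  sum is bounded by a tail of a convergent series.
\<close>

lemma euler_product_L:
  assumes "m > 0" "dirichlet_char m \<xi>" "s > 1"
  shows "(\<lambda>N. (\<Prod>q | prime q \<and> q \<le> N. 1 - \<xi> q * of_real (real q powr - s)) * dirichlet_L \<xi> s) \<longlonglongrightarrow> 1"
proof -
  define f where "f = (\<lambda>n. \<xi> n * of_real (real n powr - s))"
  have f: "f (a * b) = f a * f b" for a b
    using assms(2) by (simp add: f_def dirichlet_char_mult powr_mult)
  have f01: "f 0 = 0" "f (Suc 0) = 1" using assms by (simp_all add: f_def dirichlet_char_1)
  have abs: "(\<lambda>n. norm (f n)) summable_on A" for A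
    using abs_summable_L[OF assms] unfolding f_def .
  then have sm: "f summable_on A" for A by (rule abs_summable_summable)
  define g where "g = (\<lambda>n. norm (f n))"
  have gs: "g sums infsum g UNIV"
    unfolding g_def using abs by (intro has_sum_imp_sums has_sum_infsum)
  have bound: "norm (infsum f {n. \<forall>q\<in>{q. prime q \<and> q \<le> N}. \<not> q dvd n} - 1) \<le> infsum g UNIV - sum g {..<Suc N}" 
    if "N \<ge> 2" for N
  proof -
    let ?A = "{n. \<forall>q\<in>{q. prime q \<and> q \<le> N}. \<not> q dvd n}"
    have sub: "?A - {1} \<subseteq> {..<Suc N} \<union> {Suc N..}" by auto
    have A1: "?A - {1} \<subseteq> {Suc N..}"
    proof
      fix n assume n: "n \<in> ?A - {1}"
      then have "n \<noteq> 1" by simp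
      then obtain q where q: "prime q" "q dvd n" using prime_factor_nat by blast
      then have "q > N" using n by auto
      moreover have "n \<noteq> 0"
      proof
        assume "n = 0"
        then have "\<not> 2 dvd (0::nat)" using n that two_is_prime_nat by blast
        then show False by simp
      qed
      ultimately show "n \<in> {Suc N..}" using dvd_imp_le[OF q(2)] by simp
    qed
    have "infsum f ?A = infsum f ({1} \<union> (?A - {1}))" by (rule arg_cong[where f = "infsum f"]) auto
    also have "\<dots> = f 1 + infsum f (?A - {1})" by (subst infsum_Un_disjoint) (auto intro: sm)
    finally have "norm (infsum f ?A - 1) = norm (infsum f (?A - {1}))" using f01 by simp
    also have "\<dots> \<le> infsum g (?A - {1})" unfolding g_def by (rule norm_infsum_bound) (rule abs)
    also have "\<dots> \<le> infsum g {Suc N..}"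
      using A1 abs unfolding g_def by (intro infsum_mono2) auto
    also have "\<dots> = infsum g UNIV - sum g {..<Suc N}"
    proof -
      have "infsum g UNIV = infsum g ({..<Suc N} \<union> {Suc N..})"
        by (rule arg_cong[where f = "infsum g"]) auto
      also have "\<dots> = sum g {..<Suc N} + infsum g {Suc N..}"
        by (subst infsum_Un_disjoint) (use abs in \<open>auto simp: g_def\<close>)
      finally show ?thesis by simp
    qed
    finally show ?thesis .
  qed
  have "(\<lambda>N. infsum f {n. \<forall>q\<in>{q. prime q \<and> q \<le> N}. \<not> q dvd n}) \<longlonglongrightarrow> 1"
  proof (rule LIM_zero_cancel, rule tendsto_norm_zero_cancel, rule tendsto_sandwich[OF _ _ tendsto_const])
    show "(\<lambda>N. infsum g UNIV - sum g {..<Suc N}) \<longlonglongrightarrow> 0"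
      using tendsto_diff[OF tendsto_const LIMSEQ_Suc[OF gs[unfolded sums_def]], of "infsum g UNIV"] by simp
    show "\<forall>\<^sub>F N in sequentially. norm (infsum f {n. \<forall>q\<in>{q. prime q \<and> q \<le> N}. \<not> q dvd n} - 1) \<le> infsum g UNIV - sum g {..<Suc N}"
      using eventually_ge_at_top[of 2] by eventually_elim (rule bound)
  qed simp
  also have "(\<lambda>N. infsum f {n. \<forall>q\<in>{q. prime q \<and> q \<le> N}. \<not> q dvd n}) =
    (\<lambda>N. (\<Prod>q | prime q \<and> q \<le> N. 1 - f q) * dirichlet_L \<xi> s)"
    unfolding L_eq_infsum[OF assms] f_def[symmetric]
    by (intro ext infsum_coprime_insert f abs) auto
  finally show ?thesis unfolding f_def .
qed

text \<open>
  Write \<open>|1 - z| ^ 2 = 1 + y\<close>.  Since \<open>1 + y \<ge> 1/4\<close>, the logarithm of \<open>1 + y\<close> is \<open>y\<close> up to \<open>4 y ^ 2\<close>, which is at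
  most \<open>25 |z| ^ 2\<close>; halving this and adding the \<open>|z| ^ 2 / 2\<close> contained in \<open>y / 2\<close> gives 13.
\<close>

lemma abs_ln_norm_one_minus:
  fixes z :: complex
  assumes "norm z \<le> 1/2"
  shows "\<bar>- ln (norm (1 - z)) - Re z\<bar> \<le> 13 * (norm z)^2"
proof -
  define y where "y = (norm z)^2 - 2 * Re z"
  have r: "\<bar>Re z\<bar> \<le> norm z" by (rule abs_Re_le_cmod)
  have sq: "(norm (1 - z))^2 = 1 + y"
    unfolding y_def cmod_power2 by (simp add: power2_eq_square algebra_simps)
  have "norm (1 - z) \<ge> 1/2" using norm_triangle_ineq2[of 1 z] assms by simp
  then have "(norm (1 - z))^2 \<ge> (1/2)^2" by (rule power_mono) simp
  then have y4: "1 + y \<ge> 1/4" using sq by (simp add: power2_eq_square)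
  have pos: "norm (1 - z) > 0" using \<open>norm (1 - z) \<ge> 1/2\<close> by linarith
  have ln: "ln (norm (1 - z)) = ln (1 + y) / 2"
    using sq pos by (metis ln_realpow of_nat_numeral nonzero_mult_div_cancel_left zero_neq_numeral)
  have up: "ln (1 + y) \<le> y" using ln_le_minus_one[of "1 + y"] y4 by simp
  have "- ln (1 + y) = ln (inverse (1 + y))" using y4 by (simp add: ln_inverse)
  also have "\<dots> \<le> inverse (1 + y) - 1" using y4 by (intro ln_le_minus_one) simp
  also have "\<dots> = - y + y^2 / (1 + y)" using y4 by (simp add: field_simps power2_eq_square)
  also have "y^2 / (1 + y) \<le> y^2 / (1/4)" using y4 by (intro divide_left_mono) auto
  finally have low: "y - 4 * y^2 \<le> ln (1 + y)" by simp
  have "\<bar>y\<bar> \<le> (norm z)^2 + 2 * norm z" unfolding y_def using abs_triangle_ineq4[of "(norm z)^2" "2 * Re z"] r by simp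
  also have "\<dots> \<le> 5/2 * norm z"
    using mult_right_mono[OF assms norm_ge_zero[of z]] by (simp add: power2_eq_square)
  finally have "\<bar>y\<bar>^2 \<le> (5/2 * norm z)^2" by (intro power_mono) auto
  then have y2: "y^2 \<le> 25/4 * (norm z)^2" by (simp add: power_mult_distrib power2_eq_square)
  have "(norm z)^2 \<ge> 0" by simp
  then show ?thesis using up low y2 unfolding ln y_def by (auto simp: abs_le_iff)
qed

lemma
  assumes "m > 0" "dirichlet_char m \<xi>" "s > 1"
  shows L_nonzero: "dirichlet_L \<xi> s \<noteq> 0"
    and ln_norm_L: "\<bar>ln (norm (dirichlet_L \<xi> s)) - (\<Sum>\<^sub>\<infinity>p\<in>{p. prime p}. Re (\<xi> p) * real p powr - s)\<bar>
      \<le> 13 * (\<Sum>\<^sub>\<infinity>n. real n powr - 2)"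
proof -
  define f where "f = (\<lambda>n. \<xi> n * of_real (real n powr - s))"
  have nf: "norm (f n) \<le> real n powr - s" for n
    using norm_dirichlet_char_le[OF assms(1,2), of n] by (simp add: f_def norm_mult mult_left_le_one_le)
  let ?P = "\<lambda>N. {q::nat. prime q \<and> q \<le> N}"
  have lim: "(\<lambda>N. (\<Prod>q\<in>?P N. 1 - f q) * dirichlet_L \<xi> s) \<longlonglongrightarrow> 1"
    using euler_product_L[OF assms] unfolding f_def .
  show nz: "dirichlet_L \<xi> s \<noteq> 0"
  proof
    assume "dirichlet_L \<xi> s = 0"
    with lim have "(\<lambda>N. 0::complex) \<longlonglongrightarrow> 1" by simp
    then show False by (simp add: LIMSEQ_const_iff)
  qed
  have half: "norm (f q) \<le> 1/2" if "prime q" for q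
  proof -
    have q: "q \<ge> 2" using that by (rule prime_ge_2_nat)
    have "real q powr - s \<le> real q powr - 1" using q assms(3) by (intro powr_mono) auto
    also have "\<dots> = 1 / real q" using q by (simp add: powr_minus_divide)
    also have "\<dots> \<le> 1/2" using q by (simp add: field_simps)
    finally show ?thesis using nf[of q] by linarith
  qed
  have ne: "1 - f q \<noteq> 0" if "prime q" for q using half[OF that] by auto
  have "(\<lambda>N. norm ((\<Prod>q\<in>?P N. 1 - f q) * dirichlet_L \<xi> s)) \<longlonglongrightarrow> norm (1::complex)"
    by (rule tendsto_norm[OF lim])
  then have "(\<lambda>N. ln (norm ((\<Prod>q\<in>?P N. 1 - f q) * dirichlet_L \<xi> s))) \<longlonglongrightarrow> ln 1"
    by (intro tendsto_ln) auto
  also have "(\<lambda>N. ln (norm ((\<Prod>q\<in>?P N. 1 - f q) * dirichlet_L \<xi> s))) =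
      (\<lambda>N. (\<Sum>q\<in>?P N. ln (norm (1 - f q))) + ln (norm (dirichlet_L \<xi> s)))"
  proof
    fix N
    have "norm ((\<Prod>q\<in>?P N. 1 - f q) * dirichlet_L \<xi> s) = (\<Prod>q\<in>?P N. norm (1 - f q)) * norm (dirichlet_L \<xi> s)"
      by (simp add: norm_mult prod_norm)
    also have "ln \<dots> = ln (\<Prod>q\<in>?P N. norm (1 - f q)) + ln (norm (dirichlet_L \<xi> s))"
      using nz ne by (intro ln_mult_pos prod_pos) auto
    also have "ln (\<Prod>q\<in>?P N. norm (1 - f q)) = (\<Sum>q\<in>?P N. ln (norm (1 - f q)))"
      using ne by (intro ln_prod) auto
    finally show "ln (norm ((\<Prod>q\<in>?P N. 1 - f q) * dirichlet_L \<xi> s)) = (\<Sum>q\<in>?P N. ln (norm (1 - f q))) + ln (norm (dirichlet_L \<xi> s))" .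
  qed
  finally have l1: "(\<lambda>N. (\<Sum>q\<in>?P N. ln (norm (1 - f q))) + ln (norm (dirichlet_L \<xi> s))) \<longlonglongrightarrow> 0" by simp
  have "(\<lambda>n. norm (f n)) summable_on {p. prime p}" using abs_summable_L[OF assms] unfolding f_def .
  then have rs: "(\<lambda>p. Re (f p)) summable_on {p. prime p}"
    by (rule summable_on_Re[OF abs_summable_summable])
  have "((\<lambda>p. if prime p then Re (f p) else 0) has_sum infsum (\<lambda>p. Re (f p)) {p. prime p}) UNIV"
    using has_sum_infsum[OF rs] by (subst has_sum_cong_neutral[where g = "\<lambda>p. Re (f p)" and T = "{p. prime p}"]) auto
  then have "(\<lambda>p. if prime p then Re (f p) else 0) sums infsum (\<lambda>p. Re (f p)) {p. prime p}"
    by (rule has_sum_imp_sums)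
  then have "(\<lambda>N. \<Sum>p<Suc N. if prime p then Re (f p) else 0) \<longlonglongrightarrow> infsum (\<lambda>p. Re (f p)) {p. prime p}"
    unfolding sums_def by (rule LIMSEQ_Suc)
  also have "(\<lambda>N. \<Sum>p<Suc N. if prime p then Re (f p) else 0) = (\<lambda>N. \<Sum>q\<in>?P N. Re (f q))"
  proof
    fix N
    have "(\<Sum>p<Suc N. if prime p then Re (f p) else 0) = (\<Sum>p | p \<in> {..<Suc N} \<and> prime p. Re (f p))"
      by (rule sum.inter_filter[symmetric]) simp
    also have "{p. p \<in> {..<Suc N} \<and> prime p} = ?P N" by auto
    finally show "(\<Sum>p<Suc N. if prime p then Re (f p) else 0) = (\<Sum>q\<in>?P N. Re (f q))" .
  qed
  finally have l2: "(\<lambda>N. \<Sum>q\<in>?P N. Re (f q)) \<longlonglongrightarrow> infsum (\<lambda>p. Re (f p)) {p. prime p}" .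
  have "(\<lambda>N. \<bar>((\<Sum>q\<in>?P N. ln (norm (1 - f q))) + ln (norm (dirichlet_L \<xi> s))) - ln (norm (dirichlet_L \<xi> s)) + (\<Sum>q\<in>?P N. Re (f q))\<bar>)
     \<longlonglongrightarrow> \<bar>0 - ln (norm (dirichlet_L \<xi> s)) + infsum (\<lambda>p. Re (f p)) {p. prime p}\<bar>"
    by (intro tendsto_rabs tendsto_add tendsto_diff l1 l2 tendsto_const)
  moreover have "\<bar>((\<Sum>q\<in>?P N. ln (norm (1 - f q))) + ln (norm (dirichlet_L \<xi> s))) - ln (norm (dirichlet_L \<xi> s)) + (\<Sum>q\<in>?P N. Re (f q))\<bar>
      \<le> 13 * (\<Sum>\<^sub>\<infinity>n. real n powr - 2)" for N
  proof -
    have "\<bar>((\<Sum>q\<in>?P N. ln (norm (1 - f q))) + ln (norm (dirichlet_L \<xi> s))) - ln (norm (dirichlet_L \<xi> s)) + (\<Sum>q\<in>?P N. Re (f q))\<bar>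
      = \<bar>\<Sum>q\<in>?P N. - ln (norm (1 - f q)) - Re (f q)\<bar>"
      by (subst abs_minus_cancel[symmetric]) (simp add: sum.distrib sum_negf sum_subtractf)
    also have "\<dots> \<le> (\<Sum>q\<in>?P N. \<bar>- ln (norm (1 - f q)) - Re (f q)\<bar>)" by (rule sum_abs)
    also have "\<dots> \<le> (\<Sum>q\<in>?P N. 13 * real q powr - 2)"
    proof (rule sum_mono)
      fix q assume q: "q \<in> ?P N"
      have "(norm (f q))^2 \<le> (real q powr - 1)^2"
      proof (rule power_mono)
        have "real q powr - s \<le> real q powr - 1" using q prime_ge_1_nat[of q] assms(3) by (intro powr_mono) auto
        then show "norm (f q) \<le> real q powr - 1" using nf[of q] by linarith
      qed simp
      also have "\<dots> = real q powr - 2" using q prime_gt_0_nat[of q] by (simp add: powr_minus_divide power_divide)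
      finally show "\<bar>- ln (norm (1 - f q)) - Re (f q)\<bar> \<le> 13 * real q powr - 2"
        using abs_ln_norm_one_minus[OF half, of q] q by simp
    qed
    also have "\<dots> = 13 * (\<Sum>q\<in>?P N. real q powr - 2)" by (simp add: sum_distrib_left)
    also have "(\<Sum>q\<in>?P N. real q powr - 2) \<le> (\<Sum>\<^sub>\<infinity>n. real n powr - 2)"
      by (rule finite_sum_le_infsum) (auto intro: summable_on_powr)
    finally show ?thesis by simp
  qed
  ultimately have "\<bar>0 - ln (norm (dirichlet_L \<xi> s)) + infsum (\<lambda>p. Re (f p)) {p. prime p}\<bar> \<le> 13 * (\<Sum>\<^sub>\<infinity>n. real n powr - 2)"
    by (intro LIMSEQ_le_const2) auto
  then show "\<bar>ln (norm (dirichlet_L \<xi> s)) - (\<Sum>\<^sub>\<infinity>p\<in>{p. prime p}. Re (\<xi> p) * real p powr - s)\<bar>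
      \<le> 13 * (\<Sum>\<^sub>\<infinity>n. real n powr - 2)"
    unfolding f_def by (simp add: abs_minus_commute)
qed

section \<open>Behaviour at 1 of Dirichlet series of non-principal characters\<close>

lemma sum_shift_period_bound:
  assumes "m > 1" "dirichlet_char m \<xi>" "\<xi> \<noteq> principal_char m"
  shows "norm (\<Sum>k<n. \<xi> (Suc k)) \<le> real m"
proof -
  have "\<xi> 0 = 0" using assms by (simp add: dirichlet_char_eq_0_iff)
  then have "(\<Sum>k<n. \<xi> (Suc k)) = (\<Sum>k<Suc n. \<xi> k)" by (simp only: sum.lessThan_Suc_shift add_0)
  then show ?thesis using norm_sum_dirichlet_char_le[of m \<xi> "Suc n"] assms by simp
qed

lemma summable_L:
  assumes "m > 1" "dirichlet_char m \<xi>" "\<xi> \<noteq> principal_char m" "s > 0"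
  shows "summable (\<lambda>n. \<xi> n * of_real (real n powr - s))"
proof -
  have "summable (\<lambda>n. \<xi> (Suc n) * of_real (real (Suc n) powr - s))"
  proof (rule summable_Dirichlet_test[OF sum_shift_period_bound[OF assms(1-3)]])
    show "(\<lambda>n. real (Suc n) powr - s) \<longlonglongrightarrow> 0"
      using LIMSEQ_Suc[OF tendsto_neg_powr[OF _ filterlim_real_sequentially]] assms(4) by simp
    show "decseq (\<lambda>n. real (Suc n) powr - s)"
      using assms(4) by (auto simp: decseq_def intro!: powr_mono2')
  qed
  then show ?thesis by (subst (asm) summable_Suc_iff)
qed

text \<open>
  The mean value theorem, with a factor \<open>s - 1\<close> extracted from the derivative
  \<open>z ^ (-2) (s z ^ (1 - s) - 1)\<close>; the bound \<open>1 + ln z \<le> 2 \<surd>z\<close> makes the result summable over \<open>x\<close>.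
\<close>

lemma powr_difference_variation:
  fixes s :: real
  assumes "1 < s" "1 \<le> x"
  shows "\<bar>(x powr - 1 - x powr - s) - ((x + 1) powr - 1 - (x + 1) powr - s)\<bar> \<le> (s - 1) * (2 * x powr - (3/2))"
proof -
  define g' where "g' = (\<lambda>z::real. - (z powr - 2) + s * z powr (- 1 - s))"
  have "\<exists>z. x < z \<and> z < x + 1 \<and> ((x + 1) powr - 1 - (x + 1) powr - s) - (x powr - 1 - x powr - s) = (x + 1 - x) * g' z"
  proof (rule MVT2)
    fix z assume "x \<le> z"
    then show "((\<lambda>z. z powr - 1 - z powr - s) has_real_derivative g' z) (at z)"
      using DERIV_diff[OF has_real_derivative_powr[of z "- 1"] has_real_derivative_powr[of z "- s"]] assms
      by (simp add: g'_def algebra_simps minus_diff_commute[of s 1])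
  qed simp
  then obtain z where z: "x < z" and eq: "((x + 1) powr - 1 - (x + 1) powr - s) - (x powr - 1 - x powr - s) = g' z" by auto
  have z1: "z > 1" using z assms by simp
  define w where "w = z powr (1 - s)"
  have w: "g' z = - (z powr - 2) * (1 - s * w)"
    unfolding g'_def w_def by (simp add: algebra_simps powr_add[symmetric])
  have w0: "0 \<le> w" and w1: "w \<le> 1" using z1 assms(1) powr_mono[of "1 - s" 0 z] by (simp_all add: w_def)
  have "w = exp (- ((s - 1) * ln z))" using z1 by (simp add: w_def powr_def algebra_simps)
  then have wl: "1 - w \<le> (s - 1) * ln z" using exp_ge_add_one_self[of "- ((s - 1) * ln z)"] by simp
  have sw: "(s - 1) * w \<le> (s - 1) * 1" using w1 assms(1) by (intro mult_left_mono) auto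
  have sw0: "0 \<le> (s - 1) * w" using w0 assms(1) by simp
  have "1 - s * w = (1 - w) - (s - 1) * w" by (simp add: algebra_simps)
  moreover have "\<bar>a - b\<bar> \<le> X + Y" if "0 \<le> a" "a \<le> X" "0 \<le> b" "b \<le> Y" for a b X Y :: real
    using that by linarith
  ultimately have "\<bar>1 - s * w\<bar> \<le> (s - 1) * ln z + (s - 1)" using wl sw sw0 w1 by simp
  also have "\<dots> = (s - 1) * (1 + ln z)" by (simp add: algebra_simps)
  also have "\<dots> \<le> (s - 1) * (2 * sqrt z)"
  proof (rule mult_left_mono)
    have "ln z = 2 * ln (sqrt z)" using z1 by (simp add: ln_sqrt)
    also have "\<dots> \<le> 2 * (sqrt z - 1)" using z1 by (intro mult_left_mono ln_le_minus_one) auto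
    finally show "1 + ln z \<le> 2 * sqrt z" by simp
  qed (use assms in simp)
  finally have b: "\<bar>1 - s * w\<bar> \<le> (s - 1) * (2 * sqrt z)" .
  have "\<bar>g' z\<bar> = z powr - 2 * \<bar>1 - s * w\<bar>" unfolding w by (simp add: abs_mult)
  also have "\<dots> \<le> z powr - 2 * ((s - 1) * (2 * sqrt z))" by (intro mult_left_mono b) auto
  also have "\<dots> = (s - 1) * (2 * z powr - (3/2))"
    using z1 by (simp add: powr_half_sqrt[symmetric] powr_add[symmetric])
  also have "\<dots> \<le> (s - 1) * (2 * x powr - (3/2))"
    using z assms by (intro mult_left_mono powr_mono2') auto
  finally show ?thesis using eq by (simp add: abs_minus_commute)
qed

text \<open>
  The partial sums of \<open>\<xi>\<close> are bounded, so the difference is at most a constant times the total variation of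
  \<open>n ^ (-1) - n ^ (-s)\<close>, which is of order \<open>s - 1\<close>.
\<close>

lemma L_lipschitz_at_1:
  assumes "m > 1" "dirichlet_char m \<xi>" "\<xi> \<noteq> principal_char m"
  obtains C where "C > 0" "\<And>s. s > 1 \<Longrightarrow> norm (dirichlet_L \<xi> s - dirichlet_L \<xi> 1) \<le> C * (s - 1)"
proof -
  define T where "T = (\<Sum>n. 2 * real n powr - (3/2))"
  have sT: "summable (\<lambda>n. 2 * real n powr - (3/2))" by (intro summable_mult summable_powr) simp
  have bound: "norm (dirichlet_L \<xi> s - dirichlet_L \<xi> 1) \<le> real m * T * (s - 1)" if s: "s > 1" for s
  proof -
    define a where "a = (\<lambda>n. real n powr - 1 - real n powr - s)"
    have var: "\<bar>a n - a (Suc n)\<bar> \<le> (s - 1) * (2 * real n powr - (3/2))" for n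
    proof (cases "n = 0")
      case False
      then show ?thesis using powr_difference_variation[OF s, of "real n"] by (simp add: a_def add.commute)
    qed (simp add: a_def)
    have sv: "summable (\<lambda>n. \<bar>a n - a (Suc n)\<bar>)"
      by (rule summable_comparison_test'[OF summable_mult[OF sT, of "s - 1"], of 0]) (use var in simp)
    have a0: "a \<longlonglongrightarrow> 0"
    proof -
      have "(\<lambda>n. real n powr - 1 - real n powr - s) \<longlonglongrightarrow> 0 - 0"
        by (intro tendsto_diff tendsto_neg_powr filterlim_real_sequentially) (use s in auto)
      then show ?thesis by (simp add: a_def)
    qed
    have "dirichlet_L \<xi> 1 - dirichlet_L \<xi> s = (\<Sum>n. \<xi> n * of_real (a n))"
      unfolding dirichlet_L_def a_def using s
      by (subst suminf_diff[OF summable_L[OF assms] summable_L[OF assms]]) (auto simp: algebra_simps)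
    then have "norm (dirichlet_L \<xi> s - dirichlet_L \<xi> 1) \<le> real m * (\<Sum>n. \<bar>a n - a (Suc n)\<bar>)"
      using norm_suminf_bounded_variation[OF norm_sum_dirichlet_char_le[OF _ assms(2,3)] a0 sv] assms(1)
      by (simp add: norm_minus_commute)
    also have "\<dots> \<le> real m * (\<Sum>n. (s - 1) * (2 * real n powr - (3/2)))"
      by (intro mult_left_mono suminf_le[OF var sv summable_mult[OF sT]]) auto
    also have "\<dots> = real m * T * (s - 1)" unfolding T_def by (subst suminf_mult[OF sT]) simp
    finally show ?thesis .
  qed
  have "T \<ge> 0" unfolding T_def by (intro suminf_nonneg sT) auto
  then have "real m * T + 1 > 0" by (simp add: add_nonneg_pos)
  moreover have "norm (dirichlet_L \<xi> s - dirichlet_L \<xi> 1) \<le> (real m * T + 1) * (s - 1)" if "s > 1" for s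
    using bound[OF that] that by (simp add: algebra_simps)
  ultimately show thesis by (rule that)
qed

section \<open>Non-vanishing at 1 for real characters\<close>

definition divisor_sum :: "(nat \<Rightarrow> real) \<Rightarrow> nat \<Rightarrow> real" where
  "divisor_sum r n = (\<Sum>d | d dvd n. r d)"

lemma divisor_sum_prime_power_mult:
  fixes p k n :: nat
  assumes r: "\<And>a b. r (a * b) = r a * r b" "r (Suc 0) = 1" and "prime p" "\<not> p dvd n" "n > 0"
  shows "divisor_sum r (p ^ k * n) = (\<Sum>i\<le>k. r p ^ i) * divisor_sum r n"
proof -
  have rp: "r (p ^ i) = r p ^ i" for i by (induction i) (simp_all add: r)
  have cop: "coprime (p ^ i) d" if "d dvd n" for i d
    using assms that by (metis coprime_power_left_iff dvd_trans prime_imp_coprime)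
  have inj: "inj_on (\<lambda>(i, d). p ^ i * d) ({..k} \<times> {d. d dvd n})"
  proof (rule inj_onI, clarsimp)
    fix i d i' d' assume *: "p ^ i * d = p ^ i' * d'" "d dvd n" "d' dvd n"
    have nd: "\<not> p dvd d" "\<not> p dvd d'" using * assms dvd_trans by blast+
    have mult: "multiplicity p (p ^ j * e) = j" if "\<not> p dvd e" "e dvd n" for j e
    proof -
      have "e \<noteq> 0" using that assms(5) by (auto dest: dvd_pos_nat)
      then show ?thesis
        using that(1) assms(3) by (simp add: prime_elem_multiplicity_mult_distrib not_dvd_imp_multiplicity_0)
    qed
    have "multiplicity p (p ^ i * d) = i" "multiplicity p (p ^ i' * d') = i'"
      using mult nd * by blast+
    then show "i = i' \<and> d = d'" using * assms(3) by (auto simp: prime_gt_0_nat)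
  qed
  have img: "(\<lambda>(i, d). p ^ i * d) ` ({..k} \<times> {d. d dvd n}) = {d. d dvd p ^ k * n}"
  proof (intro equalityI subsetI)
    fix d assume "d \<in> {d. d dvd p ^ k * n}"
    then obtain a b where ab: "d = a * b" "a dvd p ^ k" "b dvd n" by (auto elim: dvd_productE)
    then obtain i where "i \<le> k" "a = p ^ i" using assms(3) by (auto simp: divides_primepow_nat)
    with ab show "d \<in> (\<lambda>(i, d). p ^ i * d) ` ({..k} \<times> {d. d dvd n})" by auto
  qed (auto intro!: mult_dvd_mono le_imp_power_dvd)
  have "divisor_sum r (p ^ k * n) = (\<Sum>(i, d)\<in>{..k} \<times> {d. d dvd n}. r (p ^ i * d))"
    unfolding divisor_sum_def img[symmetric] by (subst sum.reindex[OF inj]) (simp add: o_def case_prod_unfold)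
  also have "\<dots> = (\<Sum>i\<le>k. r p ^ i) * divisor_sum r n"
    unfolding divisor_sum_def by (simp add: r(1) rp sum_product sum.cartesian_product)
  finally show ?thesis .
qed

text \<open>
  By multiplicativity it suffices to look at prime powers, where the sum is
  \<open>1 + r p + ... + (r p) ^ k\<close> with \<open>r p \<in> {-1, 0, 1}\<close>: never negative, and at least 1 for even \<open>k\<close>.
\<close>

lemma divisor_sum_nonneg_and_squares:
  fixes r :: "nat \<Rightarrow> real"
  assumes r: "\<And>a b. r (a * b) = r a * r b" "r (Suc 0) = 1" and vals: "\<And>a. r a \<in> {-1, 0, 1}" and "n > 0"
  shows "divisor_sum r n \<ge> 0 \<and> divisor_sum r (n\<^sup>2) \<ge> 1"
  using \<open>n > 0\<close>
proof (induction n rule: less_induct)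
  case (less n)
  show ?case
  proof (cases "n = 1")
    case True
    then show ?thesis by (simp add: divisor_sum_def r)
  next
    case False
    then obtain p where p: "prime p" "p dvd n" using prime_factor_nat by blast
    define k where "k = multiplicity p n"
    obtain n' where n': "n = p ^ k * n'" "\<not> p dvd n'"
      unfolding k_def using multiplicity_decompose'[of n p thesis] less.prems not_prime_unit[of p] p(1) by blast
    have "k > 0" using p less.prems by (simp add: k_def prime_multiplicity_gt_zero_iff)
    then have "p ^ k > 1" using p(1) using prime_gt_1_nat[OF p(1)] by (intro one_less_power) auto
    have n'0: "n' > 0" using n' less.prems by (cases n') auto
    then have lt: "n' < n" using n'(1) \<open>p ^ k > 1\<close> by simp
    have IH: "divisor_sum r n' \<ge> 0" "divisor_sum r (n'\<^sup>2) \<ge> 1" using less.IH[OF lt n'0] by auto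
    have rp: "r p = 1 \<or> r p = 0 \<or> r p = -1" using vals[of p] by auto
    have alt: "(\<Sum>i\<le>j. (-1::real) ^ i) = (if even j then 1 else 0)" for j by (induction j) auto
    have zer: "(\<Sum>i\<le>j. (0::real) ^ i) = 1" for j by (induction j) auto
    have s0: "(\<Sum>i\<le>k. r p ^ i) \<ge> 0" using rp alt[of k] zer[of k] by auto
    have s1: "(\<Sum>i\<le>2*k. r p ^ i) \<ge> 1" using rp alt[of "2*k"] zer[of "2*k"] by auto
    have "divisor_sum r n = (\<Sum>i\<le>k. r p ^ i) * divisor_sum r n'"
      unfolding n'(1) by (rule divisor_sum_prime_power_mult) (use r p n' n'0 in auto)
    moreover have "n\<^sup>2 = p ^ (2 * k) * n'\<^sup>2" by (simp add: n'(1) power_mult_distrib power_mult[symmetric] mult.commute)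
    moreover have "divisor_sum r (p ^ (2 * k) * n'\<^sup>2) = (\<Sum>i\<le>2*k. r p ^ i) * divisor_sum r (n'\<^sup>2)"
      by (rule divisor_sum_prime_power_mult) (use r p n' n'0 in \<open>auto simp: prime_dvd_power_iff\<close>)
    ultimately show ?thesis
      using mult_nonneg_nonneg[OF s0 IH(1)] mult_mono[OF s1 IH(2)] s1 by simp
  qed
qed

lemma has_sum_geometric:
  fixes y :: real
  assumes "0 \<le> y" "y < 1"
  shows "((\<lambda>j. y ^ j) has_sum y / (1 - y)) {1..}"
proof -
  have "(\<lambda>j. y ^ Suc j) sums (y * (1 / (1 - y)))"
    using sums_mult[OF geometric_sums[of y], of y] assms by simp
  then have "((\<lambda>j. y ^ Suc j) has_sum y / (1 - y)) UNIV"
    using assms by (intro norm_summable_imp_has_sum) (auto simp: sums_iff abs_mult power_abs)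
  then have "((\<lambda>j. y ^ j) has_sum y / (1 - y)) (range Suc)"
    by (subst has_sum_reindex) (auto simp: o_def)
  also have "range Suc = {1..}" using greaterThan_0 by (auto simp: atLeast_Suc_greaterThan)
  finally show ?thesis .
qed

text \<open>
  Expanding \<open>x ^ n / (1 - x ^ n)\<close> into powers of \<open>x\<close> and collecting the pairs \<open>(n, j)\<close> by their product
  \<open>n j\<close> turns the Lambert series of \<open>r\<close> into the power series of its divisor sums.
\<close>

lemma lambert_series:
  fixes r :: "nat \<Rightarrow> real" and x :: real
  assumes r: "\<And>n. \<bar>r n\<bar> \<le> 1" and x: "0 < x" "x < 1"
  shows "((\<lambda>n. r n * (x ^ n / (1 - x ^ n))) abs_summable_on {1..})"
    and "(\<lambda>n. divisor_sum r n * x ^ n) summable_on {1..}"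
    and "(\<Sum>\<^sub>\<infinity>n\<in>{1..}. r n * (x ^ n / (1 - x ^ n))) = (\<Sum>\<^sub>\<infinity>n\<in>{1..}. divisor_sum r n * x ^ n)"
proof -
  define h where "h = (\<lambda>(n, j). r n * x ^ (n * j))"
  have xn: "0 \<le> x ^ n" "x ^ n < 1" if "n \<ge> 1" for n using x that by (auto simp: power_less_one_iff)
  have row: "((\<lambda>j. r n * x ^ (n * j)) has_sum r n * (x ^ n / (1 - x ^ n))) {1..}" if "n \<in> {1..}" for n
    using has_sum_cmult_right[OF has_sum_geometric[OF xn, of n], of "r n"] that by (simp add: power_mult)
  have row': "((\<lambda>j. norm (r n * x ^ (n * j))) has_sum \<bar>r n\<bar> * (x ^ n / (1 - x ^ n))) {1..}" if "n \<in> {1..}" for n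
    using has_sum_cmult_right[OF has_sum_geometric[OF xn, of n], of "\<bar>r n\<bar>"] that x by (simp add: power_mult abs_mult)
  have le: "\<bar>r n\<bar> * (x ^ n / (1 - x ^ n)) \<le> x ^ n / (1 - x)" if "n \<in> {1..}" for n
  proof -
    have "x ^ n \<le> x ^ 1" using that x by (intro power_decreasing) auto
    then have "x ^ n / (1 - x ^ n) \<le> x ^ n / (1 - x)" using x xn[of n] that by (intro divide_left_mono) auto
    moreover have "\<bar>r n\<bar> * (x ^ n / (1 - x ^ n)) \<le> 1 * (x ^ n / (1 - x ^ n))"
      using xn[of n] that r by (intro mult_right_mono) auto
    ultimately show ?thesis by simp
  qed
  have sg: "(\<lambda>n. x ^ n / (1 - x)) summable_on {1..}"
    unfolding divide_inverse using has_sum_imp_summable[OF has_sum_geometric[of x]] x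
    by (intro summable_on_cmult_left) auto
  have nn: "0 \<le> \<bar>r n\<bar> * (x ^ n / (1 - x ^ n))" if "n \<in> {1..}" for n
    using xn[of n] that by simp
  have rs: "(\<lambda>n. \<bar>r n\<bar> * (x ^ n / (1 - x ^ n))) summable_on {1..}"
    by (rule summable_on_comparison_test[OF sg le nn])
  then show "((\<lambda>n. r n * (x ^ n / (1 - x ^ n))) abs_summable_on {1..})"
  proof (rule summable_on_cong[THEN iffD1, rotated])
    fix n :: nat assume "n \<in> {1..}"
    then show "\<bar>r n\<bar> * (x ^ n / (1 - x ^ n)) = norm (r n * (x ^ n / (1 - x ^ n)))"
      using xn[of n] by (simp add: abs_mult abs_of_pos)
  qed
  have "h abs_summable_on {1..} \<times> {1..}"
    unfolding abs_summable_on_Sigma_iff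
  proof (intro conjI ballI)
    fix n :: nat assume n: "n \<in> {1..}"
    show "(\<lambda>y. h (n, y)) abs_summable_on {1..}"
      using has_sum_imp_summable[OF row'[OF n]] by (simp add: h_def)
  next
    have "norm (\<Sum>\<^sub>\<infinity>y\<in>{1..}. norm (h (n, y))) = \<bar>r n\<bar> * (x ^ n / (1 - x ^ n))" if "n \<in> {1..}" for n
      using infsumI[OF row'[OF that]] nn[OF that] unfolding h_def by (simp only: prod.case real_norm_def abs_of_nonneg)
    then show "(\<lambda>n. \<Sum>\<^sub>\<infinity>y\<in>{1..}. norm (h (n, y))) abs_summable_on {1..}"
      by (rule summable_on_cong[THEN iffD2, OF _ rs])
  qed
  then have hs: "h summable_on {1..} \<times> {1..}" by (rule abs_summable_summable)
  have S: "infsum h ({1..} \<times> {1..}) = (\<Sum>\<^sub>\<infinity>n\<in>{1..}. r n * (x ^ n / (1 - x ^ n)))"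
    unfolding infsum_Sigma_banach[OF hs, symmetric]
    by (rule infsum_cong) (simp only: h_def prod.case infsumI[OF row])
  define T where "T = Sigma {1..} (\<lambda>N::nat. {d. d dvd N})"
  define h' where "h' = (\<lambda>(N::nat, d). r d * x ^ N)"
  have bij: "bij_betw (\<lambda>(n, j). (n * j, n)) ({1..} \<times> {1..}) T"
    by (rule bij_betwI[where g = "\<lambda>(N, d). (d, N div d)"]) (auto simp: T_def Suc_le_eq elim!: dvdE)
  have hh: "h y = h' (case y of (n, j) \<Rightarrow> (n * j, n))" for y by (cases y) (simp add: h_def h'_def)
  have hs': "h' summable_on T"
    using hs summable_on_reindex_bij_betw[OF bij, of h'] by (simp add: hh[abs_def])
  have S': "infsum h' T = infsum h ({1..} \<times> {1..})"
    using infsum_reindex_bij_betw[OF bij, of h'] by (simp add: hh[abs_def])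
  have fin: "(\<Sum>\<^sub>\<infinity>d | d dvd N. h' (N, d)) = divisor_sum r N * x ^ N" if "N \<in> {1..}" for N
    using that by (subst infsum_finite) (auto simp: h'_def divisor_sum_def sum_distrib_right)
  show "(\<lambda>n. divisor_sum r n * x ^ n) summable_on {1..}"
    using summable_on_Sigma_banach[of "\<lambda>N d. h' (N, d)"] hs' fin
    unfolding T_def by (subst summable_on_cong[OF fin[symmetric]]) auto
  have "infsum h' T = (\<Sum>\<^sub>\<infinity>n\<in>{1..}. divisor_sum r n * x ^ n)"
    unfolding T_def infsum_Sigma_banach[OF hs'[unfolded T_def], symmetric]
    by (rule infsum_cong) (rule fin)
  then show "(\<Sum>\<^sub>\<infinity>n\<in>{1..}. r n * (x ^ n / (1 - x ^ n))) = (\<Sum>\<^sub>\<infinity>n\<in>{1..}. divisor_sum r n * x ^ n)"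
    using S S' by simp
qed

text \<open>
  Divided by \<open>1 - y ^ 2\<close> the right-hand side is the sum of the \<open>y ^ (2 i)\<close>; pairing the terms \<open>i\<close> and
  \<open>n - i\<close>, the arithmetic mean dominates the geometric mean \<open>y ^ n\<close>.
\<close>

lemma one_minus_power_lower_bound:
  fixes y :: real
  assumes "0 < y" "y < 1"
  shows "real (Suc n) * (1 - y\<^sup>2) * y ^ n \<le> 1 - (y\<^sup>2) ^ Suc n"
proof -
  have "2 * (real (Suc n) * y ^ n) = (\<Sum>i<Suc n. 2 * y ^ n)" by simp
  also have "\<dots> \<le> (\<Sum>i<Suc n. (y\<^sup>2) ^ i + (y\<^sup>2) ^ (n - i))"
  proof (rule sum_mono)
    fix i assume "i \<in> {..<Suc n}"
    then have "y ^ n = y ^ i * y ^ (n - i)" by (simp add: power_add[symmetric])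
    moreover have "0 \<le> (y ^ i - y ^ (n - i))\<^sup>2" by simp
    ultimately show "2 * y ^ n \<le> (y\<^sup>2) ^ i + (y\<^sup>2) ^ (n - i)"
      by (simp add: power2_eq_square algebra_simps power_mult_distrib)
  qed
  also have "\<dots> = 2 * (\<Sum>i<Suc n. (y\<^sup>2) ^ i)"
    using sum.nat_diff_reindex[of "\<lambda>i. (y\<^sup>2) ^ i" "Suc n"] by (simp add: sum.distrib)
  finally have "(1 - y\<^sup>2) * (real (Suc n) * y ^ n) \<le> (1 - y\<^sup>2) * (\<Sum>i<Suc n. (y\<^sup>2) ^ i)"
    using assms by (intro mult_left_mono) (auto simp: power_le_one)
  also have "\<dots> = 1 - (y\<^sup>2) ^ Suc n" by (rule one_diff_power_eq[symmetric])
  finally show ?thesis by (simp add: mult_ac)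
qed

text \<open>
  The difference between the coefficients of \<open>r n\<close> in \<open>(\<Sum>n. r n / n) / (1 - x)\<close> and in the Lambert series;
  the index is shifted so that it starts at 0.
\<close>

definition lambert_kernel :: "real \<Rightarrow> nat \<Rightarrow> real" where
  "lambert_kernel x n = 1 / real (Suc n) * (1 / (1 - x)) - x ^ Suc n / (1 - x ^ Suc n)"

lemma lambert_kernel_0: "x \<noteq> 1 \<Longrightarrow> lambert_kernel x 0 = 1"
  by (simp add: lambert_kernel_def field_simps)

lemma lambert_kernel_tendsto_0:
  assumes "0 < x" "x < 1"
  shows "lambert_kernel x \<longlonglongrightarrow> 0"
proof -
  have "(\<lambda>n. 1 / real (Suc n)) \<longlonglongrightarrow> 0" using LIMSEQ_Suc[OF lim_1_over_n] by simp
  moreover have "(\<lambda>n. x ^ Suc n) \<longlonglongrightarrow> 0" using LIMSEQ_Suc[OF LIMSEQ_power_zero[of x]] assms by simp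
  ultimately have "lambert_kernel x \<longlonglongrightarrow> 0 * (1 / (1 - x)) - 0 / (1 - 0)"
    unfolding lambert_kernel_def[abs_def] by (intro tendsto_intros) auto
  then show ?thesis by simp
qed

text \<open>
  With \<open>u = x ^ n\<close> this amounts to \<open>n (n + 1) (1 - x) ^ 2 u \<le> (1 - u) (1 - x u)\<close>, a product of two instances of
  the bound for \<open>1 - x ^ n\<close> at \<open>y = \<surd>x\<close>.
\<close>

lemma decseq_lambert_kernel:
  assumes x: "0 < x" "x < 1"
  shows "decseq (lambert_kernel x)"
  unfolding decseq_Suc_iff
proof
  fix n
  define y where "y = sqrt x"
  have y: "0 < y" "y < 1" and xy: "x = y\<^sup>2" using x by (auto simp: y_def)
  define N where "N = real (Suc n)"
  define u where "u = x ^ Suc n"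
  have N: "N > 0" by (simp add: N_def)
  have u: "0 < u" "u < 1" using x power_less_one_iff[of x "Suc n"] by (auto simp: u_def)
  have xu: "x * u < 1" using mult_strict_mono[OF x(2) u(2)] x u by simp
  have b1: "N * (1 - x) * y ^ n \<le> 1 - u"
    unfolding N_def u_def xy by (rule one_minus_power_lower_bound[OF y])
  have b2: "(N + 1) * (1 - x) * y ^ Suc n \<le> 1 - x * u"
    using one_minus_power_lower_bound[OF y, of "Suc n"] unfolding N_def u_def xy by (simp add: add_ac)
  have "u = y ^ n * y ^ Suc n * y"
    unfolding u_def xy by (simp add: power2_eq_square power_mult_distrib)
  also have "\<dots> \<le> y ^ n * y ^ Suc n" using y by (intro mult_right_le_one_le) auto
  finally have "N * (N + 1) * (1 - x)\<^sup>2 * u \<le> N * (N + 1) * (1 - x)\<^sup>2 * (y ^ n * y ^ Suc n)"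
    using N by (intro mult_left_mono) auto
  also have "\<dots> = (N * (1 - x) * y ^ n) * ((N + 1) * (1 - x) * y ^ Suc n)"
    by (simp add: power2_eq_square mult_ac)
  also have "\<dots> \<le> (1 - u) * (1 - x * u)" using b1 b2 N x y u by (intro mult_mono) auto
  finally have key: "N * (N + 1) * (1 - x)\<^sup>2 * u \<le> (1 - u) * (1 - x * u)" .
  have "u / (1 - u) - x * u / (1 - x * u) = (1 - x) * u / ((1 - u) * (1 - x * u))"
    using u xu by (simp add: field_simps)
  also have "\<dots> \<le> 1 / (N * (N + 1) * (1 - x))"
    using key u xu N x by (simp add: divide_simps power2_eq_square mult_ac)
  also have "\<dots> = (1 / N - 1 / (N + 1)) * (1 / (1 - x))"
    using N by (simp add: field_simps)
  also have "\<dots> = 1 / N * (1 / (1 - x)) - 1 / (N + 1) * (1 / (1 - x))" by (rule left_diff_distrib)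
  finally have "1 / (N + 1) * (1 / (1 - x)) - x * u / (1 - x * u) \<le> 1 / N * (1 / (1 - x)) - u / (1 - u)"
    by linarith
  then show "lambert_kernel x (Suc n) \<le> lambert_kernel x n"
    unfolding lambert_kernel_def N_def u_def by (simp add: add_ac)
qed

text \<open>
  If the sum vanished, minus the Lambert series of \<open>r\<close> would be the sum of \<open>r n\<close> against a decreasing kernel
  with first value 1, hence bounded by \<open>M\<close> uniformly in \<open>x\<close>.  But its power series has coefficients that
  are nonnegative and at least 1 at squares, so it is unbounded as \<open>x\<close> tends to 1.
\<close>

theorem real_character_sum_nonzero:
  fixes r :: "nat \<Rightarrow> real"
  assumes r: "\<And>a b. r (a * b) = r a * r b" "r (Suc 0) = 1" and vals: "\<And>a. r a \<in> {-1, 0, 1}"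
    and bounded: "\<And>n. norm (\<Sum>k<n. r (Suc k)) \<le> M"
  shows "(\<Sum>n. r (Suc n) * (1 / real (Suc n))) \<noteq> 0"
proof
  assume zero: "(\<Sum>n. r (Suc n) * (1 / real (Suc n))) = 0"
  have inv0: "(\<lambda>n. 1 / real (Suc n)) \<longlonglongrightarrow> 0" using LIMSEQ_Suc[OF lim_1_over_n] by simp
  have "decseq (\<lambda>n. 1 / real (Suc n))" by (auto simp: decseq_def intro!: divide_left_mono)
  from summable_Dirichlet_test[OF bounded inv0 this]
  have sm: "summable (\<lambda>n. r (Suc n) * (1 / real (Suc n)))" by simp
  have r1: "\<bar>r n\<bar> \<le> 1" for n using vals[of n] by auto
  have le: "(\<Sum>k\<in>{1..K}. x ^ k\<^sup>2) \<le> M" if x: "0 < x" "x < 1" for x :: real and K :: nat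
  proof -
    define F where "F = (\<Sum>\<^sub>\<infinity>n\<in>{1..}. r n * (x ^ n / (1 - x ^ n)))"
    note lam = lambert_series[of r, OF r1 x]
    have "((\<lambda>n. r n * (x ^ n / (1 - x ^ n))) has_sum F) {1..}"
      unfolding F_def by (rule has_sum_infsum[OF abs_summable_summable[OF lam(1)]])
    also have "{1..} = range Suc" using greaterThan_0 by (auto simp: atLeast_Suc_greaterThan)
    finally have "((\<lambda>n. r (Suc n) * (x ^ Suc n / (1 - x ^ Suc n))) has_sum F) UNIV"
      by (subst (asm) has_sum_reindex) (auto simp: o_def)
    then have F: "(\<lambda>n. r (Suc n) * (x ^ Suc n / (1 - x ^ Suc n))) sums F" by (rule has_sum_imp_sums)
    have "(\<lambda>n. r (Suc n) * (1 / real (Suc n)) * (1 / (1 - x)) - r (Suc n) * (x ^ Suc n / (1 - x ^ Suc n)))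
        sums (0 * (1 / (1 - x)) - F)"
      using summable_sums[OF sm] zero by (intro sums_diff sums_mult2 F) simp
    then have "(\<lambda>n. r (Suc n) * lambert_kernel x n) sums (- F)"
      by (simp add: lambert_kernel_def right_diff_distrib mult.assoc)
    then have "- F = (\<Sum>n. r (Suc n) * lambert_kernel x n)" by (rule sums_unique)
    moreover have "norm (\<Sum>n. r (Suc n) * lambert_kernel x n) \<le> M * 1"
      using norm_suminf_Dirichlet_test[OF bounded lambert_kernel_tendsto_0[OF x] decseq_lambert_kernel[OF x]]
        lambert_kernel_0[of x] x by simp
    ultimately have "F \<le> M" by simp
    have inj: "inj_on (\<lambda>k::nat. k\<^sup>2) {1..K}" by (auto simp: inj_on_def power2_eq_iff)
    have "(\<Sum>k\<in>{1..K}. x ^ k\<^sup>2) \<le> (\<Sum>k\<in>{1..K}. divisor_sum r (k\<^sup>2) * x ^ k\<^sup>2)"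
    proof (rule sum_mono)
      fix k assume "k \<in> {1..K}"
      then have "1 \<le> divisor_sum r (k\<^sup>2)" using divisor_sum_nonneg_and_squares[OF r vals, of k] by simp
      from mult_right_mono[OF this, of "x ^ k\<^sup>2"] show "x ^ k\<^sup>2 \<le> divisor_sum r (k\<^sup>2) * x ^ k\<^sup>2"
        using x by simp
    qed
    also have "\<dots> = (\<Sum>n\<in>(\<lambda>k. k\<^sup>2) ` {1..K}. divisor_sum r n * x ^ n)"
      by (simp only: sum.reindex[OF inj] o_def)
    also have "\<dots> \<le> (\<Sum>\<^sub>\<infinity>n\<in>{1..}. divisor_sum r n * x ^ n)"
      using divisor_sum_nonneg_and_squares[OF r vals] x
      by (intro finite_sum_le_infsum[OF lam(2)]) auto
    also have "\<dots> = F" unfolding F_def using lam(3) by simp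
    finally show ?thesis using \<open>F \<le> M\<close> by simp
  qed
  define K where "K = nat \<lceil>M\<rceil> + 1"
  have "((\<lambda>x::real. \<Sum>k\<in>{1..K}. x ^ k\<^sup>2) \<longlongrightarrow> (\<Sum>k\<in>{1..K}. 1 ^ k\<^sup>2)) (at_left 1)"
    by (intro tendsto_intros)
  moreover have "\<forall>\<^sub>F x::real in at_left 1. (\<Sum>k\<in>{1..K}. x ^ k\<^sup>2) \<le> M"
    unfolding eventually_at_left_field by (intro exI[of _ 0]) (use le in auto)
  ultimately have "(\<Sum>k\<in>{1..K}. (1::real) ^ k\<^sup>2) \<le> M"
    by (rule tendsto_upperbound) simp
  then have "real K \<le> M" by simp
  then show False unfolding K_def by linarith
qed

lemma L_1_real_nonzero:
  assumes "m > 1" "dirichlet_char m \<xi>" "\<xi> \<noteq> principal_char m" "(\<lambda>a. cnj (\<xi> a)) = \<xi>"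
  shows "dirichlet_L \<xi> 1 \<noteq> 0"
proof -
  define r where "r = (\<lambda>n. Re (\<xi> n))"
  have \<xi>r: "\<xi> n = of_real (r n)" for n
    using fun_cong[OF assms(4), of n] by (simp add: r_def complex_eq_iff)
  have vals: "r n \<in> {-1, 0, 1}" for n
    using norm_dirichlet_char[OF _ assms(2), of n] assms(1) unfolding \<xi>r norm_of_real
    by (auto split: if_splits)
  have mult: "r (a * b) = r a * r b" for a b
    using dirichlet_char_mult[OF assms(2), of a b] unfolding \<xi>r by (simp flip: of_real_mult)
  have one: "r (Suc 0) = 1" using dirichlet_char_1[OF assms(2)] unfolding \<xi>r by simp
  have bd: "norm (\<Sum>k<n. r (Suc k)) \<le> real m" for n
    using sum_shift_period_bound[OF assms(1-3), of n] unfolding \<xi>r by (simp flip: of_real_sum)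
  have "summable (\<lambda>n. of_real (r n * real n powr - 1) :: complex)"
    using summable_L[OF assms(1-3), of 1] unfolding \<xi>r by simp
  then have sm: "summable (\<lambda>n. r n * real n powr - 1)" by (simp only: summable_complex_of_real)
  have "dirichlet_L \<xi> 1 = of_real (\<Sum>n. r n * real n powr - 1)"
    unfolding dirichlet_L_def \<xi>r by (subst suminf_of_real[OF sm]) simp
  also have "(\<Sum>n. r n * real n powr - 1) = (\<Sum>n. r (Suc n) * (1 / real (Suc n)))"
    using suminf_split_head[OF sm] by (simp add: powr_minus_divide)
  finally show ?thesis
    using real_character_sum_nonzero[of r, OF mult one vals bd] by (simp only: of_real_eq_0_iff not_False_eq_True)
qed

section \<open>The density of the primes in the residue class of 1\<close>

lemma has_sum_sum:
  fixes f :: "'i \<Rightarrow> 'a \<Rightarrow> real"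
  assumes "finite I" "\<And>i. i \<in> I \<Longrightarrow> (f i has_sum S i) A"
  shows "((\<lambda>x. \<Sum>i\<in>I. f i x) has_sum (\<Sum>i\<in>I. S i)) A"
  using assms by (induction I rule: finite_induct) (auto intro!: has_sum_add)

definition prime_sum :: "nat set \<Rightarrow> real \<Rightarrow> real" where
  "prime_sum S s = (\<Sum>\<^sub>\<infinity>p\<in>S. real p powr - s)"

lemma prime_sum_nonneg: "prime_sum S s \<ge> 0"
  unfolding prime_sum_def by (intro infsum_nonneg) auto

text \<open>
  Bounds what the squares and higher powers of primes contribute to \<open>ln |L(s, \<xi>)|\<close>, uniformly in \<open>s\<close> and \<open>\<xi>\<close>.
\<close>

definition L_error :: real where "L_error = 13 * (\<Sum>\<^sub>\<infinity>n. real n powr - 2)"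

lemma L_error_nonneg: "L_error \<ge> 0"
  unfolding L_error_def by (intro mult_nonneg_nonneg infsum_nonneg) auto

text \<open>
  Each \<open>ln |L(s, \<xi>)|\<close> is the sum of \<open>Re (\<xi> p) p ^ (-s)\<close> over the primes up to a bounded error, and
  orthogonality singles out the primes congruent to 1.
\<close>

lemma sum_ln_norm_L:
  assumes m: "m > 1" and s: "s > 1"
    and sep: "\<And>a. coprime a m \<Longrightarrow> a mod m \<noteq> 1 \<Longrightarrow> \<exists>\<xi>. dirichlet_char m \<xi> \<and> \<xi> a \<noteq> 1"
  shows "\<bar>(\<Sum>\<xi> | dirichlet_char m \<xi>. ln (norm (dirichlet_L \<xi> s))) -
     real (card {\<xi>. dirichlet_char m \<xi>}) * prime_sum {p. prime p \<and> p mod m = 1} s\<bar>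
     \<le> real (card {\<xi>. dirichlet_char m \<xi>}) * L_error"
proof -
  let ?D = "{\<xi>. dirichlet_char m \<xi>}"
  have m0: "m > 0" using m by simp
  define A where "A = (\<lambda>\<xi>::nat \<Rightarrow> complex. \<Sum>\<^sub>\<infinity>p\<in>{p. prime p}. Re (\<xi> p) * real p powr - s)"
  have hs: "((\<lambda>p. Re (\<xi> p) * real p powr - s) has_sum A \<xi>) {p. prime p}" if "\<xi> \<in> ?D" for \<xi>
  proof -
    have "(\<lambda>p. Re (\<xi> p * of_real (real p powr - s))) summable_on {p. prime p}"
      by (rule summable_on_Re[OF abs_summable_summable[OF abs_summable_L[OF m0 _ s]]]) (use that in auto)
    then show ?thesis unfolding A_def by (intro has_sum_infsum) simp
  qed
  have "((\<lambda>p. \<Sum>\<xi>\<in>?D. Re (\<xi> p) * real p powr - s) has_sum (\<Sum>\<xi>\<in>?D. A \<xi>)) {p. prime p}"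
    by (intro has_sum_sum finite_dirichlet_char m0 hs)
  also have "(\<lambda>p. \<Sum>\<xi>\<in>?D. Re (\<xi> p) * real p powr - s) =
      (\<lambda>p. if p mod m = 1 then real (card ?D) * real p powr - s else 0)"
  proof
    fix p
    have "(\<Sum>\<xi>\<in>?D. Re (\<xi> p) * real p powr - s) = Re (\<Sum>\<xi>\<in>?D. \<xi> p) * real p powr - s"
      by (simp add: sum_distrib_right)
    also have "\<dots> = (if p mod m = 1 then real (card ?D) * real p powr - s else 0)"
      by (subst sum_all_dirichlet_chars[OF m sep]) simp_all
    finally show "(\<Sum>\<xi>\<in>?D. Re (\<xi> p) * real p powr - s) = (if p mod m = 1 then real (card ?D) * real p powr - s else 0)" .
  qed
  finally have "((\<lambda>p. if p mod m = 1 then real (card ?D) * real p powr - s else 0) has_sum (\<Sum>\<xi>\<in>?D. A \<xi>)) {p. prime p}" .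
  then have "((\<lambda>p. real (card ?D) * real p powr - s) has_sum (\<Sum>\<xi>\<in>?D. A \<xi>)) {p. prime p \<and> p mod m = 1}"
    by (rule has_sum_cong_neutral[THEN iffD1, rotated -1]) auto
  moreover have "((\<lambda>p. real (card ?D) * real p powr - s) has_sum
      (real (card ?D) * prime_sum {p. prime p \<and> p mod m = 1} s)) {p. prime p \<and> p mod m = 1}"
    unfolding prime_sum_def by (intro has_sum_cmult_right has_sum_infsum summable_on_powr s)
  ultimately have eq: "(\<Sum>\<xi>\<in>?D. A \<xi>) = real (card ?D) * prime_sum {p. prime p \<and> p mod m = 1} s"
    by (rule has_sum_unique)
  have "\<bar>(\<Sum>\<xi>\<in>?D. ln (norm (dirichlet_L \<xi> s))) - (\<Sum>\<xi>\<in>?D. A \<xi>)\<bar> \<le> (\<Sum>\<xi>\<in>?D. \<bar>ln (norm (dirichlet_L \<xi> s)) - A \<xi>\<bar>)"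
    unfolding sum_subtractf[symmetric] by (rule sum_abs)
  also have "\<dots> \<le> (\<Sum>\<xi>\<in>?D. L_error)"
    unfolding A_def L_error_def by (intro sum_mono ln_norm_L) (use m s in auto)
  finally show ?thesis unfolding eq by simp
qed

text \<open>
  Comparison of \<open>n ^ (-s)\<close> with the increments of \<open>n ^ (1 - s) / (1 - s)\<close>.
\<close>

lemma suminf_powr_le:
  assumes "s > 1"
  shows "(\<Sum>n. real n powr - s) \<le> 1 + 1 / (s - 1)"
proof -
  define b where "b = (\<lambda>n. real (Suc n) powr (1 - s) / (s - 1))"
  have b0: "b \<longlonglongrightarrow> 0"
  proof -
    have "(\<lambda>n. real (Suc n) powr (1 - s)) \<longlonglongrightarrow> 0"
      using assms by (intro LIMSEQ_Suc[OF tendsto_neg_powr[OF _ filterlim_real_sequentially]]) simp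
    then have "b \<longlonglongrightarrow> 0 / (s - 1)" unfolding b_def using assms by (intro tendsto_divide tendsto_const) auto
    then show ?thesis by simp
  qed
  have le: "real (Suc (Suc n)) powr - s \<le> b n - b (Suc n)" for n
  proof -
    have "\<exists>z. real (Suc n) < z \<and> z < real (Suc (Suc n)) \<and>
        real (Suc (Suc n)) powr (1 - s) - real (Suc n) powr (1 - s) =
        (real (Suc (Suc n)) - real (Suc n)) * ((1 - s) * z powr (1 - s - 1))"
    proof (rule MVT2)
      fix z assume "real (Suc n) \<le> z"
      then have "z > 0" by linarith
      then show "((\<lambda>z. z powr (1 - s)) has_real_derivative (1 - s) * z powr (1 - s - 1)) (at z)"
        by (rule has_real_derivative_powr)
    qed simp
    then obtain z where z: "real (Suc n) < z" "z < real (Suc (Suc n))"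
      and eq: "real (Suc (Suc n)) powr (1 - s) - real (Suc n) powr (1 - s) = (1 - s) * z powr - s" by auto
    have "b n - b (Suc n) = z powr - s"
    proof -
      have "b n - b (Suc n) = - (real (Suc (Suc n)) powr (1 - s) - real (Suc n) powr (1 - s)) / (s - 1)"
        unfolding b_def by (simp add: diff_divide_distrib)
      also have "\<dots> = (s - 1) * z powr - s / (s - 1)" unfolding eq by (simp add: algebra_simps)
      finally show ?thesis using assms by simp
    qed
    moreover have "real (Suc (Suc n)) powr - s \<le> z powr - s"
      using z assms by (intro powr_mono2') auto
    ultimately show ?thesis by simp
  qed
  have tel: "(\<lambda>n. b n - b (Suc n)) sums (b 0 - 0)" by (rule telescope_sums'[OF b0])
  have sm: "summable (\<lambda>n. real n powr - s)" by (rule summable_powr[OF assms])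
  have sm1: "summable (\<lambda>n. real (Suc n) powr - s)" using sm by (subst summable_Suc_iff)
  have sm2: "summable (\<lambda>n. real (Suc (Suc n)) powr - s)" 
    using sm1 by (subst summable_Suc_iff[of "\<lambda>n. real (Suc n) powr - s"])
  have "(\<Sum>n. real n powr - s) = 1 + (\<Sum>n. real (Suc (Suc n)) powr - s)"
    using suminf_split_head[OF sm] suminf_split_head[OF sm1] by simp
  also have "(\<Sum>n. real (Suc (Suc n)) powr - s) \<le> (\<Sum>n. b n - b (Suc n))"
    by (rule suminf_le[OF le sm2 sums_summable[OF tel]])
  also have "\<dots> = 1 / (s - 1)" using sums_unique[OF tel] by (simp add: b_def)
  finally show ?thesis by simp
qed

lemma norm_L_le:
  assumes "m > 0" "dirichlet_char m \<xi>" "s > 1"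
  shows "norm (dirichlet_L \<xi> s) \<le> 1 + 1 / (s - 1)"
proof -
  have le: "norm (\<xi> n * of_real (real n powr - s)) \<le> real n powr - s" for n
    using norm_dirichlet_char_le[OF assms(1,2), of n] by (simp add: norm_mult mult_left_le_one_le)
  have sm: "summable (\<lambda>n. norm (\<xi> n * of_real (real n powr - s)))"
    by (rule summable_comparison_test'[OF summable_powr[OF assms(3)], of 0]) (use le in auto)
  have "norm (dirichlet_L \<xi> s) \<le> (\<Sum>n. norm (\<xi> n * of_real (real n powr - s)))"
    unfolding dirichlet_L_def by (rule summable_norm[OF sm])
  also have "\<dots> \<le> (\<Sum>n. real n powr - s)"
    by (rule suminf_le[OF le sm summable_powr[OF assms(3)]])
  also have "\<dots> \<le> 1 + 1 / (s - 1)" by (rule suminf_powr_le[OF assms(3)])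
  finally show ?thesis .
qed

text \<open>
  Suppose that \<open>L(1, \<xi>) = 0\<close> with \<open>\<xi>\<close> not real.  As \<open>s\<close> tends to 1, the sum of the logarithms over all characters
  is then at most \<open>ln (s - 1)\<close> plus a constant: \<open>\<xi>\<close> and its conjugate contribute \<open>2 ln (s - 1)\<close>, the principal
  character \<open>- ln (s - 1)\<close>, and the others are bounded above.  This contradicts the lower bound from the
  sum over primes, which is not negative.
\<close>

lemma L_1_nonzero:
  assumes m: "m > 1" and char: "dirichlet_char m \<xi>" and np: "\<xi> \<noteq> principal_char m"
    and sep: "\<And>a. coprime a m \<Longrightarrow> a mod m \<noteq> 1 \<Longrightarrow> \<exists>\<xi>. dirichlet_char m \<xi> \<and> \<xi> a \<noteq> 1"
  shows "dirichlet_L \<xi> 1 \<noteq> 0"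
proof (cases "(\<lambda>a. cnj (\<xi> a)) = \<xi>")
  case True
  then show ?thesis by (rule L_1_real_nonzero[OF assms(1-3)])
next
  case nonreal: False
  show ?thesis
  proof
    assume zero: "dirichlet_L \<xi> 1 = 0"
    have m0: "m > 0" using m by simp
    define \<eta> where "\<eta> = (\<lambda>a. cnj (\<xi> a))"
    let ?D = "{\<xi>. dirichlet_char m \<xi>}" and ?P = "principal_char m"
    have \<eta>: "dirichlet_char m \<eta>" unfolding \<eta>_def by (rule dirichlet_char_cnj[OF char])
    have \<eta>np: "\<eta> \<noteq> ?P"
    proof
      assume "\<eta> = ?P"
      then have "\<xi> a = cnj (?P a)" for a unfolding \<eta>_def by (metis complex_cnj_cnj)
      then have "\<xi> = ?P" by (auto simp: principal_char_def fun_eq_iff)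
      with np show False by simp
    qed
    \<comment> \<open>A lower bound for the order of vanishing of the series of \<open>\<psi>\<close> at 1.\<close>
    define e where "e = (\<lambda>\<psi>. if \<psi> = ?P then -1 else if \<psi> = \<xi> \<or> \<psi> = \<eta> then 1 else (0::real))"
    have "\<exists>c. \<forall>s. 1 < s \<and> s \<le> 2 \<longrightarrow> ln (norm (dirichlet_L \<psi> s)) \<le> c + e \<psi> * ln (s - 1)" if "\<psi> \<in> ?D" for \<psi>
    proof (cases "\<psi> = ?P")
      case True
      have "ln (norm (dirichlet_L \<psi> s)) \<le> ln 2 + e \<psi> * ln (s - 1)" if s: "1 < s" "s \<le> 2" for s
      proof -
        have "norm (dirichlet_L \<psi> s) \<le> 1 + 1 / (s - 1)" by (rule norm_L_le[OF m0 _ s(1)]) (use \<open>\<psi> \<in> ?D\<close> in simp)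
        also have "1 \<le> 1 / (s - 1)" using s by simp
        then have "1 + 1 / (s - 1) \<le> 2 / (s - 1)" by simp
        finally have "ln (norm (dirichlet_L \<psi> s)) \<le> ln (2 / (s - 1))"
          using L_nonzero[OF m0 _ s(1), of \<psi>] \<open>\<psi> \<in> ?D\<close> by (intro ln_mono) auto
        also have "\<dots> = ln 2 - ln (s - 1)" using s by (simp add: ln_div)
        finally show ?thesis using True by (simp add: e_def)
      qed
      then show ?thesis by blast
    next
      case False
      obtain C where C: "C > 0" "\<And>s. s > 1 \<Longrightarrow> norm (dirichlet_L \<psi> s - dirichlet_L \<psi> 1) \<le> C * (s - 1)"
        using L_lipschitz_at_1[OF m _ False] \<open>\<psi> \<in> ?D\<close> by blast
      have nz: "norm (dirichlet_L \<psi> s) > 0" if "s > 1" for s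
        using L_nonzero[OF m0 _ that, of \<psi>] \<open>\<psi> \<in> ?D\<close> by simp
      show ?thesis
      proof (cases "\<psi> = \<xi> \<or> \<psi> = \<eta>")
        case \<psi>: True
        have "ln (norm (dirichlet_L \<psi> s)) \<le> ln C' + e \<psi> * ln (s - 1)"
          if C': "C' > 0" "\<And>s. s > 1 \<Longrightarrow> norm (dirichlet_L \<xi> s - dirichlet_L \<xi> 1) \<le> C' * (s - 1)" and s: "1 < s" "s \<le> 2" for s C'
        proof -
          have "norm (dirichlet_L \<eta> s) = norm (dirichlet_L \<xi> s)" unfolding \<eta>_def L_cnj[OF m0 char s(1)] by simp
          then have "norm (dirichlet_L \<psi> s) = norm (dirichlet_L \<xi> s)" using \<psi> by auto
          also have "\<dots> \<le> C' * (s - 1)" using C'(2)[OF s(1)] zero by simp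
          finally have "ln (norm (dirichlet_L \<psi> s)) \<le> ln (C' * (s - 1))" using nz[OF s(1)] by (rule ln_mono)
          also have "\<dots> = ln C' + ln (s - 1)" using C'(1) s by (intro ln_mult_pos) auto
          finally show ?thesis using \<psi> False by (simp add: e_def)
        qed
        then show ?thesis using L_lipschitz_at_1[OF m char np] by metis
      next
        case \<psi>: False
        have "ln (norm (dirichlet_L \<psi> s)) \<le> ln (norm (dirichlet_L \<psi> 1) + C) + e \<psi> * ln (s - 1)" if s: "1 < s" "s \<le> 2" for s
        proof -
          have "norm (dirichlet_L \<psi> s) \<le> norm (dirichlet_L \<psi> 1) + norm (dirichlet_L \<psi> s - dirichlet_L \<psi> 1)" by (rule norm_triangle_sub)
          also have "norm (dirichlet_L \<psi> s - dirichlet_L \<psi> 1) \<le> C * (s - 1)" by (rule C(2)[OF s(1)])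
          also have "\<dots> \<le> C * 1" using C(1) s by (intro mult_left_mono) auto
          finally have "norm (dirichlet_L \<psi> s) \<le> norm (dirichlet_L \<psi> 1) + C" by simp
          then have "ln (norm (dirichlet_L \<psi> s)) \<le> ln (norm (dirichlet_L \<psi> 1) + C)" using nz[OF s(1)] by (intro ln_mono) auto
          then show ?thesis using False \<psi> by (simp add: e_def)
        qed
        then show ?thesis by blast
      qed
    qed
    then have "\<forall>\<psi>\<in>?D. \<exists>c. \<forall>s. 1 < s \<and> s \<le> 2 \<longrightarrow> ln (norm (dirichlet_L \<psi> s)) \<le> c + e \<psi> * ln (s - 1)" by blast
    from bchoice[OF this] obtain c where
      c: "\<And>\<psi> s. \<psi> \<in> ?D \<Longrightarrow> 1 < s \<Longrightarrow> s \<le> 2 \<Longrightarrow> ln (norm (dirichlet_L \<psi> s)) \<le> c \<psi> + e \<psi> * ln (s - 1)"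
      by blast
    have "(\<Sum>\<psi>\<in>?D. e \<psi>) = (\<Sum>\<psi>\<in>{?P, \<xi>, \<eta>}. e \<psi>)"
      using \<eta> char dirichlet_char_principal[OF m0]
      by (intro sum.mono_neutral_right finite_dirichlet_char m0) (auto simp: e_def)
    also have "\<dots> = 1" using np \<eta>np nonreal unfolding \<eta>_def[symmetric] by (auto simp: e_def)
    finally have se: "(\<Sum>\<psi>\<in>?D. e \<psi>) = 1" .
    \<comment> \<open>The point \<open>s\<close> is so close to 1 that \<open>ln (s - 1) = - T\<close> outweighs all constants.\<close>
    define T where "T = \<bar>(\<Sum>\<psi>\<in>?D. c \<psi>)\<bar> + real (card ?D) * L_error + 1"
    define s where "s = 1 + exp (- T)"
    have T: "T \<ge> 1" unfolding T_def using L_error_nonneg by simp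
    then have s: "1 < s" "s \<le> 2" unfolding s_def by auto
    have "\<bar>(\<Sum>\<psi>\<in>?D. ln (norm (dirichlet_L \<psi> s))) - real (card ?D) * prime_sum {p. prime p \<and> p mod m = 1} s\<bar>
        \<le> real (card ?D) * L_error"
      by (rule sum_ln_norm_L[OF m s(1)]) (rule sep)
    moreover have "0 \<le> real (card ?D) * prime_sum {p. prime p \<and> p mod m = 1} s"
      by (intro mult_nonneg_nonneg prime_sum_nonneg) simp
    ultimately have "- (real (card ?D) * L_error) \<le> (\<Sum>\<psi>\<in>?D. ln (norm (dirichlet_L \<psi> s)))"
      by linarith
    also have "\<dots> \<le> (\<Sum>\<psi>\<in>?D. c \<psi> + e \<psi> * ln (s - 1))" by (intro sum_mono c s) auto
    also have "\<dots> = (\<Sum>\<psi>\<in>?D. c \<psi>) - T"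
      unfolding sum.distrib sum_distrib_right[symmetric] se by (simp add: s_def)
    finally show False unfolding T_def by linarith
  qed
qed

text \<open>
  The series of the principal character tends to infinity, since it dominates the terms at \<open>k m + 1\<close> and
  the harmonic series diverges; its logarithm is bounded by the sum over the primes plus a constant.
\<close>

lemma prime_sum_all_at_top:
  fixes m :: nat
  assumes m: "m > 1"
  shows "filterlim (prime_sum {p. prime p}) at_top (at_right 1)"
proof -
  have m0: "m > 0" using m by simp
  let ?P = "principal_char m"
  have le: "ln (norm (dirichlet_L ?P s)) - L_error \<le> prime_sum {p. prime p} s" if s: "s > 1" for s
  proof -
    have "(\<Sum>\<^sub>\<infinity>p\<in>{p. prime p}. Re (?P p) * real p powr - s) \<le> prime_sum {p. prime p} s"
      unfolding prime_sum_def
    proof (rule infsum_mono)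
      have "(\<lambda>p. Re (?P p * of_real (real p powr - s))) summable_on {p. prime p}"
        by (rule summable_on_Re[OF abs_summable_summable[OF abs_summable_L[OF m0 dirichlet_char_principal[OF m0] s]]])
      then show "(\<lambda>p. Re (?P p) * real p powr - s) summable_on {p. prime p}" by simp
    qed (auto simp: principal_char_def summable_on_powr s)
    then show ?thesis
      using ln_norm_L[OF m0 dirichlet_char_principal[OF m0] s] unfolding L_error_def[symmetric] by linarith
  qed
  have big: "\<forall>\<^sub>F s in at_right 1. Z < norm (dirichlet_L ?P s)" for Z :: real
  proof -
    have "\<exists>K. real m * Z < (\<Sum>k\<le>K. 1 / real (Suc k))"
    proof (rule ccontr)
      assume "\<nexists>K. real m * Z < (\<Sum>k\<le>K. 1 / real (Suc k))"
      then have "summable (\<lambda>k. 1 / real (Suc k))"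
        by (intro bounded_imp_summable[of _ "real m * Z"]) (auto simp: not_less)
      then have "summable (\<lambda>k. 1 / real k)" by (subst (asm) summable_Suc_iff)
      then show False using summable_real_powr_iff[of "-1"] by (simp add: powr_minus_divide)
    qed
    then obtain K where K: "real m * Z < (\<Sum>k\<le>K. 1 / real (Suc k))" ..
    have "Z < (\<Sum>k\<le>K. real (k * m + 1) powr - 1)"
    proof -
      have "(\<Sum>k\<le>K. 1 / real (Suc k)) \<le> (\<Sum>k\<le>K. real m * real (k * m + 1) powr - 1)"
      proof (rule sum_mono)
        fix k
        have "k * m + 1 \<le> m * Suc k" using m by simp
        then have "real (k * m + 1) \<le> real m * real (Suc k)" by (metis of_nat_mono of_nat_mult)
        then show "1 / real (Suc k) \<le> real m * real (k * m + 1) powr - 1"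
          using m by (simp add: powr_minus_divide frac_le_eq le_divide_eq divide_le_eq del: of_nat_Suc of_nat_add of_nat_mult)
      qed
      also have "\<dots> = real m * (\<Sum>k\<le>K. real (k * m + 1) powr - 1)" by (simp add: sum_distrib_left)
      finally have "real m * Z < real m * (\<Sum>k\<le>K. real (k * m + 1) powr - 1)" using K by (rule less_le_trans[rotated])
      then show ?thesis using m0 by (simp only: mult_less_cancel_left_pos of_nat_0_less_iff)
    qed
    moreover have "((\<lambda>s. \<Sum>k\<le>K. real (k * m + 1) powr - s) \<longlongrightarrow> (\<Sum>k\<le>K. real (k * m + 1) powr - 1)) (at_right 1)"
      by (intro tendsto_intros) (simp only: of_nat_eq_0_iff, simp)
    ultimately have "\<forall>\<^sub>F s in at_right 1. Z < (\<Sum>k\<le>K. real (k * m + 1) powr - s)"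
      by (rule order_tendstoD(1)[rotated])
    moreover have "\<forall>\<^sub>F s::real in at_right 1. s > 1" by (rule eventually_at_right_less)
    ultimately show ?thesis
    proof eventually_elim
      case (elim s)
      note ch = dirichlet_char_principal[OF m0]
      have cop: "coprime (k * m + 1) m" for k
        by (rule coprimeI) (metis dvd_add_right_iff dvd_mult)
      have inj: "inj_on (\<lambda>k. k * m + 1) {..K}" using m by (auto simp: inj_on_def)
      have sm: "(\<lambda>n. ?P n * of_real (real n powr - s)) summable_on UNIV"
        by (rule abs_summable_summable[OF abs_summable_L[OF m0 ch elim(2)]])
      have "(\<Sum>k\<le>K. real (k * m + 1) powr - s) = (\<Sum>k\<le>K. Re (?P (k * m + 1) * of_real (real (k * m + 1) powr - s)))"
        using cop by (intro sum.cong) (auto simp: principal_char_def)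
      also have "\<dots> = (\<Sum>n\<in>(\<lambda>k. k * m + 1) ` {..K}. Re (?P n * of_real (real n powr - s)))"
        by (simp only: sum.reindex[OF inj] o_def)
      also have "\<dots> \<le> (\<Sum>\<^sub>\<infinity>n. Re (?P n * of_real (real n powr - s)))"
        by (rule finite_sum_le_infsum[OF summable_on_Re[OF sm]]) (auto simp: principal_char_def)
      also have "\<dots> = Re (dirichlet_L ?P s)" unfolding L_eq_infsum[OF m0 ch elim(2)] by (rule infsum_Re[OF sm])
      also have "\<dots> \<le> norm (dirichlet_L ?P s)" by (rule complex_Re_le_cmod)
      finally show ?case using elim(1) by simp
    qed
  qed
  show ?thesis
    unfolding filterlim_at_top
  proof
    fix Z :: real
    have "\<forall>\<^sub>F s::real in at_right 1. s > 1" by (rule eventually_at_right_less)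
    with big[of "exp (Z + L_error)"] show "\<forall>\<^sub>F s in at_right 1. Z \<le> prime_sum {p. prime p} s"
    proof eventually_elim
      case (elim s)
      have "Z + L_error = ln (exp (Z + L_error))" by simp
      also have "\<dots> \<le> ln (norm (dirichlet_L ?P s))" using elim(1) by (intro ln_mono) auto
      finally show ?case using le[OF elim(2)] by simp
    qed
  qed
qed

text \<open>
  With \<open>h\<close> the number of characters, \<open>h\<close> times the sum over the primes congruent to 1 and the sum over all
  primes differ by a bounded amount, because the characters other than the principal one contribute
  convergent logarithms and the primes dividing \<open>m\<close> a bounded sum.  The sum over all primes tends to
  infinity, so the quotient tends to \<open>1 / h\<close>.
\<close>

theorem prime_density_residue_1:
  fixes m :: nat
  assumes m: "m > 1"
    and sep: "\<And>a. coprime a m \<Longrightarrow> a mod m \<noteq> 1 \<Longrightarrow> \<exists>\<xi>. dirichlet_char m \<xi> \<and> \<xi> a \<noteq> 1"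
  shows "has_prime_density {p. prime p \<and> p mod m = 1} (1 / real (card {\<xi>. dirichlet_char m \<xi>}))"
proof -
  let ?D = "{\<xi>. dirichlet_char m \<xi>}" and ?P = "principal_char m"
  let ?S = "{p. prime p \<and> p mod m = 1}"
  define h where "h = real (card ?D)"
  have m0: "m > 0" using m by simp
  have Pch: "?P \<in> ?D" using dirichlet_char_principal[OF m0] by simp
  have h: "h > 0" unfolding h_def using finite_dirichlet_char[OF m0] Pch by (auto simp: card_gt_0_iff)
  define R where "R = (\<lambda>s. \<Sum>\<xi>\<in>?D - {?P}. ln (norm (dirichlet_L \<xi> s)))"
  have lim: "(R \<longlongrightarrow> (\<Sum>\<xi>\<in>?D - {?P}. ln (norm (dirichlet_L \<xi> 1)))) (at_right 1)"
    unfolding R_def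
  proof (intro tendsto_sum)
    fix \<xi> assume \<xi>: "\<xi> \<in> ?D - {?P}"
    obtain C where C: "C > 0" "\<And>s. s > 1 \<Longrightarrow> norm (dirichlet_L \<xi> s - dirichlet_L \<xi> 1) \<le> C * (s - 1)"
      using L_lipschitz_at_1[OF m, of \<xi>] \<xi> by auto
    have "((\<lambda>s. dirichlet_L \<xi> s - dirichlet_L \<xi> 1) \<longlongrightarrow> 0) (at_right 1)"
    proof (rule tendsto_norm_zero_cancel, rule tendsto_sandwich[OF _ _ tendsto_const])
      show "((\<lambda>s. C * (s - 1)) \<longlongrightarrow> 0) (at_right 1)" by (auto intro!: tendsto_eq_intros)
      show "\<forall>\<^sub>F s in at_right 1. norm (dirichlet_L \<xi> s - dirichlet_L \<xi> 1) \<le> C * (s - 1)"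
        using eventually_at_right_less[of "1::real"] by eventually_elim (rule C(2))
    qed simp
    then have "((\<lambda>s. dirichlet_L \<xi> s) \<longlongrightarrow> dirichlet_L \<xi> 1) (at_right 1)" by (rule LIM_zero_cancel)
    moreover have "dirichlet_L \<xi> 1 \<noteq> 0" using L_1_nonzero[OF m _ _ sep] \<xi> by auto
    ultimately show "((\<lambda>s. ln (norm (dirichlet_L \<xi> s))) \<longlongrightarrow> ln (norm (dirichlet_L \<xi> 1))) (at_right 1)"
      by (intro tendsto_ln tendsto_norm) auto
  qed
  define B where "B = \<bar>\<Sum>\<xi>\<in>?D - {?P}. ln (norm (dirichlet_L \<xi> 1))\<bar> + 1"
  have evR: "\<forall>\<^sub>F s in at_right 1. \<bar>R s\<bar> < B"
    by (rule order_tendstoD(2)[OF tendsto_rabs[OF lim]]) (simp add: B_def)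
  define E where "E = h * L_error + L_error + real m + B"
  have close: "\<forall>\<^sub>F s in at_right 1. \<bar>h * prime_sum ?S s - prime_sum {p. prime p} s\<bar> \<le> E"
    using evR eventually_at_right_less[of "1::real"]
  proof eventually_elim
    case (elim s)
    define A where "A = (\<Sum>\<^sub>\<infinity>p\<in>{p. prime p}. Re (?P p) * real p powr - s)"
    have "(\<Sum>\<xi>\<in>?D. ln (norm (dirichlet_L \<xi> s))) = ln (norm (dirichlet_L ?P s)) + R s"
      unfolding R_def by (rule sum.remove[OF finite_dirichlet_char[OF m0] Pch])
    moreover have "\<bar>(\<Sum>\<psi>\<in>?D. ln (norm (dirichlet_L \<psi> s))) - real (card ?D) * prime_sum ?S s\<bar> \<le> real (card ?D) * L_error"
      by (rule sum_ln_norm_L[OF m elim(2)]) (rule sep)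
    ultimately have 1: "\<bar>ln (norm (dirichlet_L ?P s)) + R s - h * prime_sum ?S s\<bar> \<le> h * L_error"
      by (simp add: h_def)
    have 2: "\<bar>ln (norm (dirichlet_L ?P s)) - A\<bar> \<le> L_error"
      using ln_norm_L[OF m0 _ elim(2), of ?P] Pch by (simp add: A_def L_error_def)
    have "prime_sum {p. prime p} s = prime_sum {p. prime p \<and> coprime p m} s + prime_sum {p. prime p \<and> \<not> coprime p m} s"
      unfolding prime_sum_def
      by (subst infsum_Un_disjoint[symmetric]) (auto intro: summable_on_powr elim infsum_cong arg_cong2[where f = infsum])
    moreover have "A = prime_sum {p. prime p \<and> coprime p m} s"
      unfolding A_def prime_sum_def by (rule infsum_cong_neutral) (auto simp: principal_char_def)
    moreover have "prime_sum {p. prime p \<and> \<not> coprime p m} s \<le> real m"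
    proof -
      have sub: "{p. prime p \<and> \<not> coprime p m} \<subseteq> {1..m}"
      proof
        fix p assume "p \<in> {p. prime p \<and> \<not> coprime p m}"
        then have "prime p" "p dvd m" using prime_imp_coprime by blast+
        then show "p \<in> {1..m}" using m0 prime_ge_1_nat by (auto dest: dvd_imp_le)
      qed
      then have "prime_sum {p. prime p \<and> \<not> coprime p m} s = (\<Sum>p | prime p \<and> \<not> coprime p m. real p powr - s)"
        unfolding prime_sum_def by (intro infsum_finite) (rule finite_subset, auto)
      also have "\<dots> \<le> (\<Sum>p\<in>{1..m}. real p powr - s)" by (rule sum_mono2[OF _ sub]) auto
      also have "\<dots> \<le> (\<Sum>p\<in>{1..m}. 1)"
      proof (rule sum_mono)
        fix p assume "p \<in> {1..m}"
        then show "real p powr - s \<le> 1" using powr_mono[of "- s" 0 "real p"] elim(2) by simp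
      qed
      finally show ?thesis by simp
    qed
    moreover have "prime_sum {p. prime p \<and> \<not> coprime p m} s \<ge> 0" by (rule prime_sum_nonneg)
    ultimately show ?case using 1 2 elim(1) L_error_nonneg unfolding E_def by linarith
  qed
  have top: "filterlim (prime_sum {p. prime p}) at_top (at_right 1)" by (rule prime_sum_all_at_top[OF m])
  have "((\<lambda>s. prime_sum ?S s / prime_sum {p. prime p} s - 1 / h) \<longlongrightarrow> 0) (at_right 1)"
  proof (rule tendsto_norm_zero_cancel, rule tendsto_sandwich[OF _ _ tendsto_const])
    have "((\<lambda>s. (E / h) / prime_sum {p. prime p} s) \<longlongrightarrow> 0) (at_right 1)"
      by (rule tendsto_divide_0[OF tendsto_const filterlim_at_top_imp_at_infinity[OF top]])
    then show "((\<lambda>s. (E / h) / prime_sum {p. prime p} s) \<longlongrightarrow> 0) (at_right 1)" .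
    have "\<forall>\<^sub>F s in at_right 1. 0 < prime_sum {p. prime p} s"
      using top unfolding filterlim_at_top_dense by blast
    with close show "\<forall>\<^sub>F s in at_right 1. norm (prime_sum ?S s / prime_sum {p. prime p} s - 1 / h) \<le> (E / h) / prime_sum {p. prime p} s"
    proof eventually_elim
      case (elim s)
      have "prime_sum ?S s / prime_sum {p. prime p} s - 1 / h =
          (h * prime_sum ?S s - prime_sum {p. prime p} s) / (h * prime_sum {p. prime p} s)"
        using elim(2) h by (simp add: field_simps)
      then have "norm (prime_sum ?S s / prime_sum {p. prime p} s - 1 / h) =
          \<bar>h * prime_sum ?S s - prime_sum {p. prime p} s\<bar> / (h * prime_sum {p. prime p} s)"
        using elim(2) h by (simp add: abs_divide abs_mult)
      also have "\<dots> \<le> E / (h * prime_sum {p. prime p} s)"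
        using elim h by (intro divide_right_mono) auto
      finally show ?case by simp
    qed
  qed simp
  then show ?thesis
    unfolding has_prime_density_def h_def[symmetric] prime_sum_def by (rule LIM_zero_cancel)
qed

section \<open>Characters modulo 2520\<close>

text \<open>
  A function that behaves like a discrete logarithm modulo \<open>q\<close>, with values modulo \<open>k\<close>, gives a character.
\<close>

lemma dirichlet_char_index:
  fixes ind :: "nat \<Rightarrow> nat"
  assumes "m > 0" "q dvd m" and \<zeta>: "\<zeta> ^ k = 1" "\<zeta> \<noteq> 0" "\<zeta> ^ ind (1 mod q) = 1"
    and ind: "\<And>a b. a < q \<Longrightarrow> b < q \<Longrightarrow> coprime a q \<Longrightarrow> coprime b q \<Longrightarrow> ind (a * b mod q) mod k = (ind a + ind b) mod k"
  shows "dirichlet_char m (\<lambda>a. if coprime a m then \<zeta> ^ ind (a mod q) else 0)"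
proof -
  have red: "\<zeta> ^ i = \<zeta> ^ (i mod k)" for i
  proof -
    have "\<zeta> ^ i = \<zeta> ^ (k * (i div k) + i mod k)" by simp
    also have "\<dots> = \<zeta> ^ (i mod k)" by (simp only: power_add power_mult \<zeta>(1) power_one mult_1)
    finally show ?thesis .
  qed
  have q0: "q > 0" using assms(1,2) by (auto dest: dvd_pos_nat)
  have m: "\<zeta> ^ ind (a * b mod q) = \<zeta> ^ ind (a mod q) * \<zeta> ^ ind (b mod q)" if "coprime a m" "coprime b m" for a b
  proof -
    have "coprime a q" "coprime b q" using that assms(2) by (auto intro: coprime_divisors[OF dvd_refl])
    then have "ind (a * b mod q) mod k = (ind (a mod q) + ind (b mod q)) mod k"
      using ind[of "a mod q" "b mod q"] q0 by (simp add: mod_mult_eq)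
    then show ?thesis by (metis red power_add)
  qed
  show ?thesis
    unfolding dirichlet_char_def
  proof (intro conjI allI)
    show "(if coprime 1 m then \<zeta> ^ ind (1 mod q) else 0) = 1" using \<zeta>(3) by simp
    fix a b
    show "(if coprime (a * b) m then \<zeta> ^ ind (a * b mod q) else 0) =
      (if coprime a m then \<zeta> ^ ind (a mod q) else 0) * (if coprime b m then \<zeta> ^ ind (b mod q) else 0)"
      using m by auto
    show "(if coprime (a mod m) m then \<zeta> ^ ind (a mod m mod q) else 0) = (if coprime a m then \<zeta> ^ ind (a mod q) else 0)"
      using assms(1,2) by (simp add: mod_mod_cancel)
    show "((if coprime a m then \<zeta> ^ ind (a mod q) else 0) \<noteq> 0) = coprime a m"
      using \<zeta>(2) by simp
  qed
qed

lemma dirichlet_char_index_separates: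
  fixes tab :: "nat list"
  assumes m: "m > 0" "q dvd m" and k: "k > 0" "q > 1" "tab ! 1 = 0" 
    and tab: "\<forall>a\<in>set [0..<q]. \<forall>b\<in>set [0..<q]. gcd a q = 1 \<and> gcd b q = 1 \<longrightarrow>
                 (tab ! (a * b mod q)) mod k = (tab ! a + tab ! b) mod k"
    and a: "coprime a m" "\<not> k dvd tab ! (a mod q)"
  shows "\<exists>\<xi>. dirichlet_char m \<xi> \<and> \<xi> a \<noteq> 1"
proof -
  define \<zeta> where "\<zeta> = exp (2 * of_real pi * \<i> * of_nat 1 / of_nat k)"
  have pow: "\<zeta> ^ j = exp (2 * of_real pi * \<i> * of_nat j / of_nat k)" for j
    unfolding \<zeta>_def exp_of_nat_mult[symmetric] by (simp add: mult_ac)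
  have one: "\<zeta> ^ j = 1 \<longleftrightarrow> k dvd j" for j
    unfolding pow by (rule complex_root_unity_eq_1) (use k in simp)
  have "dirichlet_char m (\<lambda>a. if coprime a m then \<zeta> ^ (tab ! (a mod q)) else 0)"
  proof (rule dirichlet_char_index[OF m, where k = k])
    show "\<zeta> ^ k = 1" "\<zeta> ^ (tab ! (1 mod q)) = 1" "\<zeta> \<noteq> 0"
      using k unfolding one by (simp_all add: \<zeta>_def)
    fix a b assume "a < q" "b < q" "coprime a q" "coprime b q"
    then have "a \<in> set [0..<q]" "b \<in> set [0..<q]" "gcd a q = 1 \<and> gcd b q = 1" by simp_all
    then show "tab ! (a * b mod q) mod k = (tab ! a + tab ! b) mod k" by (rule tab[rule_format])
  qed
  moreover have "(if coprime a m then \<zeta> ^ (tab ! (a mod q)) else 0) \<noteq> 1" using a one by simp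
  ultimately show ?thesis by blast
qed

text \<open>
  A unit other than 1 differs from 1 modulo 5, 7, 8 or 9.  The tables are discrete logarithms to the bases 2,
  3 and 2 modulo 5, 7 and 9; the two tables modulo 8 belong to the characters of conductor 4 and 8.
\<close>

lemma dirichlet_chars_2520_separate:
  fixes a :: nat
  assumes a: "coprime a 2520" "a mod 2520 \<noteq> 1"
  shows "\<exists>\<xi>. dirichlet_char 2520 \<xi> \<and> \<xi> a \<noteq> 1"
proof -
  have cop: "coprime a q" if "q dvd 2520" for q
    using a(1) that by (rule coprime_divisors[OF dvd_refl, rotated])
  have c: "a mod q \<in> set [0..<q]" "gcd (a mod q) q = 1" if "q dvd 2520" "q > 0" for q
    using cop[OF that(1)] that(2) by (auto simp: coprime_iff_gcd_eq_1[symmetric])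
  have "\<forall>r\<in>set [0..<5]. gcd r 5 = 1 \<longrightarrow> r \<in> {1,2,3,4::nat}" by code_simp
  then have c5: "a mod 5 \<in> {1,2,3,4}" using c[of 5] by fastforce
  have "\<forall>r\<in>set [0..<7]. gcd r 7 = 1 \<longrightarrow> r \<in> {1,2,3,4,5,6::nat}" by code_simp
  then have c7: "a mod 7 \<in> {1,2,3,4,5,6}" using c[of 7] by fastforce
  have "\<forall>r\<in>set [0..<8]. gcd r 8 = 1 \<longrightarrow> r \<in> {1,3,5,7::nat}" by code_simp
  then have c8: "a mod 8 \<in> {1,3,5,7}" using c[of 8] by fastforce
  have "\<forall>r\<in>set [0..<9]. gcd r 9 = 1 \<longrightarrow> r \<in> {1,2,4,5,7,8::nat}" by code_simp
  then have c9: "a mod 9 \<in> {1,2,4,5,7,8}" using c[of 9] by fastforce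
  have "[a = 1] (mod 2520)" if "a mod 5 = 1" "a mod 7 = 1" "a mod 8 = 1" "a mod 9 = 1"
  proof -
    have "[a = 1] (mod 5)" "[a = 1] (mod 7)" "[a = 1] (mod 8)" "[a = 1] (mod 9)"
      using that by (simp_all add: cong_def)
    then have "[a = 1] (mod 5 * 7 * 8 * 9)"
      by (intro coprime_cong_mult_nat) (auto simp: coprime_iff_gcd_eq_1 gcd_non_0_nat)
    then show ?thesis by simp
  qed
  then have "a mod 5 \<noteq> 1 \<or> a mod 7 \<noteq> 1 \<or> a mod 8 \<noteq> 1 \<or> a mod 9 \<noteq> 1"
    using a(2) by (auto simp: cong_def)
  then consider "a mod 5 \<in> {2,3,4}" | "a mod 7 \<in> {2,3,4,5,6}" | "a mod 8 \<in> {3,7}" | "a mod 8 = 5" | "a mod 9 \<in> {2,4,5,7,8}"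
    using c5 c7 c8 c9 by blast
  then show ?thesis
  proof cases
    case 1
    then show ?thesis using a(1)
      by (intro dirichlet_char_index_separates[where q = 5 and k = 4 and tab = "[0,0,1,3,2]"]) (simp, simp, simp, simp, simp, code_simp, simp, auto)
  next
    case 2
    then show ?thesis using a(1)
      by (intro dirichlet_char_index_separates[where q = 7 and k = 6 and tab = "[0,0,2,1,4,5,3]"]) (simp, simp, simp, simp, simp, code_simp, simp, auto)
  next
    case 3
    then show ?thesis using a(1)
      by (intro dirichlet_char_index_separates[where q = 8 and k = 2 and tab = "[0,0,0,1,0,0,0,1]"]) (simp, simp, simp, simp, simp, code_simp, simp, auto)
  next
    case 4
    then show ?thesis using a(1)
      by (intro dirichlet_char_index_separates[where q = 8 and k = 2 and tab = "[0,0,0,1,0,1,0,0]"]) (simp, simp, simp, simp, simp, code_simp, simp, auto)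
  next
    case 5
    then show ?thesis using a(1)
      by (intro dirichlet_char_index_separates[where q = 9 and k = 6 and tab = "[0,0,1,0,2,5,0,4,3]"]) (simp, simp, simp, simp, simp, code_simp, simp, auto)
  qed
qed

lemma prime_density_2520: "\<exists>\<delta>>0. has_prime_density {p. prime p \<and> p mod 2520 = 1} \<delta>"
proof (intro exI conjI)
  let ?D = "{\<xi>. dirichlet_char 2520 \<xi>}"
  show "has_prime_density {p. prime p \<and> p mod 2520 = 1} (1 / real (card ?D))"
    by (rule prime_density_residue_1) (simp_all add: dirichlet_chars_2520_separate)
  have "principal_char 2520 \<in> ?D" using dirichlet_char_principal[of 2520] by simp
  then show "0 < 1 / real (card ?D)" using finite_dirichlet_char[of 2520] by (auto simp: card_gt_0_iff)
qed

section \<open>Cusps of congruence subgroups\<close>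

definition proj_point :: "int \<times> int \<Rightarrow> rat option" where
  "proj_point v = (if snd v = 0 then None else Some (of_int (fst v) / of_int (snd v)))"

definition mat_act :: "int^2^2 \<Rightarrow> int \<times> int \<Rightarrow> int \<times> int" where
  "mat_act g v = (g $ 1 $ 1 * fst v + g $ 1 $ 2 * snd v, g $ 2 $ 1 * fst v + g $ 2 $ 2 * snd v)"

lemma proj_point_surj: "\<exists>x y. coprime x y \<and> z = proj_point (x, y)"
proof (cases z)
  case None
  then show ?thesis by (intro exI[of _ 1] exI[of _ 0]) (simp add: proj_point_def)
next
  case (Some q)
  obtain m n where q: "quotient_of q = (m, n)" by force
  then have "n > 0" "coprime m n" "q = of_int m / of_int n"
    using quotient_of_denom_pos quotient_of_coprime quotient_of_div by auto
  with Some show ?thesis by (intro exI[of _ m] exI[of _ n]) (simp add: proj_point_def)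
qed

lemma proj_point_eq_iff:
  assumes "coprime x y" "coprime x' y'"
  shows "proj_point (x, y) = proj_point (x', y') \<longleftrightarrow> (x', y') = (x, y) \<or> (x', y') = (- x, - y)"
proof
  assume eq: "proj_point (x, y) = proj_point (x', y')"
  have "x * y' = x' * y"
  proof (cases "y = 0 \<or> y' = 0")
    case False
    then have "of_int (x * y') = (of_int (x' * y) :: rat)"
      using eq by (simp add: proj_point_def field_simps)
    then show ?thesis by (simp only: of_int_eq_iff)
  qed (use eq in \<open>auto simp: proj_point_def split: if_splits\<close>)
  then have "x dvd x'" "x' dvd x" "y dvd y'" "y' dvd y"
    using assms by (metis coprime_commute coprime_dvd_mult_left_iff coprime_dvd_mult_right_iff dvd_triv_left dvd_triv_right)+
  then have "\<bar>x\<bar> = \<bar>x'\<bar>" "\<bar>y\<bar> = \<bar>y'\<bar>" by (auto intro: zdvd_antisym_abs)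
  with \<open>x * y' = x' * y\<close> show "(x', y') = (x, y) \<or> (x', y') = (- x, - y)"
    by (auto simp: abs_eq_iff)
next
  assume "(x', y') = (x, y) \<or> (x', y') = (- x, - y)"
  then show "proj_point (x, y) = proj_point (x', y')" by (auto simp: proj_point_def)
qed

lemma det_2_int: "det (g :: int^2^2) = g $ 1 $ 1 * g $ 2 $ 2 - g $ 1 $ 2 * g $ 2 $ 1"
  by (rule det_2)

lemma moebius_proj_point:
  assumes "det g = 1" "coprime x y"
  shows "Defs.moebius g (proj_point (x, y)) = proj_point (mat_act g (x, y))"
proof (cases "y = 0")
  case True
  then have "x \<noteq> 0" using assms(2) by auto
  with True show ?thesis by (simp add: Defs.moebius_def proj_point_def mat_act_def)
next
  case False
  have "of_int (g $ i $ 1) * (of_int x / of_int y) + of_int (g $ i $ 2) =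
      (of_int (g $ i $ 1 * x + g $ i $ 2 * y) / of_int y :: rat)" for i
    using False by (simp add: field_simps)
  then show ?thesis
    using False unfolding Defs.moebius_def proj_point_def mat_act_def Let_def by (simp del: of_int_add of_int_mult)
qed

lemma mat_act_coprime:
  assumes "det g = 1" "coprime x y"
  shows "coprime (fst (mat_act g (x, y))) (snd (mat_act g (x, y)))"
proof (rule coprimeI)
  fix c assume c: "c dvd fst (mat_act g (x, y))" "c dvd snd (mat_act g (x, y))"
  have d: "g $ 1 $ 1 * g $ 2 $ 2 - g $ 1 $ 2 * g $ 2 $ 1 = 1" using assms(1) by (simp add: det_2_int)
  let ?X = "g $ 1 $ 1 * x + g $ 1 $ 2 * y" and ?Y = "g $ 2 $ 1 * x + g $ 2 $ 2 * y"
  have "g $ 2 $ 2 * ?X - g $ 1 $ 2 * ?Y = x * (g $ 1 $ 1 * g $ 2 $ 2 - g $ 1 $ 2 * g $ 2 $ 1)"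
    "g $ 1 $ 1 * ?Y - g $ 2 $ 1 * ?X = y * (g $ 1 $ 1 * g $ 2 $ 2 - g $ 1 $ 2 * g $ 2 $ 1)"
    by (simp_all add: algebra_simps)
  then have "g $ 2 $ 2 * ?X - g $ 1 $ 2 * ?Y = x" "g $ 1 $ 1 * ?Y - g $ 2 $ 1 * ?X = y" using d by simp_all
  moreover have "c dvd ?X" "c dvd ?Y" using c by (simp_all add: mat_act_def)
  ultimately have "c dvd x" "c dvd y" by (metis dvd_diff dvd_mult)+
  then show "is_unit c" using assms(2) by (meson coprime_common_divisor)
qed

text \<open>
  Covers all the groups of interest: \<open>k = 1\<close> gives \<open>\<Gamma>\<^sub>1(N)\<close>, \<open>k = N\<close> gives \<open>\<Gamma>(N)\<close>, and \<open>k = 2\<close> with \<open>N\<close> even gives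
  \<open>\<Gamma>\<^sub>1(N) \<inter> \<Gamma>(2)\<close>.
\<close>

definition Gamma_family :: "int \<Rightarrow> int \<Rightarrow> (int^2^2) set" where
  "Gamma_family N k = {g \<in> SL2Z. [g $ 1 $ 1 = 1] (mod N) \<and> [g $ 2 $ 1 = 0] (mod N) \<and>
     [g $ 2 $ 2 = 1] (mod N) \<and> [g $ 1 $ 2 = 0] (mod k)}"

text \<open>
  Upper triangular matrices move the first entry \<open>x\<close> by multiples of \<open>k y\<close>, and it only matters modulo \<open>N\<close>,
  which is why it is compared modulo \<open>gcd (k y) N\<close>.
\<close>

definition cusp_rel :: "int \<Rightarrow> int \<Rightarrow> int \<times> int \<Rightarrow> int \<times> int \<Rightarrow> bool" where
  "cusp_rel N k v w \<longleftrightarrow> (\<exists>e\<in>{1, -1}. [snd w = e * snd v] (mod N) \<and> [fst w = e * fst v] (mod gcd (k * snd v) N))"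

lemma gcd_mult_cong:
  fixes N k y y' e :: int
  assumes "[y' = e * y] (mod N)" "e \<in> {1, -1}"
  shows "gcd (k * y') N = gcd (k * y) N"
proof -
  have "[k * y' = k * (e * y)] (mod N)" using assms(1) by (rule cong_scalar_left)
  then have "gcd (k * y') N = gcd (k * (e * y)) N" by (metis cong_def gcd_mod_left gcd.commute gcd_red_int)
  also have "\<dots> = gcd (k * y) N" using assms(2) by auto
  finally show ?thesis .
qed

lemma cusp_rel_sym: "cusp_rel N k v w \<Longrightarrow> cusp_rel N k w v"
  unfolding cusp_rel_def
proof (elim bexE conjE)
  fix e assume e: "e \<in> {1, -1::int}" and *: "[snd w = e * snd v] (mod N)" "[fst w = e * fst v] (mod gcd (k * snd v) N)"
  have "e * e = 1" using e by auto
  then have "[snd v = e * snd w] (mod N)" "[fst v = e * fst w] (mod gcd (k * snd v) N)"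
    using cong_scalar_left[OF *(1), of e] cong_scalar_left[OF *(2), of e]
    by (simp_all add: cong_sym_eq mult.assoc[symmetric])
  then show "\<exists>e\<in>{1, -1}. [snd v = e * snd w] (mod N) \<and> [fst v = e * fst w] (mod gcd (k * snd w) N)"
    using e gcd_mult_cong[OF *(1) e, of k] by auto
qed

lemma cusp_rel_trans: "cusp_rel N k u v \<Longrightarrow> cusp_rel N k v w \<Longrightarrow> cusp_rel N k u w"
  unfolding cusp_rel_def
proof (elim bexE conjE)
  fix e d assume e: "e \<in> {1, -1::int}" and *: "[snd v = e * snd u] (mod N)" "[fst v = e * fst u] (mod gcd (k * snd u) N)"
    and d: "d \<in> {1, -1::int}" and **: "[snd w = d * snd v] (mod N)" "[fst w = d * fst v] (mod gcd (k * snd v) N)"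
  have "[snd w = d * (e * snd u)] (mod N)" using **(1) cong_scalar_left[OF *(1)] cong_trans by blast
  moreover have "[fst w = d * (e * fst u)] (mod gcd (k * snd u) N)"
    using **(2) cong_scalar_left[OF *(2)] cong_trans unfolding gcd_mult_cong[OF *(1) e, of k] by blast
  moreover have "d * e \<in> {1, -1}" using d e by auto
  ultimately show "\<exists>e\<in>{1, -1}. [snd w = e * snd u] (mod N) \<and> [fst w = e * fst u] (mod gcd (k * snd u) N)"
    by (intro bexI[of _ "d * e"]) (simp_all add: mult.assoc)
qed

lemma cusp_rel_uminus: "cusp_rel N k v (x, y) \<Longrightarrow> cusp_rel N k v (- x, - y)"
  using cusp_rel_trans[of N k v "(x, y)" "(- x, - y)"] unfolding cusp_rel_def by auto

text \<open>
  The principal congruence subgroup acts transitively on primitive vectors in a residue class.  Bezout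
  coefficients \<open>p, q\<close> and \<open>p', q'\<close> complete both vectors to unimodular matrices, and \<open>t\<close> is the
  parameter of a transvection inserted between them to make the product congruent to the identity.
\<close>

lemma congruent_primitive_vectors:
  fixes x y x' y' N :: int
  assumes "coprime x y" "coprime x' y'" and xy: "[x' = x] (mod N)" "[y' = y] (mod N)"
  obtains a b c d where "a * d - b * c = 1" "[a = 1] (mod N)" "[b = 0] (mod N)" "[c = 0] (mod N)" "[d = 1] (mod N)"
    "a * x + b * y = x'" "c * x + d * y = y'"
proof -
  obtain p q where pq: "p * x + q * y = 1" using bezout_int[of x y] assms(1) by (auto simp: coprime_iff_gcd_eq_1)
  obtain p' q' where pq': "p' * x' + q' * y' = 1" using bezout_int[of x' y'] assms(2) by (auto simp: coprime_iff_gcd_eq_1)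
  define D E t where "D = q' - q" and "E = p - p'" and "t = p * D + q * E"
  define a b c d where "a = x' * p - (t * x' - q') * y" and "b = x' * q + (t * x' - q') * x"
    and "c = y' * p - (t * y' + p') * y" and "d = y' * q + (t * y' + p') * x"
  have "[p' * x' + q' * y' = p' * x + q' * y] (mod N)" by (intro cong_add cong_scalar_left xy)
  then have "[p * x + q * y = p' * x + q' * y] (mod N)" unfolding pq pq' .
  then have Ex: "[E * x = D * y] (mod N)" by (simp add: D_def E_def cong_iff_dvd_diff algebra_simps)
  have tx: "[t * x = D] (mod N)"
  proof -
    have "[t * x = p * x * D + q * (E * x)] (mod N)" by (simp add: t_def algebra_simps)
    also have "[p * x * D + q * (E * x) = p * x * D + q * (D * y)] (mod N)" by (intro cong_add cong_refl cong_scalar_left Ex)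
    also have "p * x * D + q * (D * y) = D * (p * x + q * y)" by (simp add: algebra_simps)
    finally show ?thesis by (simp add: pq)
  qed
  have ty: "[t * y = E] (mod N)"
  proof -
    have "[t * y = p * (D * y) + q * y * E] (mod N)" by (simp add: t_def algebra_simps)
    also have "[p * (D * y) + q * y * E = p * (E * x) + q * y * E] (mod N)" by (intro cong_add cong_refl cong_scalar_left cong_sym[OF Ex])
    also have "p * (E * x) + q * y * E = E * (p * x + q * y)" by (simp add: algebra_simps)
    finally show ?thesis by (simp add: pq)
  qed
  have "[a = x * p - (t * x - q') * y] (mod N)"
    unfolding a_def by (intro cong_diff cong_mult cong_refl xy)
  also have "[x * p - (t * x - q') * y = x * p - (D - q') * y] (mod N)"
    by (intro cong_diff cong_mult cong_refl tx)
  also have "x * p - (D - q') * y = 1" using pq by (simp add: D_def algebra_simps)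
  finally have a: "[a = 1] (mod N)" .
  have "[b = x * q + (t * x - q') * x] (mod N)"
    unfolding b_def by (intro cong_add cong_diff cong_mult cong_refl xy)
  also have "[x * q + (t * x - q') * x = x * q + (D - q') * x] (mod N)"
    by (intro cong_add cong_diff cong_mult cong_refl tx)
  also have "x * q + (D - q') * x = 0" by (simp add: D_def algebra_simps)
  finally have b: "[b = 0] (mod N)" .
  have "[c = y * p - (t * y + p') * y] (mod N)"
    unfolding c_def by (intro cong_diff cong_add cong_mult cong_refl xy)
  also have "[y * p - (t * y + p') * y = y * p - (E + p') * y] (mod N)"
    by (intro cong_diff cong_add cong_mult cong_refl ty)
  also have "y * p - (E + p') * y = 0" by (simp add: E_def algebra_simps)
  finally have c: "[c = 0] (mod N)" .
  have "[d = y * q + (t * y + p') * x] (mod N)"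
    unfolding d_def by (intro cong_add cong_mult cong_refl xy)
  also have "[y * q + (t * y + p') * x = y * q + (E + p') * x] (mod N)"
    by (intro cong_add cong_mult cong_refl ty)
  also have "y * q + (E + p') * x = 1" using pq by (simp add: E_def algebra_simps)
  finally have d: "[d = 1] (mod N)" .
  have "a * d - b * c = (p * x + q * y) * (p' * x' + q' * y')" unfolding a_def b_def c_def d_def by (simp add: algebra_simps)
  moreover have "a * x + b * y = x' * (p * x + q * y)" "c * x + d * y = y' * (p * x + q * y)"
    unfolding a_def b_def c_def d_def by (simp_all add: algebra_simps)
  ultimately show thesis using that[of a d b c] a b c d pq pq' by simp
qed

lemma mat_2_exists: "\<exists>g :: int^2^2. g $ 1 $ 1 = a \<and> g $ 1 $ 2 = b \<and> g $ 2 $ 1 = c \<and> g $ 2 $ 2 = d"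
  by (intro exI[of _ "\<chi> i j. if i = 1 then (if j = 1 then a else b) else (if j = 1 then c else d)"]) simp

text \<open>
  For the converse, a solution \<open>j\<close> of \<open>x' \<equiv> x + k j y\<close> modulo \<open>N\<close> gives a triangular matrix that moves \<open>(x, y)\<close> into
  the residue class of \<open>\<plusminus>(x', y')\<close>; transitivity of the principal congruence subgroup does the rest.
\<close>

lemma orbit_iff_cusp_rel:
  assumes k: "k dvd N" and v: "coprime x y" and w: "coprime x' y'"
  shows "(\<exists>g\<in>Gamma_family N k. proj_point (x', y') = Defs.moebius g (proj_point (x, y))) \<longleftrightarrow> cusp_rel N k (x, y) (x', y')"
proof
  assume "\<exists>g\<in>Gamma_family N k. proj_point (x', y') = Defs.moebius g (proj_point (x, y))"
  then obtain g where g: "g \<in> Gamma_family N k" and eq: "proj_point (x', y') = Defs.moebius g (proj_point (x, y))" by blast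
  have det: "det g = 1" using g by (simp add: Gamma_family_def SL2Z_def)
  define X Y where "X = g $ 1 $ 1 * x + g $ 1 $ 2 * y" and "Y = g $ 2 $ 1 * x + g $ 2 $ 2 * y"
  have XY: "mat_act g (x, y) = (X, Y)" by (simp add: mat_act_def X_def Y_def)
  have "coprime X Y" using mat_act_coprime[OF det v] XY by simp
  moreover have "proj_point (X, Y) = proj_point (x', y')" using eq moebius_proj_point[OF det v] XY by simp
  ultimately have pm: "(x', y') = (X, Y) \<or> (x', y') = (- X, - Y)" using proj_point_eq_iff w by blast
  have "[Y = 0 * x + 1 * y] (mod N)"
    unfolding Y_def using g by (intro cong_add cong_mult cong_refl) (auto simp: Gamma_family_def)
  moreover have "[X = 1 * x + 0] (mod gcd (k * y) N)"
    unfolding X_def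
  proof (intro cong_add cong_mult cong_refl)
    show "[g $ 1 $ 1 = 1] (mod gcd (k * y) N)" using g by (auto simp: Gamma_family_def intro: cong_dvd_modulus)
    have "k dvd g $ 1 $ 2" using g by (simp add: Gamma_family_def cong_0_iff)
    then have "k * y dvd g $ 1 $ 2 * y" by (intro mult_dvd_mono) auto
    then have "gcd (k * y) N dvd g $ 1 $ 2 * y" by (metis dvd_trans gcd_dvd1)
    then show "[g $ 1 $ 2 * y = 0] (mod gcd (k * y) N)" by (simp add: cong_0_iff)
  qed
  ultimately have "cusp_rel N k (x, y) (X, Y)" unfolding cusp_rel_def by (intro bexI[of _ 1]) auto
  with pm show "cusp_rel N k (x, y) (x', y')" using cusp_rel_uminus by auto
next
  assume "cusp_rel N k (x, y) (x', y')"
  then obtain e where e: "e \<in> {1, -1}" and rel: "[y' = e * y] (mod N)" "[x' = e * x] (mod gcd (k * y) N)"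
    unfolding cusp_rel_def fst_conv snd_conv by blast
  have ee: "e * e = 1" using e by auto
  have rel1: "[e * y' = y] (mod N)" "[e * x' = x] (mod gcd (k * y) N)"
    using cong_scalar_left[OF rel(1), of e] cong_scalar_left[OF rel(2), of e] ee by (simp_all add: mult.assoc[symmetric])
  have cop': "coprime (e * x') (e * y')" using e w by auto
  have "gcd (k * y) N dvd e * x' - x" using rel1(2) by (simp add: cong_iff_dvd_diff)
  then obtain l where l: "e * x' - x = gcd (k * y) N * l" by (elim dvdE)
  obtain i r where ir: "i * (k * y) + r * N = gcd (k * y) N" using bezout_int by blast
  define j where "j = i * l"
  have "e * x' - (x + k * j * y) = N * (r * l)"
  proof -
    have "e * x' - x = (i * (k * y) + r * N) * l" using l ir by simp
    then show ?thesis by (simp add: j_def algebra_simps)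
  qed
  then have cx: "[e * x' = x + k * j * y] (mod N)" by (simp add: cong_iff_dvd_diff)
  have copu: "coprime (x + k * j * y) y" using v by (metis coprime_iff_gcd_eq_1 gcd_add_mult mult.commute gcd.commute add.commute)
  obtain a b c d where M: "a * d - b * c = 1" "[a = 1] (mod N)" "[b = 0] (mod N)" "[c = 0] (mod N)" "[d = 1] (mod N)"
    "a * (x + k * j * y) + b * y = e * x'" "c * (x + k * j * y) + d * y = e * y'"
    using congruent_primitive_vectors[OF copu cop' cx rel1(1)] .
  obtain g :: "int^2^2" where g: "g $ 1 $ 1 = a" "g $ 1 $ 2 = a * (k * j) + b" "g $ 2 $ 1 = c" "g $ 2 $ 2 = c * (k * j) + d"
    using mat_2_exists by blast
  have det: "det g = 1" using M(1) unfolding det_2_int g by (simp add: algebra_simps)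
  have "[c * (k * j) + d = 0 * (k * j) + 1] (mod N)" using M by (intro cong_add cong_mult cong_refl)
  moreover have "[a * (k * j) + b = 0] (mod k)"
    using M(3) k by (simp add: cong_0_iff) (meson dvd_add dvd_mult dvd_mult2 dvd_trans dvd_refl)
  ultimately have gG: "g \<in> Gamma_family N k" using det M by (simp add: Gamma_family_def SL2Z_def g)
  have "mat_act g (x, y) = (e * x', e * y')" using M(6,7) by (simp add: mat_act_def g algebra_simps)
  then have "Defs.moebius g (proj_point (x, y)) = proj_point (e * x', e * y')" using moebius_proj_point[OF det v] by simp
  also have "\<dots> = proj_point (x', y')" using e by (auto simp: proj_point_def)
  finally show "\<exists>g\<in>Gamma_family N k. proj_point (x', y') = Defs.moebius g (proj_point (x, y))" using gG by metis
qed

text \<open>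
  The sign is used to bring the second entry into \<open>[0, N / 2]\<close>.  At the two ends of this interval the sign
  still acts, and it is used to bring the first entry into the lower half of its range.
\<close>

definition cusp_reps :: "int \<Rightarrow> int \<Rightarrow> (int \<times> int) set" where
  "cusp_reps N k = {(a, b). 0 \<le> b \<and> 2 * b \<le> N \<and> 0 \<le> a \<and> a < gcd (k * b) N \<and> gcd a (gcd b N) = 1 \<and>
     (b = 0 \<or> 2 * b = N \<longrightarrow> 2 * a \<le> gcd (k * b) N)}"

lemma cusp_reps_unique:
  assumes N: "N > 0" and t: "t \<in> cusp_reps N k" "t' \<in> cusp_reps N k" "cusp_rel N k t t'"
  shows "t = t'"
proof -
  have small: "u = v" if "[u = v] (mod n)" "0 \<le> u" "u < n" "0 \<le> v" "v < n" for u v n :: int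
    using that by (simp add: cong_def)
  have neg: "u = v" if "[u = - v] (mod n)" "0 \<le> u" "2 * u \<le> n" "0 \<le> v" "2 * v \<le> n" "n > 0" for u v n :: int
  proof -
    have "n dvd u + v" using that(1) by (simp add: cong_iff_dvd_diff)
    then obtain q where q: "u + v = n * q" by (elim dvdE)
    have "n * q \<le> n * 1" "n * 0 \<le> n * q" using q that by linarith+
    then have "q \<le> 1" "0 \<le> q" using that(6) by (simp_all only: mult_le_cancel_left_pos)
    then have "q = 0 \<or> q = 1" by auto
    then show ?thesis using q that by auto
  qed
  obtain a b a' b' where tt: "t = (a, b)" "t' = (a', b')" by (cases t, cases t')
  define g where "g = gcd (k * b) N"
  have g: "g > 0" using N by (simp add: g_def)
  have b: "0 \<le> b" "2 * b \<le> N" "0 \<le> b'" "2 * b' \<le> N" using t tt by (auto simp: cusp_reps_def)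
  consider "[b' = b] (mod N)" "[a' = a] (mod g)" | "[b' = - b] (mod N)" "[a' = - a] (mod g)"
    using t(3) unfolding cusp_rel_def tt g_def by auto
  then show ?thesis
  proof cases
    case 1
    have "b' = b" using small[OF 1(1)] b N by auto
    moreover from this have "a' = a" using small[OF 1(2)] t tt by (auto simp: cusp_reps_def g_def)
    ultimately show ?thesis using tt by simp
  next
    case 2
    have bb: "b' = b" using neg[OF 2(1)] b N by auto
    have "N dvd 2 * b" using 2(1) unfolding bb by (simp add: cong_iff_dvd_diff)
    then obtain q where q: "2 * b = N * q" by (elim dvdE)
    then have "N * q \<le> N * 1" "N * 0 \<le> N * q" using b by linarith+
    then have "q \<le> 1" "0 \<le> q" using N by (simp_all only: mult_le_cancel_left_pos)
    then have "q = 0 \<or> q = 1" by auto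
    then have "b = 0 \<or> 2 * b = N" using q by auto
    then have "0 \<le> a" "2 * a \<le> g" "0 \<le> a'" "2 * a' \<le> g" using t tt bb by (auto simp: cusp_reps_def g_def)
    then have "a' = a" using neg[OF 2(2)] g by auto
    then show ?thesis using tt bb by simp
  qed
qed

lemma cusp_reps_exist:
  assumes N: "N > 0" and v: "coprime x y"
  shows "\<exists>t\<in>cusp_reps N k. cusp_rel N k (x, y) t"
proof -
  obtain e b where e: "e \<in> {1, -1}" and b: "[b = e * y] (mod N)" "0 \<le> b" "2 * b \<le> N"
  proof (cases "2 * (y mod N) \<le> N")
    case True
    then show ?thesis using that[of 1 "y mod N"] N by (simp add: cong_def)
  next
    case False
    then have "2 * (N - y mod N) \<le> N" "0 \<le> N - y mod N" using pos_mod_bound[OF N, of y] by simp_all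
    moreover have "[N - y mod N = - 1 * y] (mod N)"
    proof -
      have "N - y mod N - - 1 * y = N * (1 + y div N)"
        using minus_mod_eq_mult_div[of y N] by (simp add: algebra_simps)
      then show ?thesis by (simp only: cong_iff_dvd_diff dvd_triv_left)
    qed
    ultimately show ?thesis using that[of "-1" "N - y mod N"] by blast
  qed
  define g where "g = gcd (k * y) N"
  have gb: "gcd (k * b) N = g" unfolding g_def by (rule gcd_mult_cong[OF b(1) e])
  have g0: "g > 0" using N by (simp add: g_def)
  have key: "gcd a (gcd b N) = 1" if "[a = s * x] (mod g)" "s \<in> {1, -1}" for a s
  proof -
    have "is_unit c" if c: "c dvd a" "c dvd b" "c dvd N" for c
    proof -
      have "c dvd g" unfolding gb[symmetric] using c by auto
      then have "c dvd s * x" using \<open>[a = s * x] (mod g)\<close> c(1) by (meson cong_dvd_iff cong_dvd_modulus)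
      then have "c dvd x" using \<open>s \<in> {1, -1}\<close> by auto
      moreover have "c dvd e * y" using b(1) c by (meson cong_dvd_iff cong_dvd_modulus)
      then have "c dvd y" using e by auto
      ultimately show ?thesis using v by (meson coprime_common_divisor)
    qed
    then have "is_unit (gcd a (gcd b N))" by (meson dvd_trans gcd_dvd1 gcd_dvd2)
    then show ?thesis by simp
  qed
  define a where "a = (e * x) mod g"
  have a: "[a = e * x] (mod g)" "0 \<le> a" "a < g" using g0 by (simp_all add: a_def cong_def)
  show ?thesis
  proof (cases "(b = 0 \<or> 2 * b = N) \<and> 2 * a > g")
    case False
    then have "(a, b) \<in> cusp_reps N k" using a b key[OF a(1) e] unfolding cusp_reps_def mem_Collect_eq case_prod_conv gb by auto
    moreover have "cusp_rel N k (x, y) (a, b)" using a b e unfolding cusp_rel_def g_def by auto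
    ultimately show ?thesis by blast
  next
    case True
    have "[b = - b] (mod N)" using True by (auto simp: cong_iff_dvd_diff)
    also have "[- b = - (e * y)] (mod N)" using b(1) by (simp only: cong_minus_minus_iff)
    finally have b': "[b = (- e) * y] (mod N)" by simp
    have "[g - a = 0 - e * x] (mod g)" by (intro cong_diff a) (simp add: cong_0_iff)
    then have a': "[g - a = (- e) * x] (mod g)" by simp
    have e': "- e \<in> {1, -1}" using e by auto
    have "(g - a, b) \<in> cusp_reps N k" using True a b key[OF a' e'] unfolding cusp_reps_def mem_Collect_eq case_prod_conv gb by auto
    moreover have "cusp_rel N k (x, y) (g - a, b)" using a' b' e' unfolding cusp_rel_def g_def by auto
    ultimately show ?thesis by blast
  qed
qed

text \<open>
  Take for \<open>s\<close> the product of the primes that divide \<open>b\<close> but not \<open>a\<close>.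
\<close>

lemma coprime_lift_exists:
  fixes a b N :: int
  assumes "b \<noteq> 0" "gcd a (gcd b N) = 1"
  shows "\<exists>s. coprime (a + N * s) b"
proof -
  define s where "s = \<Prod>{p \<in> prime_factors b. \<not> p dvd a}"
  have "coprime (a + N * s) b"
  proof (rule ccontr)
    assume "\<not> coprime (a + N * s) b"
    then have "\<not> is_unit (gcd (a + N * s) b)" by (simp add: coprime_iff_gcd_eq_1)
    then obtain p where p: "prime p" "p dvd a + N * s" "p dvd b"
      using assms(1) prime_divisor_exists[of "gcd (a + N * s) b"] by auto
    have pb: "p \<in> prime_factors b" using p assms(1) by (simp add: in_prime_factors_iff)
    show False
    proof (cases "p dvd a")
      case True
      then have "p dvd N * s" using p(2) by (simp add: dvd_add_right_iff)
      moreover have "\<not> p dvd N"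
      proof
        assume "p dvd N"
        then have "p dvd gcd a (gcd b N)" using True p by simp
        then have "p dvd 1" using assms(2) by (simp only:)
        then show False using p(1) not_prime_unit by blast
      qed
      ultimately have "p dvd s" using p(1) prime_dvd_multD by blast
      then obtain q where q: "q \<in> prime_factors b" "\<not> q dvd a" "p dvd q"
        unfolding s_def using p(1) by (auto simp: prime_dvd_prod_iff)
      then have "p = q" using p(1) by (auto intro: primes_dvd_imp_eq)
      then show False using q True by simp
    next
      case False
      then have "p dvd s" unfolding s_def using pb by (intro dvd_prodI) auto
      then have "p dvd a" using p(2) by (metis dvd_add_left_iff dvd_mult)
      with False show False by simp
    qed
  qed
  then show ?thesis ..
qed

lemma cusp_reps_lift:
  assumes N: "N > 0" and t: "t \<in> cusp_reps N k"
  shows "\<exists>x y. coprime x y \<and> cusp_rel N k (x, y) t"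
proof -
  obtain a b where ab: "t = (a, b)" "gcd a (gcd b N) = 1" using t by (auto simp: cusp_reps_def)
  \<comment> \<open>The lemma on coprime lifts needs a nonzero second entry.\<close>
  define y where "y = (if b = 0 then N else b)"
  have y: "y \<noteq> 0" "gcd a (gcd y N) = 1" "[b = y] (mod N)" using N ab by (auto simp: y_def cong_def)
  obtain s where "coprime (a + N * s) y" using coprime_lift_exists[OF y(1,2)] by blast
  moreover have "[a = a + N * s] (mod gcd (k * y) N)" by (simp add: cong_iff_dvd_diff)
  ultimately show ?thesis using y(3) ab by (intro exI[of _ "a + N * s"] exI[of _ y]) (auto simp: cusp_rel_def)
qed

theorem card_cusps_Gamma_family:
  assumes N: "N > 0" and k: "k dvd N"
  shows "card (cusps (Gamma_family N k)) = card (cusp_reps N k)"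
proof -
  have "\<exists>t. t \<in> cusp_reps N k \<and> (\<exists>x y. coprime x y \<and> z = proj_point (x, y) \<and> cusp_rel N k (x, y) t)" for z
    using proj_point_surj[of z] cusp_reps_exist[OF N] by metis
  then obtain f where f: "\<And>z. f z \<in> cusp_reps N k"
    "\<And>z. \<exists>x y. coprime x y \<and> z = proj_point (x, y) \<and> cusp_rel N k (x, y) (f z)" by metis
  have iff: "(\<exists>g\<in>Gamma_family N k. w = Defs.moebius g z) \<longleftrightarrow> f z = f w" for z w
  proof -
    obtain x y where z: "coprime x y" "z = proj_point (x, y)" "cusp_rel N k (x, y) (f z)" using f(2) by blast
    obtain x' y' where w: "coprime x' y'" "w = proj_point (x', y')" "cusp_rel N k (x', y') (f w)" using f(2) by blast
    have "(\<exists>g\<in>Gamma_family N k. w = Defs.moebius g z) \<longleftrightarrow> cusp_rel N k (x, y) (x', y')"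
      unfolding z(2) w(2) by (rule orbit_iff_cusp_rel[OF k z(1) w(1)])
    also have "\<dots> \<longleftrightarrow> f z = f w"
    proof
      assume "cusp_rel N k (x, y) (x', y')"
      then have "cusp_rel N k (f z) (f w)" using z(3) w(3) cusp_rel_sym cusp_rel_trans by blast
      then show "f z = f w" using cusp_reps_unique[OF N f(1) f(1)] by blast
    next
      assume "f z = f w"
      then show "cusp_rel N k (x, y) (x', y')" using z(3) w(3) cusp_rel_sym cusp_rel_trans by metis
    qed
    finally show ?thesis .
  qed
  have "cusps (Gamma_family N k) = (\<lambda>t. f -` {t}) ` range f"
  proof -
    have "{(z, w). f z = f w} `` {z} = f -` {f z}" for z by auto
    then show ?thesis unfolding cusps_def iff quotient_def by (auto simp: image_iff)
  qed
  moreover have "inj_on (\<lambda>t. f -` {t}) (range f)"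
  proof (rule inj_onI)
    fix t t' assume t: "t \<in> range f" and eq: "f -` {t} = f -` {t'}"
    from t obtain z where z: "t = f z" ..
    then have "z \<in> f -` {t'}" using eq by blast
    then show "t = t'" using z by simp
  qed
  ultimately have "card (cusps (Gamma_family N k)) = card (range f)" by (simp add: card_image)
  also have "range f = cusp_reps N k"
  proof (intro equalityI subsetI)
    fix t assume t: "t \<in> cusp_reps N k"
    obtain x y where xy: "coprime x y" "cusp_rel N k (x, y) t" using cusp_reps_lift[OF N t] by blast
    define z where "z = proj_point (x, y)"
    obtain x' y' where w: "coprime x' y'" "z = proj_point (x', y')" "cusp_rel N k (x', y') (f z)" using f(2) by blast
    have "(x', y') = (x, y) \<or> (x', y') = (- x, - y)" using proj_point_eq_iff[OF xy(1) w(1)] w(2) z_def by simp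
    then have "cusp_rel N k (x, y) (x', y')" 
      using cusp_rel_uminus[of N k "(x, y)" x y] by (auto simp: cusp_rel_def)
    then have "cusp_rel N k t (f z)" using xy(2) w(3) cusp_rel_sym cusp_rel_trans by blast
    then have "t = f z" using cusp_reps_unique[OF N t f(1)] by blast
    then show "t \<in> range f" by simp
  qed (use f(1) in auto)
  finally show ?thesis .
qed


lemma card_cusp_reps:
  assumes "N > 0"
  shows "card (cusp_reps N k) = length (filter (\<lambda>(a, b). gcd a (gcd b N) = 1 \<and>
     (b = 0 \<or> 2 * b = N \<longrightarrow> 2 * a \<le> gcd (k * b) N))
     (concat (map (\<lambda>b. map (\<lambda>a. (a, b)) [0..gcd (k * b) N - 1]) [0..N div 2])))"
proof -
  let ?l = "filter (\<lambda>(a, b). gcd a (gcd b N) = 1 \<and> (b = 0 \<or> 2 * b = N \<longrightarrow> 2 * a \<le> gcd (k * b) N))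
     (concat (map (\<lambda>b. map (\<lambda>a. (a, b)) [0..gcd (k * b) N - 1]) [0..N div 2]))"
  have half: "2 * b \<le> N \<longleftrightarrow> b \<le> N div 2" for b by presburger
  have "cusp_reps N k = set ?l"
    unfolding cusp_reps_def half by (auto simp: image_iff)
  moreover have "distinct ?l"
  proof (intro distinct_filter distinct_concat)
    let ?m = "\<lambda>b. map (\<lambda>a. (a, b)) [0..gcd (k * b) N - 1]"
    have "inj_on ?m UNIV"
    proof (rule inj_onI)
      fix b c assume eq: "?m b = ?m c"
      have "gcd (k * b) N > 0" using assms by simp
      then have "(0, b) \<in> set (?m b)" by auto
      then show "b = c" unfolding eq by auto
    qed
    then show "distinct (map ?m [0..N div 2])"
      by (simp add: distinct_map inj_on_subset[of _ UNIV])
  qed (auto simp: distinct_map inj_on_def)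
  ultimately show ?thesis by (simp only: distinct_card)
qed

lemma Gamma1_eq: "Gamma1 N = Gamma_family (int N) 1"
  by (auto simp: Gamma1_def Gamma_family_def)

lemma Gamma_eq: "Gamma N = Gamma_family (int N) (int N)"
  by (auto simp: Gamma_def Gamma_family_def)

lemma Gamma1_inter_Gamma_2: "even N \<Longrightarrow> Gamma1 N \<inter> Gamma 2 = Gamma_family (int N) 2"
  by (auto simp: Gamma1_def Gamma_def Gamma_family_def intro: cong_dvd_modulus)

lemma num_cusps_eq:
  "num_cusps Z2 = 2" "num_cusps Z3 = 2" "num_cusps Z4 = 3" "num_cusps Z2xZ2 = 3"
  "num_cusps Z5 = 4" "num_cusps Z6 = 4" "num_cusps Z7 = 6" "num_cusps Z8 = 6"
  "num_cusps Z9 = 8" "num_cusps Z10 = 8" "num_cusps Z12 = 10"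
  "num_cusps Z2xZ4 = 4" "num_cusps Z2xZ6 = 6" "num_cusps Z2xZ8 = 10"
  unfolding num_cusps_def modular_group.simps
  unfolding Gamma1_inter_Gamma_2[of 4, simplified] Gamma1_inter_Gamma_2[of 6, simplified]
    Gamma1_inter_Gamma_2[of 8, simplified]
  unfolding Gamma1_eq Gamma_eq of_nat_numeral
  by (subst card_cusps_Gamma_family, simp, simp, subst card_cusp_reps, simp, code_simp)+

section \<open>Counting nodal values modulo a prime\<close>

lemma quotient_of_of_int_div:
  assumes "d \<noteq> 0" "quotient_of (of_int x / of_int d) = (m, n)"
  shows "n dvd d" "m * d = x * n" "n > 0"
proof -
  show n: "n > 0" using quotient_of_denom_pos[OF assms(2)] .
  have "of_int x / of_int d = (of_int m / of_int n :: rat)" using quotient_of_div[OF assms(2)] .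
  then have "(of_int (m * d) :: rat) = of_int (x * n)" using assms(1) n by (simp add: field_simps)
  then show eq: "m * d = x * n" by (simp only: of_int_eq_iff)
  have "coprime m n" using quotient_of_coprime[OF assms(2)] .
  moreover have "n dvd m * d" unfolding eq by simp
  ultimately show "n dvd d" by (simp add: coprime_dvd_mult_right_iff coprime_commute)
qed

lemma reduce_mod_div:
  assumes p: "prime p" and d: "\<not> int p dvd d"
  shows "reduce_mod p (of_int x / of_int d) \<in> Fp p" "[d * reduce_mod p (of_int x / of_int d) = x] (mod int p)"
proof -
  have d0: "d \<noteq> 0" using d by auto
  obtain m n where mn: "quotient_of (of_int x / of_int d) = (m, n)" by force
  note q = quotient_of_of_int_div[OF d0 mn]
  have red: "reduce_mod p (of_int x / of_int d) = (m * modular_inverse (int p) n) mod int p"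
    by (simp add: reduce_mod_def mn)
  show "reduce_mod p (of_int x / of_int d) \<in> Fp p" unfolding red using prime_gt_0_nat[OF p] by simp
  have "\<not> int p dvd n" using d q(1) dvd_trans by blast
  then have "coprime n (int p)" using p prime_imp_coprime[of "int p" n] by (simp add: coprime_commute)
  then have inv: "[n * modular_inverse (int p) n = 1] (mod int p)" by (rule cong_modular_inverse1)
  have "[d * reduce_mod p (of_int x / of_int d) = d * (m * modular_inverse (int p) n)] (mod int p)"
    unfolding red by (intro cong_mult cong_refl) (simp add: cong_def)
  also have "d * (m * modular_inverse (int p) n) = x * (n * modular_inverse (int p) n)"
    using q(2) by (metis mult.assoc mult.commute)
  also have "[x * (n * modular_inverse (int p) n) = x * 1] (mod int p)" by (intro cong_mult cong_refl inv)
  finally show "[d * reduce_mod p (of_int x / of_int d) = x] (mod int p)" by simp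
qed

lemma prime_dvd_mult_cancel_int:
  assumes "prime p" "\<not> int p dvd d"
  shows "int p dvd d * x \<longleftrightarrow> int p dvd x"
  using assms by (simp add: prime_dvd_mult_iff)

text \<open>
  For \<open>A / d\<close> and \<open>B / d\<close> in place of \<open>A\<close> and \<open>B\<close> the discriminant is \<open>(4 A ^ 3 + 27 d B ^ 2) / d ^ 3\<close>; the common
  denominator \<open>d\<close> makes it possible to stay within the integers.
\<close>

definition nodal_value :: "nat \<Rightarrow> int \<Rightarrow> int \<Rightarrow> int \<Rightarrow> bool" where
  "nodal_value p d A B \<longleftrightarrow> int p dvd 4 * A ^ 3 + 27 * d * B ^ 2 \<and> \<not> (int p dvd A \<and> int p dvd B)"

lemma nodal_value_cong:
  assumes "[A = A'] (mod int p)" "[B = B'] (mod int p)"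
  shows "nodal_value p d A B \<longleftrightarrow> nodal_value p d A' B'"
proof -
  have "[4 * A ^ 3 + 27 * d * B ^ 2 = 4 * A' ^ 3 + 27 * d * B' ^ 2] (mod int p)"
    by (intro cong_add cong_mult cong_pow cong_refl assms)
  from cong_dvd_iff[OF this] cong_dvd_iff[OF assms(1)] cong_dvd_iff[OF assms(2)]
  show ?thesis unfolding nodal_value_def by blast
qed

lemma nodal_value_scale:
  assumes "prime p" "\<not> int p dvd c"
  shows "nodal_value p d (c ^ (2 * k) * A) (c ^ (3 * k) * B) \<longleftrightarrow> nodal_value p d A B"
proof -
  have nd: "\<not> int p dvd c ^ j" for j
    using assms prime_dvd_power[of "int p"] by auto
  have "4 * (c ^ (2 * k) * A) ^ 3 + 27 * d * (c ^ (3 * k) * B) ^ 2 = c ^ (6 * k) * (4 * A ^ 3 + 27 * d * B ^ 2)"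
    by (simp add: power_mult_distrib power_mult[symmetric] algebra_simps)
  then show ?thesis unfolding nodal_value_def by (simp only: prime_dvd_mult_cancel_int[OF assms(1) nd])
qed

lemma c_mult_eq_card:
  assumes p: "prime p" and d: "\<not> int p dvd d"
    and fg: "\<And>a b. fst (fg G) a b = of_int (F a b) / of_int d" "\<And>a b. snd (fg G) a b = of_int (K a b) / of_int d"
  shows "c_mult G p = real (card {(a, b) \<in> Fp p \<times> Fp p. nodal_value p d (F a b) (K a b)}) / real p ^ 2"
proof -
  define R where "R = (\<lambda>(a, b). (reduce_mod p (fst (fg G) a b), reduce_mod p (snd (fg G) a b)))"
  have fin: "finite (Fp p \<times> Fp p)" by simp
  have WR: "W G p J = {ab \<in> Fp p \<times> Fp p. R ab = J}" for J by (auto simp: W_def R_def)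
  have "(\<Sum>J\<in>nodal p. card (W G p J)) = card (\<Union>J\<in>nodal p. W G p J)"
    using fin by (intro card_UN_disjoint[symmetric])
      (auto simp: WR nodal_def intro: finite_subset[OF _ fin])
  also have "(\<Union>J\<in>nodal p. W G p J) = {(a, b) \<in> Fp p \<times> Fp p. nodal_value p d (F a b) (K a b)}"
  proof -
    have "R (a, b) \<in> nodal p \<longleftrightarrow> nodal_value p d (F a b) (K a b)" for a b
    proof -
      define A B where "A = reduce_mod p (fst (fg G) a b)" and "B = reduce_mod p (snd (fg G) a b)"
      have A: "A \<in> Fp p" "[d * A = F a b] (mod int p)" and B: "B \<in> Fp p" "[d * B = K a b] (mod int p)"
        unfolding A_def B_def fg using reduce_mod_div[OF p d] by blast+
      have zero: "int p dvd C \<longleftrightarrow> C = 0" if "C \<in> Fp p" for C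
      proof
        assume "int p dvd C"
        then show "C = 0" using that zdvd_not_zless[of C "int p"] by (cases "0 < C") auto
      qed simp
      have "nodal_value p d (F a b) (K a b) \<longleftrightarrow> nodal_value p d (d * A) (d * B)"
        by (rule nodal_value_cong[OF cong_sym[OF A(2)] cong_sym[OF B(2)]])
      also have "\<dots> \<longleftrightarrow> int p dvd d ^ 3 * (4 * A ^ 3 + 27 * B ^ 2) \<and> \<not> (int p dvd A \<and> int p dvd B)"
        unfolding nodal_value_def prime_dvd_mult_cancel_int[OF p d]
        by (simp add: algebra_simps power2_eq_square power3_eq_cube)
      also have "int p dvd d ^ 3 * (4 * A ^ 3 + 27 * B ^ 2) \<longleftrightarrow> int p dvd 4 * A ^ 3 + 27 * B ^ 2"
        by (rule prime_dvd_mult_cancel_int[OF p]) (use p d prime_dvd_power[of "int p"] in auto)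
      finally show ?thesis
        using A(1) B(1) zero unfolding R_def nodal_def by (auto simp: A_def B_def cong_0_iff)
    qed
    then have mem: "R ab \<in> nodal p \<longleftrightarrow> (case ab of (a, b) \<Rightarrow> nodal_value p d (F a b) (K a b))" for ab
      by (cases ab) simp
    have "(\<Union>J\<in>nodal p. W G p J) = {ab \<in> Fp p \<times> Fp p. R ab \<in> nodal p}" by (auto simp: WR)
    then show ?thesis unfolding mem by auto
  qed
  finally have "(\<Sum>J\<in>nodal p. card (W G p J)) = card {(a, b) \<in> Fp p \<times> Fp p. nodal_value p d (F a b) (K a b)}" .
  then show ?thesis unfolding c_mult_def by (simp flip: of_nat_sum)
qed

text \<open>
  On each row \<open>b \<noteq> 0\<close> the substitution \<open>a = b ^ w t\<close> is a bijection that leads back to the row \<open>b = 1\<close>.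
\<close>

lemma card_scaling_invariant:
  fixes B :: "int \<Rightarrow> int \<Rightarrow> bool"
  assumes p: "prime p" and per: "\<And>a b. B (a mod int p) (b mod int p) \<longleftrightarrow> B a b"
    and scale: "\<And>a b c. \<not> int p dvd c \<Longrightarrow> B (c ^ w * a) (c * b) \<longleftrightarrow> B a b"
  shows "card {(a, b) \<in> Fp p \<times> Fp p. B a b} = (p - 1) * card {t \<in> Fp p. B t 1} + card {a \<in> Fp p. B a 0}"
proof -
  have p0: "int p > 0" using prime_gt_0_nat[OF p] by simp
  have row: "card {a \<in> Fp p. B a b} = card {t \<in> Fp p. B t 1}" if b: "b \<in> {1..<int p}" for b
  proof -
    have nb: "\<not> int p dvd b" using b by (intro zdvd_not_zless) auto
    then have cop: "coprime (b ^ w) (int p)"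
      using p prime_imp_coprime[of "int p" b] by (simp add: coprime_commute)
    have per1: "B (a mod int p) c \<longleftrightarrow> B a c" for a c by (metis per mod_mod_trivial)
    have inj: "inj_on (\<lambda>t. b ^ w * t mod int p) (Fp p)"
    proof (rule inj_onI)
      fix s t assume st: "s \<in> Fp p" "t \<in> Fp p" and eq: "b ^ w * s mod int p = b ^ w * t mod int p"
      then have "[s = t] (mod int p)" using cop by (metis cong_def cong_mult_lcancel)
      then show "s = t" using st by (simp add: cong_def)
    qed
    have "(\<lambda>t. b ^ w * t mod int p) ` Fp p = Fp p"
      by (rule endo_inj_surj[OF _ _ inj]) (use p0 in auto)
    then have bij: "bij_betw (\<lambda>t. b ^ w * t mod int p) (Fp p) (Fp p)" using inj by (simp add: bij_betw_def)
    have iff: "B (b ^ w * t mod int p) b \<longleftrightarrow> B t 1" for t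
      unfolding per1 using scale[OF nb, of t 1] by simp
    have "{a \<in> Fp p. B a b} = (\<lambda>t. b ^ w * t mod int p) ` {t \<in> Fp p. B t 1}"
    proof (intro equalityI subsetI)
      fix a assume a: "a \<in> {a \<in> Fp p. B a b}"
      then have "a \<in> (\<lambda>t. b ^ w * t mod int p) ` Fp p" using bij unfolding bij_betw_def by blast
      then obtain t where "t \<in> Fp p" "a = b ^ w * t mod int p" by blast
      with a iff show "a \<in> (\<lambda>t. b ^ w * t mod int p) ` {t \<in> Fp p. B t 1}" by blast
    next
      fix a assume "a \<in> (\<lambda>t. b ^ w * t mod int p) ` {t \<in> Fp p. B t 1}"
      then obtain t where "B t 1" "a = b ^ w * t mod int p" by blast
      with iff p0 show "a \<in> {a \<in> Fp p. B a b}" by simp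
    qed
    moreover have "inj_on (\<lambda>t. b ^ w * t mod int p) {t \<in> Fp p. B t 1}" using inj by (rule inj_on_subset) auto
    ultimately show ?thesis by (simp add: card_image)
  qed
  have "{(a, b) \<in> Fp p \<times> Fp p. B a b} = (\<lambda>(b, a). (a, b)) ` Sigma (Fp p) (\<lambda>b. {a \<in> Fp p. B a b})" by auto
  then have "card {(a, b) \<in> Fp p \<times> Fp p. B a b} = card (Sigma (Fp p) (\<lambda>b. {a \<in> Fp p. B a b}))"
    by (simp add: card_image inj_on_def)
  also have "\<dots> = (\<Sum>b\<in>Fp p. card {a \<in> Fp p. B a b})"     by (rule card_SigmaI) (auto intro: finite_subset[of _ "Fp p"])
  also have "\<dots> = card {a \<in> Fp p. B a 0} + (\<Sum>b\<in>Fp p - {0}. card {a \<in> Fp p. B a b})"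
    by (rule sum.remove) (use p0 in auto)
  also have "Fp p - {0} = {1..<int p}" by auto
  also have "(\<Sum>b\<in>{1..<int p}. card {a \<in> Fp p. B a b}) = (\<Sum>b\<in>{1..<int p}. card {t \<in> Fp p. B t 1})"
    by (intro sum.cong refl row)
  finally show ?thesis using p0 by (simp add: nat_diff_distrib')
qed

definition num_roots :: "nat \<Rightarrow> int poly \<Rightarrow> nat" where
  "num_roots p q = card {t \<in> Fp p. int p dvd poly q t}"

lemma poly_cong: "[x = y] (mod (n::int)) \<Longrightarrow> [poly q x = poly q y] (mod n)"
  by (induction q) (auto intro!: cong_add cong_mult)

definition simple_roots :: "nat \<Rightarrow> int poly \<Rightarrow> bool" where
  "simple_roots p q \<longleftrightarrow> (\<forall>t. \<not> (int p dvd poly q t \<and> int p dvd poly (pderiv q) t))"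

text \<open>
  Two factors with a common root would give the product a multiple root.
\<close>

lemma num_roots_prod_list:
  assumes p: "prime p" and "simple_roots p (prod_list qs)"
  shows "num_roots p (prod_list qs) = (\<Sum>q\<leftarrow>qs. num_roots p q)"
  using assms(2)
proof (induction qs)
  case Nil
  have "\<not> int p dvd 1" using p by auto
  then show ?case by (simp add: num_roots_def)
next
  case (Cons q qs)
  let ?R = "prod_list qs"
  have simple: "simple_roots p (q * ?R)" using Cons.prems by simp
  have der: "poly (pderiv (q * ?R)) t = poly q t * poly (pderiv ?R) t + poly ?R t * poly (pderiv q) t" for t
    by (simp add: pderiv_mult)
  have "simple_roots p ?R"
    unfolding simple_roots_def
  proof (intro allI notI)
    fix t assume "int p dvd poly ?R t \<and> int p dvd poly (pderiv ?R) t"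
    then have "int p dvd poly (q * ?R) t \<and> int p dvd poly (pderiv (q * ?R)) t" unfolding der by simp
    then show False using simple unfolding simple_roots_def by blast
  qed
  then have IH: "num_roots p ?R = (\<Sum>q\<leftarrow>qs. num_roots p q)" by (rule Cons.IH)
  have fin: "finite {t \<in> Fp p. X t}" for X by (rule finite_subset[of _ "Fp p"]) auto
  have disj: "{t \<in> Fp p. int p dvd poly q t} \<inter> {t \<in> Fp p. int p dvd poly ?R t} = {}"
  proof (intro equals0I)
    fix t assume "t \<in> {t \<in> Fp p. int p dvd poly q t} \<inter> {t \<in> Fp p. int p dvd poly ?R t}"
    then have "int p dvd poly (q * ?R) t \<and> int p dvd poly (pderiv (q * ?R)) t" unfolding der by simp
    then show False using simple unfolding simple_roots_def by blast
  qed
  have "{t \<in> Fp p. int p dvd poly (q * ?R) t} = {t \<in> Fp p. int p dvd poly q t} \<union> {t \<in> Fp p. int p dvd poly ?R t}"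
    using p by (auto simp: prime_dvd_mult_iff)
  then have "num_roots p (q * ?R) = num_roots p q + num_roots p ?R"
    unfolding num_roots_def using card_Un_disjoint[OF fin fin disj] by (simp only:)
  then show ?case using IH by simp
qed

text \<open>
  All constants that must be invertible modulo \<open>p\<close> are products of a few small primes; this turns the
  invertibility into a divisibility between numerals.
\<close>

lemma not_dvd_of_dvd_power:
  assumes "prime p" "\<not> int p dvd n" "c dvd n ^ j"
  shows "\<not> int p dvd c"
  using assms prime_dvd_power[of "int p"] dvd_trans by (metis prime_nat_int_transfer)

lemma no_common_root_mod:
  assumes "A * P + B * Q = [:c:]" "\<not> int p dvd c"
  shows "\<not> (int p dvd poly P t \<and> int p dvd poly Q t)"
proof
  assume "int p dvd poly P t \<and> int p dvd poly Q t"
  then have "int p dvd poly (A * P + B * Q) t" by simp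
  then show False using assms by simp
qed

text \<open>
  The zeros of the discriminant are those of \<open>P\<close>, the product of the factors \<open>q\<close>.  The first Bezout identity
  shows that the factors have no common or multiple roots modulo \<open>p\<close>, the second that \<open>F\<close> does
  not vanish at them, so that the singular cubic is not cuspidal.
\<close>

lemma card_nodal_affine:
  fixes F K :: "int poly" and d :: int
  assumes p: "prime p" and n: "\<not> int p dvd n"
    and disc: "4 * F ^ 3 + [:27 * d:] * K ^ 2 = [:C:] * (\<Prod>(q, e)\<leftarrow>qes. q ^ Suc e)" "C dvd n ^ j"
    and simple: "A * (\<Prod>(q, e)\<leftarrow>qes. q) + B * pderiv (\<Prod>(q, e)\<leftarrow>qes. q) = [:c:]" "c dvd n ^ j"
    and cusp: "A' * (\<Prod>(q, e)\<leftarrow>qes. q) + B' * F = [:c':]" "c' dvd n ^ j"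
    and split: "\<And>q e. (q, e) \<in> set qes \<Longrightarrow> num_roots p q = degree q"
  shows "card {t \<in> Fp p. nodal_value p d (poly F t) (poly K t)} = (\<Sum>(q, e)\<leftarrow>qes. degree q)"
proof -
  let ?P = "\<Prod>(q, e)\<leftarrow>qes. q"
  note nd = not_dvd_of_dvd_power[OF p n]
  have "int p dvd poly (\<Prod>(q, e)\<leftarrow>qes. q ^ Suc e) t \<longleftrightarrow> int p dvd poly ?P t" for t
    using p by (induction qes) (auto simp: prime_dvd_mult_iff prime_dvd_power_iff simp flip: power_Suc)
  then have D: "int p dvd 4 * poly F t ^ 3 + 27 * d * poly K t ^ 2 \<longleftrightarrow> int p dvd poly ?P t" for t
    using arg_cong[OF disc(1), of "\<lambda>q. poly q t"] prime_dvd_mult_cancel_int[OF p nd[OF disc(2)]] by simp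
  have "nodal_value p d (poly F t) (poly K t) \<longleftrightarrow> int p dvd poly ?P t" for t
    unfolding nodal_value_def D using no_common_root_mod[OF cusp(1) nd[OF cusp(2)], of t] by blast
  then have "card {t \<in> Fp p. nodal_value p d (poly F t) (poly K t)} = num_roots p (prod_list (map fst qes))"
    by (simp add: num_roots_def case_prod_unfold)
  also have "\<dots> = (\<Sum>q\<leftarrow>map fst qes. num_roots p q)"
    using no_common_root_mod[OF simple(1) nd[OF simple(2)]]
    by (intro num_roots_prod_list[OF p]) (simp add: simple_roots_def case_prod_unfold)
  also have "\<dots> = (\<Sum>(q, e)\<leftarrow>qes. degree q)"
    unfolding map_map using split by (intro arg_cong[where f = sum_list] map_cong) auto
  finally show ?thesis .
qed

lemma card_nodal_weighted:
  fixes F K :: "int \<Rightarrow> int \<Rightarrow> int"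
  assumes p: "prime p"
    and per: "\<And>a b. [F (a mod int p) (b mod int p) = F a b] (mod int p)" "\<And>a b. [K (a mod int p) (b mod int p) = K a b] (mod int p)"
    and scale: "\<And>a b c. F (c ^ w * a) (c * b) = c ^ (2 * k) * F a b" "\<And>a b c. K (c ^ w * a) (c * b) = c ^ (3 * k) * K a b"
    and affine: "\<And>t. F t 1 = poly F\<^sub>1 t" "\<And>t. K t 1 = poly K\<^sub>1 t"
  shows "card {(a, b) \<in> Fp p \<times> Fp p. nodal_value p d (F a b) (K a b)} =
    (p - 1) * card {t \<in> Fp p. nodal_value p d (poly F\<^sub>1 t) (poly K\<^sub>1 t)} +
    card {a \<in> Fp p. nodal_value p d (F a 0) (K a 0)}"
proof -
  let ?B = "\<lambda>a b. nodal_value p d (F a b) (K a b)"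
  have "card {(a, b) \<in> Fp p \<times> Fp p. ?B a b} = (p - 1) * card {t \<in> Fp p. ?B t 1} + card {a \<in> Fp p. ?B a 0}"
  proof (rule card_scaling_invariant[OF p, where w = w])
    show "?B (a mod int p) (b mod int p) \<longleftrightarrow> ?B a b" for a b
      by (rule nodal_value_cong[OF per])
    show "?B (c ^ w * a) (c * b) \<longleftrightarrow> ?B a b" if "\<not> int p dvd c" for a b c
      unfolding scale by (rule nodal_value_scale[OF p that])
  qed
  then show ?thesis unfolding affine .
qed

section \<open>Polynomials that split modulo a prime\<close>

text \<open>
  The constants \<open>c\<close> and \<open>c'\<close> absorb denominators, as when a quadratic polynomial is multiplied by \<open>4 a\<close>.
\<close>

lemma num_roots_eq_length:
  assumes p: "prime p" and c: "\<not> int p dvd c"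
    and fac: "\<And>t. [c * poly q t = c' * (\<Prod>r\<leftarrow>rs. t - r)] (mod int p)" "\<not> int p dvd c'"
    and dist: "\<And>i j. i < j \<Longrightarrow> j < length rs \<Longrightarrow> \<not> int p dvd rs ! i - rs ! j"
  shows "num_roots p q = length rs"
proof -
  have p0: "int p > 0" using prime_gt_0_nat[OF p] by simp
  have prod: "int p dvd (\<Prod>r\<leftarrow>rs. t - r) \<longleftrightarrow> (\<exists>r\<in>set rs. int p dvd t - r)" for t
    using p by (induction rs) (auto simp: prime_dvd_mult_iff)
  have iff: "int p dvd poly q t \<longleftrightarrow> (\<exists>r\<in>set rs. t mod int p = r mod int p)" for t
  proof -
    have "int p dvd poly q t \<longleftrightarrow> int p dvd c * poly q t" by (simp only: prime_dvd_mult_cancel_int[OF p c])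
    also have "\<dots> \<longleftrightarrow> int p dvd c' * (\<Prod>r\<leftarrow>rs. t - r)" by (rule cong_dvd_iff[OF fac(1)])
    also have "\<dots> \<longleftrightarrow> (\<exists>r\<in>set rs. int p dvd t - r)" by (simp only: prime_dvd_mult_cancel_int[OF p fac(2)] prod)
    finally show ?thesis by (simp only: mod_eq_dvd_iff)
  qed
  have "{t \<in> Fp p. int p dvd poly q t} = (\<lambda>r. r mod int p) ` set rs"
    unfolding iff using p0 by force
  moreover have "distinct (map (\<lambda>r. r mod int p) rs)"
    unfolding distinct_conv_nth
  proof (intro allI impI)
    fix i j assume ij: "i < length (map (\<lambda>r. r mod int p) rs)" "j < length (map (\<lambda>r. r mod int p) rs)" "i \<noteq> j"
    have "\<not> int p dvd rs ! i - rs ! j"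
    proof (cases "i < j")
      case True
      then show ?thesis using dist ij by simp
    next
      case False
      then have "\<not> int p dvd rs ! j - rs ! i" using dist ij by simp
      then show ?thesis by (simp add: dvd_diff_commute)
    qed
    then show "map (\<lambda>r. r mod int p) rs ! i \<noteq> map (\<lambda>r. r mod int p) rs ! j"
      using ij by (simp add: mod_eq_dvd_iff)
  qed
  then have "card (set (map (\<lambda>r. r mod int p) rs)) = length rs" using distinct_card by fastforce
  ultimately show ?thesis by (simp add: num_roots_def)
qed

lemma inverse_mod_exists:
  assumes "prime p" "\<not> int p dvd a"
  obtains i where "[a * i = 1] (mod int p)"
proof -
  have "coprime a (int p)" using assms prime_imp_coprime[of "int p" a] by (simp add: coprime_commute)
  then show thesis using that cong_modular_inverse1 by blast
qed

lemma num_roots_linear: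
  assumes p: "prime p" and a: "\<not> int p dvd a"
  shows "num_roots p [:b, a:] = 1"
proof -
  obtain i where i: "[a * i = 1] (mod int p)" using inverse_mod_exists[OF p a] .
  have "num_roots p [:b, a:] = length [- (b * i)]"
  proof (rule num_roots_eq_length[OF p, where c = 1 and c' = a])
    fix t
    have "[b * 1 + a * t = b * (a * i) + a * t] (mod int p)" by (intro cong_add cong_mult cong_refl cong_sym[OF i])
    then show "[1 * poly [:b, a:] t = a * (\<Prod>r\<leftarrow>[- (b * i)]. t - r)] (mod int p)" by (simp add: algebra_simps)
  qed (use p a in auto)
  then show ?thesis by simp
qed

lemma num_roots_quadratic:
  assumes p: "prime p" and a: "\<not> int p dvd 2 * a" 
    and r: "[r\<^sup>2 = b\<^sup>2 - 4 * a * c] (mod int p)" "\<not> int p dvd b\<^sup>2 - 4 * a * c"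
  shows "num_roots p [:c, b, a:] = 2"
proof -
  obtain i where i: "[2 * a * i = 1] (mod int p)" using inverse_mod_exists[OF p a] .
  have fac: "[4 * a * poly [:c, b, a:] t = 4 * a\<^sup>2 * ((t - (r - b) * i) * (t - (- r - b) * i))] (mod int p)" for t
  proof -
    have "4 * a\<^sup>2 * ((t - (r - b) * i) * (t - (- r - b) * i)) = (2 * a * t - (r - b) * (2 * a * i)) * (2 * a * t - (- r - b) * (2 * a * i))"
      by (simp add: algebra_simps power2_eq_square)
    also have "[\<dots> = (2 * a * t - (r - b) * 1) * (2 * a * t - (- r - b) * 1)] (mod int p)"
      by (intro cong_mult cong_diff cong_refl i)
    also have "(2 * a * t - (r - b) * 1) * (2 * a * t - (- r - b) * 1) = (2 * a * t + b)\<^sup>2 - r\<^sup>2"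
      by (simp add: algebra_simps power2_eq_square)
    also have "[\<dots> = (2 * a * t + b)\<^sup>2 - (b\<^sup>2 - 4 * a * c)] (mod int p)" by (intro cong_diff cong_refl r)
    also have "(2 * a * t + b)\<^sup>2 - (b\<^sup>2 - 4 * a * c) = 4 * a * poly [:c, b, a:] t"
      by (simp add: algebra_simps power2_eq_square)
    finally show ?thesis by (rule cong_sym)
  qed
  have 2: "\<not> int p dvd 2" and na: "\<not> int p dvd a" using a by auto
  then have 4: "\<not> int p dvd 4 * a" "\<not> int p dvd 4 * a\<^sup>2"
    using p prime_dvd_mult_cancel_int[OF p 2, of 2] by (auto simp: prime_dvd_mult_iff prime_dvd_power_iff)
  have nr: "\<not> int p dvd (r - b) * i - (- r - b) * i"
  proof
    assume "int p dvd (r - b) * i - (- r - b) * i"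
    then have "int p dvd 2 * r * i" by (simp add: algebra_simps)
    then have "int p dvd 2 \<or> int p dvd r \<or> int p dvd i" using p by (auto simp: prime_dvd_mult_iff)
    moreover have "\<not> int p dvd r"
    proof
      assume "int p dvd r"
      then have "int p dvd r\<^sup>2" by (simp add: power2_eq_square)
      then show False using r cong_dvd_iff by blast
    qed
    moreover have "\<not> int p dvd i"
    proof
      assume "int p dvd i"
      then have "int p dvd 2 * a * i" by simp
      then have "int p dvd 1" using i cong_dvd_iff by blast
      then show False using p by auto
    qed
    ultimately show False using 2 by blast
  qed
  have "num_roots p [:c, b, a:] = length [(r - b) * i, (- r - b) * i]"
    by (rule num_roots_eq_length[OF p 4(1) _ 4(2)]) (use fac nr in \<open>auto simp: less_Suc_eq\<close>)
  then show ?thesis by simp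
qed

text \<open>
  In these cubics (the simplest cubic fields) the substitution \<open>t \<mapsto> 1 / (1 - t)\<close> permutes the roots, so
  one root \<open>r\<close> gives all three.  Here \<open>1 / (1 - r)\<close> is the polynomial \<open>s\<close> in \<open>r\<close>, and the square root of the
  discriminant is \<open>n ^ 2 + 3 n + 9\<close>.
\<close>

lemma num_roots_simplest_cubic:
  fixes n r :: int
  assumes p: "prime p" and r: "int p dvd poly [:1, n, - (n + 3), 1:] r"
    and disc: "\<not> int p dvd n\<^sup>2 + 3 * n + 9"
  shows "num_roots p [:1, n, - (n + 3), 1:] = 3"
proof -
  define q where "q = (\<lambda>t. t ^ 3 - (n + 3) * t\<^sup>2 + n * t + 1)"
  have qp: "poly [:1, n, - (n + 3), 1:] t = q t" for t
    by (simp add: q_def algebra_simps power2_eq_square power3_eq_cube)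
  \<comment> \<open>\<open>s\<close> is \<open>1 / (1 - r)\<close> and \<open>u\<close> the remaining root, by the sum of the roots.\<close>
  define s u where "s = - r\<^sup>2 + (n + 2) * r + 2" and "u = n + 3 - r - s"
  have q0: "int p dvd q r" using r unfolding qp .
  have fac: "q t - (t - r) * ((t - s) * (t - u)) = q r * ((r - n - 2) * t + s - 1)" for t
    unfolding q_def s_def u_def by (simp add: algebra_simps power2_eq_square power3_eq_cube)
  have diff: "(r - s) * (s - u) * (u - r) - (n\<^sup>2 + 3 * n + 9) = q r *
      (- 2 * r ^ 3 + (9 + 4 * n) * r\<^sup>2 + (- 3 - 10 * n - 2 * n\<^sup>2) * r + (n\<^sup>2 - 3 * n - 11))"
    unfolding q_def s_def u_def by (simp add: algebra_simps power2_eq_square power3_eq_cube)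
  have nd: "\<not> int p dvd (r - s) * (s - u) * (u - r)"
  proof
    assume "int p dvd (r - s) * (s - u) * (u - r)"
    moreover have "int p dvd (r - s) * (s - u) * (u - r) - (n\<^sup>2 + 3 * n + 9)" unfolding diff using q0 by simp
    ultimately show False using disc by (metis dvd_diff_right_iff)
  qed
  have "num_roots p [:1, n, - (n + 3), 1:] = length [r, s, u]"
  proof (rule num_roots_eq_length[OF p, where c = 1 and c' = 1])
    show "[1 * poly [:1, n, - (n + 3), 1:] t = 1 * (\<Prod>r\<leftarrow>[r, s, u]. t - r)] (mod int p)" for t
    proof -
      have "int p dvd q t - (t - r) * ((t - s) * (t - u))" unfolding fac using q0 by simp
      then show ?thesis by (simp only: qp cong_iff_dvd_diff list.map prod_list.Cons prod_list.Nil mult_1 mult_1_right)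
    qed
    show "\<not> int p dvd [r, s, u] ! i - [r, s, u] ! j" if "i < j" "j < length [r, s, u]" for i j
    proof -
      have "\<not> int p dvd r - s" "\<not> int p dvd s - u" "\<not> int p dvd r - u"
        using nd by (auto simp: dvd_diff_commute)
      then show ?thesis using that by (auto simp: less_Suc_eq numeral_3_eq_3)
    qed
  qed (use p in auto)
  then show ?thesis by simp
qed

text \<open>
  The sum is \<open>(w ^ q - 1) / (w - 1)\<close> for \<open>w = z ^ m\<close>, so it suffices to take for \<open>z\<close> a power of a primitive root
  of order \<open>q m\<close>.
\<close>

lemma cyclotomic_root_mod:
  fixes q m :: nat
  assumes p: "prime p" and q: "q > 1" "q * m dvd p - 1"
  obtains z :: int where "int p dvd (\<Sum>i<q. z ^ (m * i))"
proof -
  have p1: "p - 1 > 0" using prime_gt_1_nat[OF p] by simp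
  have "p > 1" by (rule prime_gt_1_nat[OF p])
  then obtain g where "residue_primroot p g" using prime_primitive_root_exists[OF _ p] by blast
  then have g: "ord p g = p - 1" using p by (simp add: residue_primroot_def totient_prime)
  obtain l where l: "p - 1 = q * m * l" using q(2) by (elim dvdE)
  have l0: "l > 0" "m > 0" using l p1 by (auto intro: Nat.gr0I)
  define z where "z = g ^ l"
  have "[(z ^ m) ^ q = 1] (mod p)"
    unfolding z_def ord_divides' [simplified] power_mult[symmetric] One_nat_def
    using g l by (simp add: ord_divides' mult_ac)
  then have 1: "[int (z ^ m) ^ q = 1] (mod int p)" by (metis cong_int_iff of_nat_1 of_nat_power)
  have "\<not> [z ^ m = 1] (mod p)"
  proof
    assume "[z ^ m = 1] (mod p)"
    then have "p - 1 dvd l * m" by (simp add: z_def power_mult[symmetric] ord_divides' g)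
    then have "q * (m * l) \<le> 1 * (m * l)" using l l0 by (auto dest!: dvd_imp_le simp: mult_ac)
    then show False using q(1) l0 by simp
  qed
  then have "\<not> [int (z ^ m) = 1] (mod int p)" by (metis cong_int_iff of_nat_1)
  then have 2: "\<not> int p dvd int (z ^ m) - 1" by (simp add: cong_iff_dvd_diff)
  have "int p dvd (int (z ^ m) - 1) * (\<Sum>i<q. int (z ^ m) ^ i)"
    using 1 by (simp only: power_diff_1_eq[symmetric] cong_iff_dvd_diff)
  then have "int p dvd (\<Sum>i<q. int (z ^ m) ^ i)" by (simp only: prime_dvd_mult_cancel_int[OF p 2])
  then have "int p dvd (\<Sum>i<q. int z ^ (m * i))" by (simp add: power_mult)
  then show thesis by (rule that)
qed


section \<open>Binary forms\<close>

definition hom_eval :: "int poly \<Rightarrow> int \<Rightarrow> int \<Rightarrow> int" where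
  "hom_eval P a b = (\<Sum>i\<le>degree P. Polynomial.coeff P i * a ^ i * b ^ (degree P - i))"

lemma homogenize_eq_hom_eval: "homogenize P a b = of_int (hom_eval P a b)"
  by (simp add: homogenize_def hom_eval_def)

lemma hom_eval_scale: "hom_eval P (c * a) (c * b) = c ^ degree P * hom_eval P a b"
  unfolding hom_eval_def sum_distrib_left
proof (rule sum.cong[OF refl])
  fix i assume "i \<in> {..degree P}"
  then have "c ^ degree P = c ^ i * c ^ (degree P - i)" by (simp add: power_add[symmetric])
  then show "Polynomial.coeff P i * (c * a) ^ i * (c * b) ^ (degree P - i) = c ^ degree P * (Polynomial.coeff P i * a ^ i * b ^ (degree P - i))"
    by (simp add: power_mult_distrib mult_ac)
qed

lemma hom_eval_1: "hom_eval P t 1 = poly P t"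
  by (simp add: hom_eval_def poly_altdef)

lemma hom_eval_0: "hom_eval P a 0 = lead_coeff P * a ^ degree P"
proof -
  have "hom_eval P a 0 = (\<Sum>i\<in>{degree P}. Polynomial.coeff P i * a ^ i * 0 ^ (degree P - i))"
    unfolding hom_eval_def by (rule sum.mono_neutral_right) auto
  then show ?thesis by simp
qed

lemma hom_eval_mod: "[hom_eval P (a mod n) (b mod n) = hom_eval P a b] (mod n)"
  unfolding hom_eval_def by (intro cong_sum cong_mult cong_pow cong_refl) (simp_all add: cong_def)

text \<open>
  The zeros of the discriminant form on the projective line are the roots of the \<open>q\<close> and the point at
  infinity, which is a cusp because of the condition on the leading coefficients.  Each of these points
  carries \<open>p - 1\<close> pairs.
\<close>

lemma c_mult_homogeneous:
  fixes F K :: "int poly"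
  assumes p: "prime p" and n: "\<not> int p dvd n"
    and fg: "fg G = (homogenize F, homogenize K)"
    and deg: "degree F = 4 * k" "degree K = 6 * k" "k > 0"
    and inf: "4 * lead_coeff F ^ 3 + 27 * lead_coeff K ^ 2 = 0" "lead_coeff F dvd n ^ j"
    and disc: "4 * F ^ 3 + [:27:] * K ^ 2 = [:C:] * (\<Prod>(q, e)\<leftarrow>qes. q ^ Suc e)" "C dvd n ^ j"
    and simple: "A * (\<Prod>(q, e)\<leftarrow>qes. q) + B * pderiv (\<Prod>(q, e)\<leftarrow>qes. q) = [:c:]" "c dvd n ^ j"
    and cusp: "A' * (\<Prod>(q, e)\<leftarrow>qes. q) + B' * F = [:c':]" "c' dvd n ^ j"
    and split: "\<And>q e. (q, e) \<in> set qes \<Longrightarrow> num_roots p q = degree q"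
  shows "c_mult G p = real (p - 1) / real p ^ 2 * real (1 + (\<Sum>(q, e)\<leftarrow>qes. degree q))"
proof -
  let ?B = "\<lambda>a b. nodal_value p 1 (hom_eval F a b) (hom_eval K a b)"
  have p0: "int p > 0" using prime_gt_0_nat[OF p] by simp
  have c: "c_mult G p = real (card {(a, b) \<in> Fp p \<times> Fp p. ?B a b}) / real p ^ 2"
    by (rule c_mult_eq_card[OF p]) (use p in \<open>auto simp: fg homogenize_eq_hom_eval\<close>)
  have "card {(a, b) \<in> Fp p \<times> Fp p. ?B a b} =
      (p - 1) * card {t \<in> Fp p. nodal_value p 1 (poly F t) (poly K t)} + card {a \<in> Fp p. ?B a 0}"
    by (rule card_nodal_weighted[OF p, where w = 1 and k = "2 * k"])
       (simp_all add: hom_eval_mod hom_eval_scale hom_eval_1 deg)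
  also have "card {t \<in> Fp p. nodal_value p 1 (poly F t) (poly K t)} = (\<Sum>(q, e)\<leftarrow>qes. degree q)"
    by (rule card_nodal_affine[OF p n _ disc(2) simple cusp split]) (use disc(1) in simp)
  also have "{a \<in> Fp p. ?B a 0} = {1..<int p}"
  proof -
    have lc: "nodal_value p 1 (lead_coeff F) (lead_coeff K)"
      unfolding nodal_value_def using inf not_dvd_of_dvd_power[OF p n] by simp
    have "?B a 0 \<longleftrightarrow> a \<noteq> 0" if a: "a \<in> Fp p" for a
    proof (cases "a = 0")
      case True
      have "hom_eval F 0 0 = 0" "hom_eval K 0 0 = 0" using deg by (simp_all add: hom_eval_0 power_0_left)
      then show ?thesis using True by (simp add: nodal_value_def)
    next
      case False
      then have nd: "\<not> int p dvd a" using a by (intro zdvd_not_zless) auto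
      have "hom_eval F a 0 = a ^ (2 * (2 * k)) * lead_coeff F" "hom_eval K a 0 = a ^ (3 * (2 * k)) * lead_coeff K"
        by (simp_all add: hom_eval_0 deg)
      with nodal_value_scale[OF p nd, of 1 "2 * k" "lead_coeff F" "lead_coeff K"] lc False
      show ?thesis by (simp only: simp_thms)
    qed
    then show ?thesis by auto
  qed
  finally have "card {(a, b) \<in> Fp p \<times> Fp p. ?B a b} = (p - 1) * (1 + (\<Sum>(q, e)\<leftarrow>qes. degree q))"
    by (simp add: nat_diff_distrib' algebra_simps)
  then show ?thesis unfolding c by (simp only: of_nat_mult times_divide_eq_left)
qed

section \<open>The parametrizing polynomials\<close>

definition of_poly :: "int poly \<Rightarrow> int poly fract" where
  "of_poly P = Fraction_Field.Fract P 1"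

lemma of_poly_hom:
  "of_poly (P + Q) = of_poly P + of_poly Q" "of_poly (P * Q) = of_poly P * of_poly Q"
  "of_poly (- P) = - of_poly P" "of_poly (P - Q) = of_poly P - of_poly Q"
  "of_poly 0 = 0" "of_poly 1 = 1"
  by (simp_all add: of_poly_def Zero_fract_def One_fract_def)

lemma of_poly_power: "of_poly (P ^ n) = of_poly P ^ n"
  by (induction n) (simp_all add: of_poly_hom)

lemma of_poly_of_nat: "of_poly (of_nat n) = of_nat n"
  by (induction n) (simp_all add: of_poly_hom)

lemma of_poly_numeral: "of_poly (numeral n) = numeral n"
  using of_poly_of_nat[of "numeral n"] by simp

lemma of_poly_eq_iff: "of_poly P = of_poly Q \<longleftrightarrow> P = Q"
  by (simp add: of_poly_def eq_fract)

lemma poly_of_fract_of_poly: "poly_of_fract (of_poly P) = P"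
  unfolding poly_of_fract_def of_poly_def[symmetric] of_poly_eq_iff by simp

lemma tvar_eq: "tvar = of_poly [:0, 1:]"
  by (simp add: tvar_def of_poly_def)

lemma
  fixes s u v :: "'a :: field"
  shows tate_b2_scale: "s\<^sup>2 * tate_b2 u v = (s - v * s)\<^sup>2 - 4 * (u * s\<^sup>2)"
    and tate_b4_scale: "s ^ 4 * tate_b4 u v = - (s * (u * s\<^sup>2) * (s - v * s))"
    and tate_b6_scale: "s ^ 6 * tate_b6 u v = s\<^sup>2 * (u * s\<^sup>2)\<^sup>2"
  unfolding tate_b2_def tate_b4_def tate_b6_def by (simp_all add: algebra_simps eval_nat_numeral)

lemma tate_c4_scale:
  fixes s u v :: "'a :: field"
  shows "s ^ 4 * tate_c4 u v = ((s - v * s)\<^sup>2 - 4 * (u * s\<^sup>2))\<^sup>2 + 24 * (s * (u * s\<^sup>2) * (s - v * s))"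
proof -
  have "s ^ 4 * tate_c4 u v = (s\<^sup>2 * tate_b2 u v)\<^sup>2 - 24 * (s ^ 4 * tate_b4 u v)"
    unfolding tate_c4_def by (simp add: algebra_simps eval_nat_numeral)
  then show ?thesis unfolding tate_b2_scale tate_b4_scale by simp
qed

lemma tate_c6_scale:
  fixes s u v :: "'a :: field"
  shows "s ^ 6 * tate_c6 u v = - (((s - v * s)\<^sup>2 - 4 * (u * s\<^sup>2)) ^ 3)
      - 36 * (((s - v * s)\<^sup>2 - 4 * (u * s\<^sup>2)) * (s * (u * s\<^sup>2) * (s - v * s))) - 216 * (s\<^sup>2 * (u * s\<^sup>2)\<^sup>2)"
proof -
  have "s ^ 6 * tate_c6 u v = - ((s\<^sup>2 * tate_b2 u v) ^ 3) + 36 * ((s\<^sup>2 * tate_b2 u v) * (s ^ 4 * tate_b4 u v))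
      - 216 * (s ^ 6 * tate_b6 u v)"
    unfolding tate_c6_def by (simp add: algebra_simps eval_nat_numeral)
  then show ?thesis unfolding tate_b2_scale tate_b4_scale tate_b6_scale by simp
qed

text \<open>
  The factors \<open>s ^ 4\<close> and \<open>s ^ 6\<close> clear denominators: the invariants depend only on \<open>s\<close>, \<open>v s\<close> and \<open>u s ^ 2\<close>, which
  are polynomials for all groups considered.
\<close>

lemma tate_pair_eq:
  assumes s: "s = of_poly S" and v: "v * s = of_poly V" and u: "u * s\<^sup>2 = of_poly U"
    and F: "F = - 27 * (((S - V)\<^sup>2 - 4 * U)\<^sup>2 + 24 * (S * U * (S - V)))"
    and K: "K = - 54 * (- (((S - V)\<^sup>2 - 4 * U) ^ 3) - 36 * (((S - V)\<^sup>2 - 4 * U) * (S * U * (S - V))) - 216 * (S\<^sup>2 * U\<^sup>2))"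
  shows "tate_pair u v s = (homogenize F, homogenize K)"
proof -
  note hom = of_poly_hom of_poly_power of_poly_numeral
  have "s ^ 4 * tate_c4 u v = of_poly (((S - V)\<^sup>2 - 4 * U)\<^sup>2 + 24 * (S * U * (S - V)))"
    unfolding tate_c4_scale v u unfolding s hom ..
  then have F': "- 27 * s ^ 4 * tate_c4 u v = of_poly F"
    unfolding F mult.assoc[of "- 27" "s ^ 4"] by (simp only: hom)
  have "s ^ 6 * tate_c6 u v = of_poly (- (((S - V)\<^sup>2 - 4 * U) ^ 3) - 36 * (((S - V)\<^sup>2 - 4 * U) * (S * U * (S - V))) - 216 * (S\<^sup>2 * U\<^sup>2))"
    unfolding tate_c6_scale v u unfolding s hom ..
  then have K': "- 54 * s ^ 6 * tate_c6 u v = of_poly K"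
    unfolding K mult.assoc[of "- 54" "s ^ 6"] by (simp only: hom)
  show ?thesis unfolding tate_pair_def F' K' poly_of_fract_of_poly ..
qed

lemma of_poly_of_int: "of_poly (of_int n) = of_int n"
  by (cases n) (simp_all add: of_poly_hom of_poly_of_nat)

lemma of_poly_pCons: "of_poly (pCons a P) = of_int a + tvar * of_poly P"
proof -
  have "pCons a P = of_int a + [:0, 1:] * P" by (simp add: of_int_poly)
  then show ?thesis by (simp only: of_poly_hom of_poly_of_int tvar_eq)
qed

lemmas tvar_eval = of_poly_pCons of_poly_hom algebra_simps eval_nat_numeral

lemmas poly_eval = numeral_poly eval_nat_numeral one_pCons

lemma tvar_poly_nonzero:
  "tvar \<noteq> 0" "tvar - 1 \<noteq> 0" "- tvar\<^sup>2 + 3 * tvar - 1 \<noteq> 0" "8 * tvar\<^sup>2 - 1 \<noteq> 0"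
  "2 * tvar * (4 * tvar + 1) * (8 * tvar\<^sup>2 - 1) \<noteq> 0"
proof -
  have nz: "x \<noteq> 0" if "x = of_poly P" "P \<noteq> 0" for x P
    using that of_poly_eq_iff[of P 0] by (simp add: of_poly_hom)
  show "tvar \<noteq> 0" by (rule nz[of _ "[:0, 1:]"]) (simp add: tvar_eval, simp)
  show "tvar - 1 \<noteq> 0" by (rule nz[of _ "[:-1, 1:]"]) (simp add: tvar_eval, simp)
  show "- tvar\<^sup>2 + 3 * tvar - 1 \<noteq> 0" by (rule nz[of _ "[:-1, 3, -1:]"]) (simp add: tvar_eval, simp)
  show "8 * tvar\<^sup>2 - 1 \<noteq> 0" by (rule nz[of _ "[:-1, 0, 8:]"]) (simp add: tvar_eval, simp)
  show "2 * tvar * (4 * tvar + 1) * (8 * tvar\<^sup>2 - 1) \<noteq> 0"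
    by (rule nz[of _ "[:0, -2, -8, 16, 64:]"]) (simp add: tvar_eval, simp)
qed

lemma denominator_cancel:
  fixes w :: "'a :: field"
  assumes "w \<noteq> 0"
  shows "x / w * w = x" "x / w\<^sup>2 * w\<^sup>2 = x"
        "x / w ^ 4 * (w ^ 3)\<^sup>2 = x * w\<^sup>2"
        "x / w\<^sup>2 * (z * w)\<^sup>2 = x * z\<^sup>2"
        "x / w ^ 3 * w ^ 3 = x"
  using assms by (simp_all add: field_simps eval_nat_numeral)

section \<open>Primes at which all cusps are rational\<close>

lemma not_dvd_210:
  assumes "prime p" "p mod 2520 = 1"
  shows "\<not> int p dvd 210"
proof
  assume "int p dvd 210"
  then have "p dvd 210" by presburger
  then have "p \<le> 210" by (rule dvd_imp_le) simp
  then show False using assms by auto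
qed

text \<open>
  Square roots from roots of unity of order 4, 8, 3 and 5: with \<open>\<zeta>\<close> of the respective order they are \<open>\<zeta>\<close>,
  \<open>\<zeta> + 1 / \<zeta>\<close>, \<open>2 \<zeta> + 1\<close> and \<open>1 + 2 (\<zeta> + 1 / \<zeta>)\<close>; the root of 3 is the product of those of -1 and -3.
\<close>

lemma quadratic_residues:
  assumes p: "prime p" "p mod 2520 = 1"
  shows "\<exists>r. [r\<^sup>2 = -1] (mod int p)" "\<exists>r. [r\<^sup>2 = 2] (mod int p)" "\<exists>r. [r\<^sup>2 = -3] (mod int p)"
    "\<exists>r. [r\<^sup>2 = 3] (mod int p)" "\<exists>r. [r\<^sup>2 = 5] (mod int p)"
proof -
  have dvd: "n dvd p - 1" if "n dvd 2520" for n
  proof -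
    have "2520 dvd p - 1" using p(2) by (metis dvd_minus_mod)
    then show ?thesis using that dvd_trans by blast
  qed
  obtain i :: int where "int p dvd (\<Sum>k<2. i ^ (2 * k))"
    using cyclotomic_root_mod[OF p(1), of 2 2] dvd[of 4] by auto
  then have i: "int p dvd 1 + i\<^sup>2" by (simp add: eval_nat_numeral)
  have ci: "[i\<^sup>2 = -1] (mod int p)" unfolding cong_iff_dvd_diff using i by (simp add: add.commute)
  then show "\<exists>r. [r\<^sup>2 = -1] (mod int p)" by blast
  obtain z :: int where "int p dvd (\<Sum>k<2. z ^ (4 * k))"
    using cyclotomic_root_mod[OF p(1), of 2 4] dvd[of 8] by auto
  then have z: "int p dvd 1 + z ^ 4" by (simp add: eval_nat_numeral)
  have "(z - z ^ 3)\<^sup>2 - 2 = (1 + z ^ 4) * (z\<^sup>2 - 2)" by (simp add: algebra_simps eval_nat_numeral)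
  then have "[(z - z ^ 3)\<^sup>2 = 2] (mod int p)" using z by (simp add: cong_iff_dvd_diff)
  then show "\<exists>r. [r\<^sup>2 = 2] (mod int p)" by blast
  obtain w :: int where "int p dvd (\<Sum>k<3. w ^ (1 * k))"
    using cyclotomic_root_mod[OF p(1), of 3 1] dvd[of 3] by auto
  then have w: "int p dvd 1 + w + w\<^sup>2" by (simp add: eval_nat_numeral)
  have "(2 * w + 1)\<^sup>2 - (- 3) = (1 + w + w\<^sup>2) * 4" by (simp add: algebra_simps eval_nat_numeral)
  then have cw: "[(2 * w + 1)\<^sup>2 = -3] (mod int p)" unfolding cong_iff_dvd_diff using w by (metis dvd_mult2)
  then show "\<exists>r. [r\<^sup>2 = -3] (mod int p)" by blast
  have "[(i * (2 * w + 1))\<^sup>2 = (- 1) * (- 3)] (mod int p)"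
    unfolding power_mult_distrib by (rule cong_mult[OF ci cw])
  then show "\<exists>r. [r\<^sup>2 = 3] (mod int p)" by auto
  obtain y :: int where "int p dvd (\<Sum>k<5. y ^ (1 * k))"
    using cyclotomic_root_mod[OF p(1), of 5 1] dvd[of 5] by auto
  then have y: "int p dvd 1 + y + y\<^sup>2 + y ^ 3 + y ^ 4" by (simp add: eval_nat_numeral algebra_simps)
  have "(1 + 2 * (y + y ^ 4))\<^sup>2 - 5 = (1 + y + y\<^sup>2 + y ^ 3 + y ^ 4) * (4 * (y ^ 4 - y ^ 3 + 2 * y) - 4)"
    by (simp add: algebra_simps eval_nat_numeral)
  then have "[(1 + 2 * (y + y ^ 4))\<^sup>2 = 5] (mod int p)" unfolding cong_iff_dvd_diff using y by (metis dvd_mult2)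
  then show "\<exists>r. [r\<^sup>2 = 5] (mod int p)" by blast
qed

text \<open>
  The roots are \<open>4 + 3 (\<zeta> + 1 / \<zeta>) + (\<zeta> ^ 2 + 1 / \<zeta> ^ 2)\<close> for \<open>\<zeta>\<close> of order 7 and \<open>2 + 2 (\<zeta> + 1 / \<zeta>) + (\<zeta> ^ 2 + 1 / \<zeta> ^ 2)\<close> for
  \<open>\<zeta>\<close> of order 9, reduced modulo the cyclotomic polynomial.
\<close>

lemma cubic_roots:
  assumes p: "prime p" "p mod 2520 = 1"
  shows "\<exists>r. int p dvd poly [:1, 5, -8, 1:] r" "\<exists>r. int p dvd poly [:1, 3, -6, 1:] r"
proof -
  have dvd: "n dvd p - 1" if "n dvd 2520" for n
  proof -
    have "2520 dvd p - 1" using p(2) by (metis dvd_minus_mod)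
    then show ?thesis using that dvd_trans by blast
  qed
  obtain z :: int where "int p dvd (\<Sum>k<7. z ^ (1 * k))"
    using cyclotomic_root_mod[OF p(1), of 7 1] dvd[of 7] by auto
  then have z: "int p dvd 1 + z + z\<^sup>2 + z ^ 3 + z ^ 4 + z ^ 5 + z ^ 6" by (simp add: eval_nat_numeral algebra_simps)
  have "poly [:1, 5, -8, 1:] (1 - 2 * z\<^sup>2 - 3 * z ^ 3 - 3 * z ^ 4 - 2 * z ^ 5) = 
     (1 + z + z\<^sup>2 + z ^ 3 + z ^ 4 + z ^ 5 + z ^ 6) * poly [:-1, 1, 16, 8, -20, -48, -69, -54, -28, -8:] z"
    by (simp add: algebra_simps eval_nat_numeral)
  then show "\<exists>r. int p dvd poly [:1, 5, -8, 1:] r" using z by (metis dvd_mult2)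
  obtain y :: int where "int p dvd (\<Sum>k<3. y ^ (3 * k))"
    using cyclotomic_root_mod[OF p(1), of 3 3] dvd[of 9] by auto
  then have y: "int p dvd 1 + y ^ 3 + y ^ 6" by (simp add: eval_nat_numeral)
  have "poly [:1, 3, -6, 1:] (2 + y - y\<^sup>2 - y ^ 4 - 2 * y ^ 5) = (1 + y ^ 3 + y ^ 6) * poly [:-9, -9, 9, 10, 15, 12, -5, -6, -12, -8:] y"
    by (simp add: algebra_simps eval_nat_numeral)
  then show "\<exists>r. int p dvd poly [:1, 3, -6, 1:] r" using y by (metis dvd_mult2)
qed

lemma num_roots_split:
  assumes p: "prime p" "p mod 2520 = 1"
  shows "num_roots p [:0, 1:] = 1" "num_roots p [:1, 1:] = 1" "num_roots p [:1, 9:] = 1"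
    "num_roots p [:-1, 1:] = 1" "num_roots p [:-1, 2:] = 1" "num_roots p [:1, 2:] = 1" "num_roots p [:1, 4:] = 1"
    "num_roots p [:-2, 1:] = 1" "num_roots p [:2, 1:] = 1" "num_roots p [:-6, 1:] = 1" "num_roots p [:6, 1:] = 1"
    "num_roots p [:-1, -11, 1:] = 2" "num_roots p [:1, -8, 8:] = 2" "num_roots p [:1, -1, 1:] = 2"
    "num_roots p [:1, -3, 1:] = 2" "num_roots p [:-1, -2, 4:] = 2" "num_roots p [:1, -2, 2:] = 2"
    "num_roots p [:1, -3, 3:] = 2" "num_roots p [:1, -6, 6:] = 2" "num_roots p [:-1, 0, 8:] = 2"
    "num_roots p [:1, 4, 8:] = 2" "num_roots p [:1, 8, 8:] = 2"
    "num_roots p [:1, 5, -8, 1:] = 3" "num_roots p [:1, 3, -6, 1:] = 3"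
proof -
  note nd = not_dvd_of_dvd_power[OF p(1) not_dvd_210[OF p], of _ 10]
  show "num_roots p [:0, 1:] = 1" "num_roots p [:1, 1:] = 1" "num_roots p [:1, 9:] = 1"
    "num_roots p [:-1, 1:] = 1" "num_roots p [:-1, 2:] = 1" "num_roots p [:1, 2:] = 1" "num_roots p [:1, 4:] = 1"
    "num_roots p [:-2, 1:] = 1" "num_roots p [:2, 1:] = 1" "num_roots p [:-6, 1:] = 1" "num_roots p [:6, 1:] = 1"
    by (rule num_roots_linear[OF p(1)], rule nd, simp)+
  have quad: "num_roots p [:c, b, a:] = 2"
    if h: "\<exists>r. [r\<^sup>2 = D] (mod int p)" "b\<^sup>2 - 4 * a * c = k\<^sup>2 * D" "2 * a dvd 210 ^ 10" "k\<^sup>2 * D dvd 210 ^ 10" for a b c k D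
  proof -
    obtain r where r: "[r\<^sup>2 = D] (mod int p)" using h(1) by blast
    have "[(k * r)\<^sup>2 = b\<^sup>2 - 4 * a * c] (mod int p)"
      unfolding h(2) power_mult_distrib by (intro cong_mult cong_refl r)
    then show ?thesis using num_roots_quadratic[OF p(1) nd[OF h(3)]] nd[OF h(4)] h(2) by metis
  qed
  note res = quadratic_residues[OF p]
  show "num_roots p [:-1, -11, 1:] = 2" by (rule quad[OF res(5), where k = 5]) simp_all
  show "num_roots p [:1, -8, 8:] = 2" by (rule quad[OF res(2), where k = 4]) simp_all
  show "num_roots p [:1, -1, 1:] = 2" by (rule quad[OF res(3), where k = 1]) simp_all
  show "num_roots p [:1, -3, 1:] = 2" by (rule quad[OF res(5), where k = 1]) simp_all
  show "num_roots p [:-1, -2, 4:] = 2" by (rule quad[OF res(5), where k = 2]) simp_all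
  show "num_roots p [:1, -2, 2:] = 2" by (rule quad[OF res(1), where k = 2]) simp_all
  show "num_roots p [:1, -3, 3:] = 2" by (rule quad[OF res(3), where k = 1]) simp_all
  show "num_roots p [:1, -6, 6:] = 2" by (rule quad[OF res(4), where k = 2]) simp_all
  show "num_roots p [:-1, 0, 8:] = 2" by (rule quad[OF res(2), where k = 4]) simp_all
  show "num_roots p [:1, 4, 8:] = 2" by (rule quad[OF res(1), where k = 4]) simp_all
  show "num_roots p [:1, 8, 8:] = 2" by (rule quad[OF res(2), where k = 4]) simp_all
  show "num_roots p [:1, 5, -8, 1:] = 3"
    using num_roots_simplest_cubic[OF p(1), where n = 5] cubic_roots(1)[OF p] nd[of 49] by auto
  show "num_roots p [:1, 3, -6, 1:] = 3"
    using num_roots_simplest_cubic[OF p(1), where n = 3] cubic_roots(2)[OF p] nd[of 27] by auto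
qed

section \<open>The groups of order at least 5\<close>

text \<open>
  For each group, the list pairs the factors of the discriminant of the short Weierstrass form with their
  multiplicities, lowered by 1; the multiplicity of a factor is the common order of the pole of the
  j-invariant at the corresponding cusps.  The point at infinity is a further rational cusp.
\<close>

lemma c_mult_Z5:
  assumes p: "prime p" "p mod 2520 = 1"
  shows "c_mult Z5 p = real (p - 1) / real p ^ 2 * real (num_cusps Z5)"
proof -
  let ?F = "[:-27, -324, -378, 324, -27:] :: int poly"
  let ?K = "[:54, 972, 4050, 0, 4050, -972, 54:] :: int poly"
  let ?qes = "[([:0, 1:], 4), ([:-1, -11, 1:], 0)] :: (int poly \<times> nat) list"
  have fg: "fg Z5 = (homogenize ?F, homogenize ?K)"
    unfolding fg.simps Let_def
    by (rule tate_pair_eq[where S = "[:1:]" and V = "[:0, 1:]" and U = "[:0, 1:]"])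
      (simp add: tvar_eval, simp add: tvar_eval, simp add: tvar_eval, simp add: poly_eval, simp add: poly_eval)
  have disc: "4 * ?F ^ 3 + [:27:] * ?K ^ 2 = [:-136048896:] * (\<Prod>(q, e)\<leftarrow>?qes. q ^ Suc e)"
    by (simp add: poly_eval)
  have simple: "[:5489, -744:] * (\<Prod>(q, e)\<leftarrow>?qes. q) + [:-125, -2739, 248:] * pderiv (\<Prod>(q, e)\<leftarrow>?qes. q) = [:125:]"
    by (simp add: pderiv_pCons)
  have cusp: "[:-33426, -47817, 38205, -3159:] * (\<Prod>(q, e)\<leftarrow>?qes. q)
      + [:-5, 1298, -117:] * ?F = [:135:]"
    by simp
  have "c_mult Z5 p = real (p - 1) / real p ^ 2 * real (1 + (\<Sum>(q, e)\<leftarrow>?qes. degree q))"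
  proof (rule c_mult_homogeneous[OF p(1) not_dvd_210[OF p] fg _ _ _ _ _ disc _ simple _ cusp, where k = 1 and j = 30])
    show "num_roots p q = degree q" if "(q, e) \<in> set ?qes" for q e
      using that by (auto simp: num_roots_split[OF p])
  qed simp_all
  then show ?thesis by (simp add: num_cusps_eq)
qed

lemma c_mult_Z6:
  assumes p: "prime p" "p mod 2520 = 1"
  shows "c_mult Z6 p = real (p - 1) / real p ^ 2 * real (num_cusps Z6)"
proof -
  let ?F = "[:-27, -324, -810, -324, -243:] :: int poly"
  let ?K = "[:54, 972, 5346, 9720, 7290, -2916, -1458:] :: int poly"
  let ?qes = "[([:0, 1:], 5), ([:1, 1:], 2), ([:1, 9:], 0)] :: (int poly \<times> nat) list"
  have fg: "fg Z6 = (homogenize ?F, homogenize ?K)"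
    unfolding fg.simps Let_def
    by (rule tate_pair_eq[where S = "[:1:]" and V = "[:0, 1:]" and U = "[:0, 1, 1:]"])
      (simp add: tvar_eval, simp add: tvar_eval, simp add: tvar_eval, simp add: poly_eval, simp add: poly_eval)
  have disc: "4 * ?F ^ 3 + [:27:] * ?K ^ 2 = [:-136048896:] * (\<Prod>(q, e)\<leftarrow>?qes. q ^ Suc e)"
    by (simp add: poly_eval)
  have simple: "[:-1325, -1971:] * (\<Prod>(q, e)\<leftarrow>?qes. q) + [:32, 685, 657:] * pderiv (\<Prod>(q, e)\<leftarrow>?qes. q) = [:32:]"
    by (simp add: pderiv_pCons)
  have cusp: "[:189783, 624186, 238383, 195372:] * (\<Prod>(q, e)\<leftarrow>?qes. q)
      + [:-16, 7221, 7236:] * ?F = [:432:]"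
    by simp
  have "c_mult Z6 p = real (p - 1) / real p ^ 2 * real (1 + (\<Sum>(q, e)\<leftarrow>?qes. degree q))"
  proof (rule c_mult_homogeneous[OF p(1) not_dvd_210[OF p] fg _ _ _ _ _ disc _ simple _ cusp, where k = 1 and j = 30])
    show "num_roots p q = degree q" if "(q, e) \<in> set ?qes" for q e
      using that by (auto simp: num_roots_split[OF p])
  qed simp_all
  then show ?thesis by (simp add: num_cusps_eq)
qed

lemma c_mult_Z7:
  assumes p: "prime p" "p mod 2520 = 1"
  shows "c_mult Z7 p = real (p - 1) / real p ^ 2 * real (num_cusps Z7)"
proof -
  let ?F = "[:-27, -108, 378, 0, -945, 1512, -1134, 324, -27:] :: int poly"
  let ?K = "[:54, 324, -810, -2484, 9396, -11988, 14742, -26244, 30780, -19116, 6318, -972, 54:] :: int poly"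
  let ?qes = "[([:0, 1:], 6), ([:-1, 1:], 6), ([:1, 5, -8, 1:], 0)] :: (int poly \<times> nat) list"
  have fg: "fg Z7 = (homogenize ?F, homogenize ?K)"
    unfolding fg.simps Let_def
    by (rule tate_pair_eq[where S = "[:1:]" and V = "[:0, -1, 1:]" and U = "[:0, 0, -1, 1:]"])
      (simp add: tvar_eval, simp add: tvar_eval, simp add: tvar_eval, simp add: poly_eval, simp add: poly_eval)
  have disc: "4 * ?F ^ 3 + [:27:] * ?K ^ 2 = [:-136048896:] * (\<Prod>(q, e)\<leftarrow>?qes. q ^ Suc e)"
    by (simp add: poly_eval)
  have simple: "[:602, -4366, 6769, -1020:] * (\<Prod>(q, e)\<leftarrow>?qes. q) + [:-49, -210, 1727, -1721, 204:] * pderiv (\<Prod>(q, e)\<leftarrow>?qes. q) = [:49:]"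
    by (simp add: pderiv_pCons)
  have cusp: "[:21033, 1101303, -1103760, -2488374, 5244183, -5405400, 1792098, -158841:] * (\<Prod>(q, e)\<leftarrow>?qes. q)
      + [:-49, -583, -42259, 48725, -5883:] * ?F = [:1323:]"
    by simp
  have "c_mult Z7 p = real (p - 1) / real p ^ 2 * real (1 + (\<Sum>(q, e)\<leftarrow>?qes. degree q))"
  proof (rule c_mult_homogeneous[OF p(1) not_dvd_210[OF p] fg _ _ _ _ _ disc _ simple _ cusp, where k = 2 and j = 30])
    show "num_roots p q = degree q" if "(q, e) \<in> set ?qes" for q e
      using that by (auto simp: num_roots_split[OF p])
  qed simp_all
  then show ?thesis by (simp add: num_cusps_eq)
qed

lemma c_mult_Z8:
  assumes p: "prime p" "p mod 2520 = 1"
  shows "c_mult Z8 p = real (p - 1) / real p ^ 2 * real (num_cusps Z8)"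
proof -
  let ?F = "[:-27, 432, -2592, 7776, -12960, 12096, -6048, 1728, -432:] :: int poly"
  let ?K = "[:54, -1296, 12960, -71712, 246240, -554688, 840672, -855360, 555984, -190080, 0, 20736, -3456:] :: int poly"
  let ?qes = "[([:0, 1:], 7), ([:-1, 1:], 7), ([:-1, 2:], 3), ([:1, -8, 8:], 0)] :: (int poly \<times> nat) list"
  have fg: "fg Z8 = (homogenize ?F, homogenize ?K)"
    unfolding fg.simps Let_def
    by (rule tate_pair_eq[where S = "[:0, 1:]" and V = "[:1, -3, 2:]" and U = "[:0, 0, 1, -3, 2:]"])
      (simp add: tvar_eval, subst denominator_cancel(1)[OF tvar_poly_nonzero(1)], simp add: tvar_eval, simp add: tvar_eval, simp add: poly_eval, simp add: poly_eval)
  have disc: "4 * ?F ^ 3 + [:27:] * ?K ^ 2 = [:-136048896:] * (\<Prod>(q, e)\<leftarrow>?qes. q ^ Suc e)"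
    by (simp add: poly_eval)
  have simple: "[:74, -708, 1680, -1120:] * (\<Prod>(q, e)\<leftarrow>?qes. q) + [:1, -52, 276, -448, 224:] * pderiv (\<Prod>(q, e)\<leftarrow>?qes. q) = [:1:]"
    by (simp add: pderiv_pCons)
  have cusp: "[:-108108, 1081080, -4279392, 8682768, -9493200, 5294160, -1496880, 427680:] * (\<Prod>(q, e)\<leftarrow>?qes. q)
      + [:-1, -4020, 19860, -31680, 15840:] * ?F = [:27:]"
    by simp
  have "c_mult Z8 p = real (p - 1) / real p ^ 2 * real (1 + (\<Sum>(q, e)\<leftarrow>?qes. degree q))"
  proof (rule c_mult_homogeneous[OF p(1) not_dvd_210[OF p] fg _ _ _ _ _ disc _ simple _ cusp, where k = 2 and j = 30])
    show "num_roots p q = degree q" if "(q, e) \<in> set ?qes" for q e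
      using that by (auto simp: num_roots_split[OF p])
  qed simp_all
  then show ?thesis by (simp add: num_cusps_eq)
qed

lemma c_mult_Z9:
  assumes p: "prime p" "p mod 2520 = 1"
  shows "c_mult Z9 p = real (p - 1) / real p ^ 2 * real (num_cusps Z9)"
proof -
  let ?F = "[:-27, 0, 324, -756, 486, 972, -3078, 4860, -5103, 3456, -1458, 324, -27:] :: int poly"
  let ?K = "[:54, 0, -972, 2268, 1458, -16524, 39690, -58320, 73386, -109728, 174960, -228420, 222912, -160380, 84078, -30780, 7290, -972, 54:] :: int poly"
  let ?qes = "[([:0, 1:], 8), ([:-1, 1:], 8), ([:1, -1, 1:], 2), ([:1, 3, -6, 1:], 0)] :: (int poly \<times> nat) list"
  have fg: "fg Z9 = (homogenize ?F, homogenize ?K)"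
    unfolding fg.simps Let_def
    by (rule tate_pair_eq[where S = "[:1:]" and V = "[:0, 0, -1, 1:]" and U = "[:0, 0, -1, 2, -2, 1:]"])
      (simp add: tvar_eval, simp add: tvar_eval, simp add: tvar_eval, simp add: poly_eval, simp add: poly_eval)
  have disc: "4 * ?F ^ 3 + [:27:] * ?K ^ 2 = [:-136048896:] * (\<Prod>(q, e)\<leftarrow>?qes. q ^ Suc e)"
    by (simp add: poly_eval)
  have simple: "[:-56, -13832, 49271, -69056, 51601, -8302:] * (\<Prod>(q, e)\<leftarrow>?qes. q) + [:-243, 542, 5514, -13271, 14756, -8727, 1186:] * pderiv (\<Prod>(q, e)\<leftarrow>?qes. q) = [:243:]"
    by (simp add: pderiv_pCons)
  have cusp: "[:286254, 495045, -3461562, 4744089, 624510, -12093381, 23556177, -30607956, 24224994, -11819277, 2933793, -261738:] * (\<Prod>(q, e)\<leftarrow>?qes. q)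
      + [:-27, -10602, -29261, 89423, -109749, 69883, -9694:] * ?F = [:729:]"
    by simp
  have "c_mult Z9 p = real (p - 1) / real p ^ 2 * real (1 + (\<Sum>(q, e)\<leftarrow>?qes. degree q))"
  proof (rule c_mult_homogeneous[OF p(1) not_dvd_210[OF p] fg _ _ _ _ _ disc _ simple _ cusp, where k = 3 and j = 30])
    show "num_roots p q = degree q" if "(q, e) \<in> set ?qes" for q e
      using that by (auto simp: num_roots_split[OF p])
  qed simp_all
  then show ?thesis by (simp add: num_cusps_eq)
qed

lemma c_mult_Z10:
  assumes p: "prime p" "p mod 2520 = 1"
  shows "c_mult Z10 p = real (p - 1) / real p ^ 2 * real (num_cusps Z10)"
proof -
  let ?F = "[:-27, 216, -432, -1080, 6480, -11664, 6912, 7776, -19440, 19440, -11232, 3456, -432:] :: int poly"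
  let ?K = "[:54, -648, 2592, -216, -32400, 112752, -128304, -199584, 981072, -1803600, 2133216, -2037312, 1926288, -1767744, 1296000, -661824, 217728, -41472, 3456:] :: int poly"
  let ?qes = "[([:0, 1:], 9), ([:-1, 1:], 9), ([:-1, 2:], 4), ([:1, -3, 1:], 1), ([:-1, -2, 4:], 0)] :: (int poly \<times> nat) list"
  have fg: "fg Z10 = (homogenize ?F, homogenize ?K)"
    unfolding fg.simps Let_def
    by (rule tate_pair_eq[where S = "[:-1, 3, -1:]" and V = "[:0, 1, -3, 2:]" and U = "[:0, 0, 0, 1, -3, 2:]"])
      (simp add: tvar_eval, subst denominator_cancel(1)[OF tvar_poly_nonzero(3)], simp add: tvar_eval, subst denominator_cancel(2)[OF tvar_poly_nonzero(3)], simp add: tvar_eval, simp add: poly_eval, simp add: poly_eval)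
  have disc: "4 * ?F ^ 3 + [:27:] * ?K ^ 2 = [:-136048896:] * (\<Prod>(q, e)\<leftarrow>?qes. q ^ Suc e)"
    by (simp add: poly_eval)
  have simple: "[:-6832, 36752, 164520, -664704, 647328, -170016:] * (\<Prod>(q, e)\<leftarrow>?qes. q) + [:-25, 6632, -11324, -51948, 142176, -109824, 24288:] * pderiv (\<Prod>(q, e)\<leftarrow>?qes. q) = [:25:]"
    by (simp add: pderiv_pCons)
  have cusp: "[:2686608, -14767488, 6626880, 121350528, -342823536, 329382720, 87966432, -536086080, 636517008, -414758016, 139335552, -18558720:] * (\<Prod>(q, e)\<leftarrow>?qes. q)
      + [:-5, -99544, 148688, 747208, -2001920, 1549248, -343680:] * ?F = [:135:]"
    by simp
  have "c_mult Z10 p = real (p - 1) / real p ^ 2 * real (1 + (\<Sum>(q, e)\<leftarrow>?qes. degree q))"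
  proof (rule c_mult_homogeneous[OF p(1) not_dvd_210[OF p] fg _ _ _ _ _ disc _ simple _ cusp, where k = 3 and j = 30])
    show "num_roots p q = degree q" if "(q, e) \<in> set ?qes" for q e
      using that by (auto simp: num_roots_split[OF p])
  qed simp_all
  then show ?thesis by (simp add: num_cusps_eq)
qed

lemma c_mult_Z12:
  assumes p: "prime p" "p mod 2520 = 1"
  shows "c_mult Z12 p = real (p - 1) / real p ^ 2 * real (num_cusps Z12)"
proof -
  let ?F = "[:-27, 648, -7128, 47952, -221616, 747792, -1907712, 3753216, -5747760, 6855840, -6318000, 4416768, -2269296, 816480, -194400, 31104, -3888:] :: int poly"
  let ?K = "[:54, -1944, 33048, -353808, 2682720, -15353712, 68988672, -249811776, 742184208, -1831706784, 3786612624, -6590020032, 9676823760, -11984223456, 12478123872, -10854518400, 7806726864, -4566176064, 2114216640, -738377856, 175146624, -19502208, -2519424, 1119744, -93312:] :: int poly"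
  let ?qes = "[([:0, 1:], 11), ([:-1, 1:], 11), ([:-1, 2:], 5), ([:1, -2, 2:], 2), ([:1, -3, 3:], 3), ([:1, -6, 6:], 0)] :: (int poly \<times> nat) list"
  have fg: "fg Z12 = (homogenize ?F, homogenize ?K)"
    unfolding fg.simps Let_def
    by (rule tate_pair_eq[where S = "[:-1, 3, -3, 1:]" and V = "[:0, 1, -5, 9, -6:]" and U = "[:0, -1, 9, -36, 83, -119, 106, -54, 12:]"])
      (simp add: tvar_eval, subst denominator_cancel(5)[OF tvar_poly_nonzero(2)], simp add: tvar_eval, subst denominator_cancel(3)[OF tvar_poly_nonzero(2)], simp add: tvar_eval, simp add: poly_eval, simp add: poly_eval)
  have disc: "4 * ?F ^ 3 + [:27:] * ?K ^ 2 = [:-136048896:] * (\<Prod>(q, e)\<leftarrow>?qes. q ^ Suc e)"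
    by (simp add: poly_eval)
  have simple: "[:2822, -71688, 526668, -1884280, 3832920, -4599504, 3066336, -876096:] * (\<Prod>(q, e)\<leftarrow>?qes. q) + [:1, -2794, 32718, -157192, 419300, -681408, 681408, -389376, 97344:] * pderiv (\<Prod>(q, e)\<leftarrow>?qes. q) = [:1:]"
    by (simp add: pderiv_pCons)
  have cusp: "[:-10457748, 196606440, -1733247072, 9509949504, -36298225440, 101959188048, -217307585376, 356858436672, -453464302320, 443328053040, -327887543808, 177818216544, -67235903280, 16601487840, -2681786880, 357571584:] * (\<Prod>(q, e)\<leftarrow>?qes. q)
      + [:-1, -387348, 3408168, -13844856, 33052164, -49896432, 47533392, -26486784, 6621696:] * ?F = [:27:]"
    by simp
  have "c_mult Z12 p = real (p - 1) / real p ^ 2 * real (1 + (\<Sum>(q, e)\<leftarrow>?qes. degree q))"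
  proof (rule c_mult_homogeneous[OF p(1) not_dvd_210[OF p] fg _ _ _ _ _ disc _ simple _ cusp, where k = 4 and j = 30])
    show "num_roots p q = degree q" if "(q, e) \<in> set ?qes" for q e
      using that by (auto simp: num_roots_split[OF p])
  qed simp_all
  then show ?thesis by (simp add: num_cusps_eq)
qed

lemma c_mult_Z2xZ8:
  assumes p: "prime p" "p mod 2520 = 1"
  shows "c_mult Z2xZ8 p = real (p - 1) / real p ^ 2 * real (num_cusps Z2xZ8)"
proof -
  let ?F = "[:-27, -864, -12096, -96768, -476928, -1382400, -1382400, 6414336, 31961088, 51314688, -88473600, -707788800, -1953497088, -3170893824, -3170893824, -1811939328, -452984832:] :: int poly"
  let ?K = "[:54, 2592, 57024, 760320, 6822144, 42964992, 189278208, 535486464, 535818240, -3308912640, -22061776896, -82046877696, -246536994816, -656375021568, -1411953721344, -1694163271680, 2194711511040, 17546820452352, 49618146557952, 90104118902784, 114456583471104, 102048422952960, 61229053771776, 22265110462464, 3710851743744:] :: int poly"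
  let ?qes = "[([:0, 1:], 7), ([:1, 2:], 7), ([:1, 4:], 7), ([:-1, 0, 8:], 1), ([:1, 4, 8:], 3), ([:1, 8, 8:], 1)] :: (int poly \<times> nat) list"
  have fg: "fg Z2xZ8 = (homogenize ?F, homogenize ?K)"
    unfolding fg.simps Let_def
    by (rule tate_pair_eq[where S = "[:0, -2, -8, 16, 64:]" and V = "[:1, 6, 16, 16:]" and U = "[:0, 0, 4, 56, 320, 960, 1536, 1024:]"])
      (simp add: tvar_eval, subst denominator_cancel(1)[OF tvar_poly_nonzero(5)], simp add: tvar_eval, subst denominator_cancel(4)[OF tvar_poly_nonzero(4)], simp add: tvar_eval, simp add: poly_eval, simp add: poly_eval)
  have disc: "4 * ?F ^ 3 + [:27:] * ?K ^ 2 = [:-34828517376:] * (\<Prod>(q, e)\<leftarrow>?qes. q ^ Suc e)"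
    by (simp add: poly_eval)
  have simple: "[:3555, 108324, 750384, 1310976, -5564160, -30433536, -51964416, -29693952:] * (\<Prod>(q, e)\<leftarrow>?qes. q) + [:-2, -3483, -46206, -206832, -249984, 1051200, 4550016, 6598656, 3299328:] * pderiv (\<Prod>(q, e)\<leftarrow>?qes. q) = [:2:]"
    by (simp add: pderiv_pCons)
  have cusp: "[:-2111616, -54922752, -623683584, -3986848512, -14927086080, -26643962880, 29470390272, 312672559104, 766963924992, -29063577600, -6106228457472, -21074921127936, -38826349166592, -42672530128896, -26336538132480, -7023076835328:] * (\<Prod>(q, e)\<leftarrow>?qes. q)
      + [:-1, 78240, 938688, 4013568, 4468224, -21135360, -88178688, -127008768, -63504384:] * ?F = [:27:]"
    by simp
  have "c_mult Z2xZ8 p = real (p - 1) / real p ^ 2 * real (1 + (\<Sum>(q, e)\<leftarrow>?qes. degree q))"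
  proof (rule c_mult_homogeneous[OF p(1) not_dvd_210[OF p] fg _ _ _ _ _ disc _ simple _ cusp, where k = 4 and j = 30])
    show "num_roots p q = degree q" if "(q, e) \<in> set ?qes" for q e
      using that by (auto simp: num_roots_split[OF p])
  qed simp_all
  then show ?thesis by (simp add: num_cusps_eq)
qed

lemma c_mult_Z2xZ4:
  assumes p: "prime p" "p mod 2520 = 1"
  shows "c_mult Z2xZ4 p = real (p - 1) / real p ^ 2 * real (num_cusps Z2xZ4)"
proof -
  let ?F = "[:-27, 0, -378, 0, -27:] :: int poly"
  let ?K = "[:-54, 0, 1782, 0, 1782, 0, -54:] :: int poly"
  let ?qes = "[([:0, 1:], 1), ([:-1, 1:], 3), ([:1, 1:], 3)] :: (int poly \<times> nat) list"
  have fg: "fg Z2xZ4 = (homogenize ?F, homogenize ?K)"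
    by (simp add: homogenize_def[abs_def] fun_eq_iff eval_nat_numeral algebra_simps)
  have disc: "4 * ?F ^ 3 + [:27:] * ?K ^ 2 = [:-8503056:] * (\<Prod>(q, e)\<leftarrow>?qes. q ^ Suc e)"
    by (simp add: poly_eval)
  have simple: "[:0, -9:] * (\<Prod>(q, e)\<leftarrow>?qes. q) + [:-2, 0, 3:] * pderiv (\<Prod>(q, e)\<leftarrow>?qes. q) = [:2:]"
    by (simp add: pderiv_pCons)
  have cusp: "[:0, 5643, 0, 405:] * (\<Prod>(q, e)\<leftarrow>?qes. q)
      + [:-16, 0, 15:] * ?F = [:432:]"
    by simp
  have "c_mult Z2xZ4 p = real (p - 1) / real p ^ 2 * real (1 + (\<Sum>(q, e)\<leftarrow>?qes. degree q))"
  proof (rule c_mult_homogeneous[OF p(1) not_dvd_210[OF p] fg _ _ _ _ _ disc _ simple _ cusp, where k = 1 and j = 30])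
    show "num_roots p q = degree q" if "(q, e) \<in> set ?qes" for q e
      using that by (auto simp: num_roots_split[OF p])
  qed simp_all
  then show ?thesis by (simp add: num_cusps_eq)
qed

lemma c_mult_Z2xZ6:
  assumes p: "prime p" "p mod 2520 = 1"
  shows "c_mult Z2xZ6 p = real (p - 1) / real p ^ 2 * real (num_cusps Z2xZ6)"
proof -
  let ?F = "[:-62208, 0, -393984, 0, -12960, 0, 1296, 0, -27:] :: int poly"
  let ?K = "[:-5971968, 0, 86593536, 0, 43670016, 0, -2363904, 0, 85536, 0, -3888, 0, 54:] :: int poly"
  let ?qes = "[([:0, 1:], 1), ([:-2, 1:], 5), ([:2, 1:], 5), ([:-6, 1:], 1), ([:6, 1:], 1)] :: (int poly \<times> nat) list"
  have fg: "fg Z2xZ6 = (homogenize ?F, homogenize ?K)"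
    by (simp add: homogenize_def[abs_def] fun_eq_iff eval_nat_numeral algebra_simps)
  have disc: "4 * ?F ^ 3 + [:27:] * ?K ^ 2 = [:-8707129344:] * (\<Prod>(q, e)\<leftarrow>?qes. q ^ Suc e)"
    by (simp add: poly_eval)
  have simple: "[:0, 3900, 0, -175:] * (\<Prod>(q, e)\<leftarrow>?qes. q) + [:3072, 0, -1340, 0, 35:] * pderiv (\<Prod>(q, e)\<leftarrow>?qes. q) = [:442368:]"
    by (simp add: pderiv_pCons)
  have cusp: "[:0, -16098912, 0, -539136, 0, 53298, 0, -1107:] * (\<Prod>(q, e)\<leftarrow>?qes. q)
      + [:-6144, 0, 1646, 0, -41:] * ?F = [:382205952:]"
    by simp
  have "c_mult Z2xZ6 p = real (p - 1) / real p ^ 2 * real (1 + (\<Sum>(q, e)\<leftarrow>?qes. degree q))"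
  proof (rule c_mult_homogeneous[OF p(1) not_dvd_210[OF p] fg _ _ _ _ _ disc _ simple _ cusp, where k = 2 and j = 30])
    show "num_roots p q = degree q" if "(q, e) \<in> set ?qes" for q e
      using that by (auto simp: num_roots_split[OF p])
  qed simp_all
  then show ?thesis by (simp add: num_cusps_eq)
qed

lemma c_mult_groups_ge_5:
  assumes "prime p" "p mod 2520 = 1"
    and "G \<in> {Z5, Z6, Z7, Z8, Z9, Z10, Z12, Z2xZ4, Z2xZ6, Z2xZ8}"
  shows "c_mult G p = real (p - 1) / real p ^ 2 * real (num_cusps G)"
  using assms c_mult_Z5 c_mult_Z6 c_mult_Z7 c_mult_Z8 c_mult_Z9 c_mult_Z10 c_mult_Z12
    c_mult_Z2xZ4 c_mult_Z2xZ6 c_mult_Z2xZ8 by auto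

section \<open>The groups of order at most 4\<close>

lemma not_dvd_6:
  assumes "prime p" "p \<ge> 5"
  shows "\<not> int p dvd 6"
proof
  assume "int p dvd 6"
  then have "int p dvd 2 * 3" by simp
  then have "int p dvd 2 \<or> int p dvd 3" using assms(1) by (simp only: prime_dvd_mult_iff prime_nat_int_transfer)
  then have "int p \<le> 2 \<or> int p \<le> 3" by (auto dest: zdvd_imp_le)
  then show False using assms(2) by simp
qed

lemma mod_cong: "[a mod n = a] (mod (n :: int))"
  by (simp add: cong_def)

lemma c_mult_Z2:
  assumes p: "prime p" "p \<ge> 5"
  shows "c_mult Z2 p = real (p - 1) / real p ^ 2 * real (num_cusps Z2)"
proof -
  note n = not_dvd_6[OF p]
  note nd = not_dvd_of_dvd_power[OF p(1) n, of _ 10]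
  let ?qes = "[([:3, 1:], 1), ([:3, 4:], 0)] :: (int poly \<times> nat) list"
  define F K :: "int \<Rightarrow> int \<Rightarrow> int" where "F = (\<lambda>a b. a)" and "K = (\<lambda>a b. b ^ 3 + a * b)"
  have "c_mult Z2 p = real (card {(a, b) \<in> Fp p \<times> Fp p. nodal_value p 1 (F a b) (K a b)}) / real p ^ 2"
    by (rule c_mult_eq_card[OF p(1)]) (use p in \<open>auto simp: F_def K_def\<close>)
  also have "card {(a, b) \<in> Fp p \<times> Fp p. nodal_value p 1 (F a b) (K a b)} =
      (p - 1) * card {t \<in> Fp p. nodal_value p 1 (poly [:0, 1:] t) (poly [:1, 1:] t)} + card {a \<in> Fp p. nodal_value p 1 (F a 0) (K a 0)}"
  proof (rule card_nodal_weighted[OF p(1), where w = 2 and k = 1])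
    show "[F (a mod int p) (b mod int p) = F a b] (mod int p)" "[K (a mod int p) (b mod int p) = K a b] (mod int p)" for a b
      unfolding F_def K_def by (intro cong_add cong_mult cong_pow mod_cong)+
  qed (simp_all add: F_def K_def algebra_simps power_mult_distrib eval_nat_numeral)
  also have "card {t \<in> Fp p. nodal_value p 1 (poly [:0, 1:] t) (poly [:1, 1:] t)} = (\<Sum>(q, e)\<leftarrow>?qes. degree q)"
  proof (rule card_nodal_affine[OF p(1) n, where j = 10 and C = 1 and c = 81 and c' = 9
      and A = "[:-16:]" and B = "[:15, 8:]" and A' = "[:1:]" and B' = "[:-15, -4:]"])
    show "num_roots p q = degree q" if "(q, e) \<in> set ?qes" for q e
      using that num_roots_linear[OF p(1) nd] by auto
  qed (simp_all add: pderiv_pCons poly_eval)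
  also have "{a \<in> Fp p. nodal_value p 1 (F a 0) (K a 0)} = {}"
    using p(1) nd[of 4] by (auto simp: nodal_value_def F_def K_def prime_dvd_mult_iff prime_dvd_power_iff)
  finally show ?thesis by (simp add: num_cusps_eq)
qed

text \<open>
  The roles of \<open>a\<close> and \<open>b\<close> are exchanged, since here \<open>b\<close> has the larger weight.
\<close>

lemma c_mult_Z3:
  assumes p: "prime p" "p \<ge> 5"
  shows "c_mult Z3 p = real (p - 1) / real p ^ 2 * real (num_cusps Z3)"
proof -
  note n = not_dvd_6[OF p]
  note nd = not_dvd_of_dvd_power[OF p(1) n, of _ 10]
  let ?qes = "[([:9, 1:], 2), ([:5, 1:], 0)] :: (int poly \<times> nat) list"
  define F K :: "int \<Rightarrow> int \<Rightarrow> int" where "F = (\<lambda>b a. 6 * a * b + 27 * a ^ 4)" and "K = (\<lambda>b a. b ^ 2 - 27 * a ^ 6)"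
  have "c_mult Z3 p = real (card {(a, b) \<in> Fp p \<times> Fp p. nodal_value p 1 (F b a) (K b a)}) / real p ^ 2"
    by (rule c_mult_eq_card[OF p(1)]) (use p in \<open>auto simp: F_def K_def\<close>)
  also have "card {(a, b) \<in> Fp p \<times> Fp p. nodal_value p 1 (F b a) (K b a)} =
      card (prod.swap ` {(b, a) \<in> Fp p \<times> Fp p. nodal_value p 1 (F b a) (K b a)})"
    by (rule arg_cong[where f = card]) auto
  also have "\<dots> = card {(b, a) \<in> Fp p \<times> Fp p. nodal_value p 1 (F b a) (K b a)}"
    by (rule card_image) simp
  also have "\<dots> = (p - 1) * card {t \<in> Fp p. nodal_value p 1 (poly [:27, 6:] t) (poly [:-27, 0, 1:] t)} + card {b \<in> Fp p. nodal_value p 1 (F b 0) (K b 0)}"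
  proof (rule card_nodal_weighted[OF p(1), where w = 3 and k = 2])
    show "[F (a mod int p) (b mod int p) = F a b] (mod int p)" "[K (a mod int p) (b mod int p) = K a b] (mod int p)" for a b
      unfolding F_def K_def by (intro cong_add cong_diff cong_mult cong_pow mod_cong cong_refl)+
  qed (simp_all add: F_def K_def algebra_simps power_mult_distrib eval_nat_numeral)
  also have "card {t \<in> Fp p. nodal_value p 1 (poly [:27, 6:] t) (poly [:-27, 0, 1:] t)} = (\<Sum>(q, e)\<leftarrow>?qes. degree q)"
  proof (rule card_nodal_affine[OF p(1) n, where j = 10 and C = 27 and c = 8 and c' = 27
      and A = "[:-2:]" and B = "[:7, 1:]" and A' = "[:12:]" and B' = "[:-19, -2:]"])
    show "num_roots p q = degree q" if "(q, e) \<in> set ?qes" for q e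
      using that num_roots_linear[OF p(1) nd] by auto
  qed (simp_all add: pderiv_pCons poly_eval)
  also have "{b \<in> Fp p. nodal_value p 1 (F b 0) (K b 0)} = {}"
    using p(1) nd[of 27] by (auto simp: nodal_value_def F_def K_def prime_dvd_mult_iff prime_dvd_power_iff)
  finally show ?thesis by (simp add: num_cusps_eq)
qed

text \<open>
  The line \<open>b = 0\<close> is one of the three cusps; each of its nonzero points has nodal value.
\<close>

lemma c_mult_Z4:
  assumes p: "prime p" "p \<ge> 5"
  shows "c_mult Z4 p = real (p - 1) / real p ^ 2 * real (num_cusps Z4)"
proof -
  note n = not_dvd_6[OF p]
  note nd = not_dvd_of_dvd_power[OF p(1) n, of _ 10]
  let ?qes = "[([:-1, 3:], 3), ([:-5, 12:], 0)] :: (int poly \<times> nat) list"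
  define F K :: "int \<Rightarrow> int \<Rightarrow> int" where "F = (\<lambda>a b. - 3 * a ^ 2 + 6 * a * b ^ 2 - 2 * b ^ 4)"
    and "K = (\<lambda>a b. (2 * a - b ^ 2) * (a ^ 2 + 2 * a * b ^ 2 - b ^ 4))"
  have "c_mult Z4 p = real (card {(a, b) \<in> Fp p \<times> Fp p. nodal_value p 1 (F a b) (K a b)}) / real p ^ 2"
    by (rule c_mult_eq_card[OF p(1)]) (use p in \<open>auto simp: F_def K_def\<close>)
  also have "card {(a, b) \<in> Fp p \<times> Fp p. nodal_value p 1 (F a b) (K a b)} =
      (p - 1) * card {t \<in> Fp p. nodal_value p 1 (poly [:-2, 6, -3:] t) (poly [:1, -4, 3, 2:] t)} + card {a \<in> Fp p. nodal_value p 1 (F a 0) (K a 0)}"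
  proof (rule card_nodal_weighted[OF p(1), where w = 2 and k = 2])
    show "[F (a mod int p) (b mod int p) = F a b] (mod int p)" "[K (a mod int p) (b mod int p) = K a b] (mod int p)" for a b
      unfolding F_def K_def by (intro cong_add cong_diff cong_mult cong_pow mod_cong cong_refl)+
  qed (simp_all add: F_def K_def algebra_simps power_mult_distrib eval_nat_numeral)
  also have "card {t \<in> Fp p. nodal_value p 1 (poly [:-2, 6, -3:] t) (poly [:1, -4, 3, 2:] t)} = (\<Sum>(q, e)\<leftarrow>?qes. degree q)"
  proof (rule card_nodal_affine[OF p(1) n, where j = 10 and C = 1 and c = 1 and c' = 1
      and A = "[:-16:]" and B = "[:-3, 8:]" and A' = "[:71, -45:]" and B' = "[:177, -540:]"])
    show "num_roots p q = degree q" if "(q, e) \<in> set ?qes" for q e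
      using that num_roots_linear[OF p(1) nd] by auto
  qed (simp_all add: pderiv_pCons poly_eval)
  also have "{a \<in> Fp p. nodal_value p 1 (F a 0) (K a 0)} = {1..<int p}"
  proof -
    have "nodal_value p 1 (F a 0) (K a 0) \<longleftrightarrow> a \<noteq> 0" if "a \<in> Fp p" for a
    proof (cases "a = 0")
      case False
      then have "\<not> int p dvd a" using that by (intro zdvd_not_zless) auto
      then have "\<not> int p dvd 3 * a ^ 2"
        using p(1) nd[of 3] by (auto simp: prime_dvd_mult_iff prime_dvd_power_iff)
      moreover have "4 * F a 0 ^ 3 + 27 * 1 * K a 0 ^ 2 = 0"
        by (simp add: F_def K_def eval_nat_numeral algebra_simps)
      ultimately show ?thesis using False unfolding nodal_value_def by (simp add: F_def)
    qed (simp add: nodal_value_def F_def K_def)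
    then show ?thesis by auto
  qed
  finally have "c_mult Z4 p = real ((p - 1) * 2 + (p - 1)) / real p ^ 2" by (simp add: nat_diff_distrib')
  also have "(p - 1) * 2 + (p - 1) = (p - 1) * 3" by simp
  finally show ?thesis by (simp add: num_cusps_eq)
qed

lemma c_mult_Z2xZ2:
  assumes p: "prime p" "p \<ge> 5"
  shows "c_mult Z2xZ2 p = real (p - 1) / real p ^ 2 * real (num_cusps Z2xZ2)"
proof -
  note n = not_dvd_6[OF p]
  note nd = not_dvd_of_dvd_power[OF p(1) n, of _ 10]
  let ?qes = "[([:0, 1:], 1), ([:-3, 1:], 1), ([:3, 1:], 1)] :: (int poly \<times> nat) list"
  define F K :: "int \<Rightarrow> int \<Rightarrow> int" where "F = (\<lambda>a b. - (a ^ 2 + 3 * b ^ 2))" and "K = (\<lambda>a b. b ^ 3 - a ^ 2 * b)"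
  have "c_mult Z2xZ2 p = real (card {(a, b) \<in> Fp p \<times> Fp p. nodal_value p 4 (F a b) (K a b)}) / real p ^ 2"
    by (rule c_mult_eq_card[OF p(1) nd]) (auto simp: F_def K_def)
  also have "card {(a, b) \<in> Fp p \<times> Fp p. nodal_value p 4 (F a b) (K a b)} =
      (p - 1) * card {t \<in> Fp p. nodal_value p 4 (poly [:-3, 0, -1:] t) (poly [:1, 0, -1:] t)} + card {a \<in> Fp p. nodal_value p 4 (F a 0) (K a 0)}"
  proof (rule card_nodal_weighted[OF p(1), where w = 1 and k = 1])
    show "[F (a mod int p) (b mod int p) = F a b] (mod int p)" "[K (a mod int p) (b mod int p) = K a b] (mod int p)" for a b
      unfolding F_def K_def cong_minus_minus_iff by (intro cong_add cong_diff cong_mult cong_pow mod_cong cong_refl)+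
  qed (simp_all add: F_def K_def algebra_simps power_mult_distrib eval_nat_numeral)
  also have "card {t \<in> Fp p. nodal_value p 4 (poly [:-3, 0, -1:] t) (poly [:1, 0, -1:] t)} = (\<Sum>(q, e)\<leftarrow>?qes. degree q)"
  proof (rule card_nodal_affine[OF p(1) n, where j = 10 and C = "-4" and c = 54 and c' = 36
      and A = "[:0, -3:]" and B = "[:-6, 0, 1:]" and A' = "[:0, 1:]" and B' = "[:-12, 0, 1:]"])
    show "num_roots p q = degree q" if "(q, e) \<in> set ?qes" for q e
      using that num_roots_linear[OF p(1) nd] by auto
  qed (simp_all add: pderiv_pCons poly_eval)
  also have "{a \<in> Fp p. nodal_value p 4 (F a 0) (K a 0)} = {}"
    using p(1) nd[of 4] by (auto simp: nodal_value_def F_def K_def prime_dvd_mult_iff prime_dvd_power_iff)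
  finally show ?thesis by (simp add: num_cusps_eq)
qed

section \<open>Proportionality\<close>

theorem corollary6:
  shows "(\<forall>p::nat. prime p \<and> p \<ge> 5 \<longrightarrow>
            (\<exists>r::real. r > 0 \<and>
               (\<forall>G\<in>{Z2, Z3, Z4, Z2xZ2}. c_mult G p = r * real (num_cusps G))))
       \<and> (\<exists>S::nat set. S \<subseteq> {p. prime p \<and> p \<ge> 5} \<and>
            (\<exists>\<delta>>0. has_prime_density S \<delta>) \<and>
            (\<forall>p\<in>S. \<exists>r::real. r > 0 \<and>
               (\<forall>G\<in>{Z5, Z6, Z7, Z8, Z9, Z10, Z12, Z2xZ4, Z2xZ6, Z2xZ8}.
                  c_mult G p = r * real (num_cusps G))))"
proof (intro conjI allI impI)
  fix p :: nat
  assume p: "prime p \<and> p \<ge> 5"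
  then have "real (p - 1) / real p ^ 2 > 0" by simp
  moreover have "\<forall>G\<in>{Z2, Z3, Z4, Z2xZ2}. c_mult G p = real (p - 1) / real p ^ 2 * real (num_cusps G)"
    using c_mult_Z2 c_mult_Z3 c_mult_Z4 c_mult_Z2xZ2 p by auto
  ultimately show "\<exists>r>0. \<forall>G\<in>{Z2, Z3, Z4, Z2xZ2}. c_mult G p = r * real (num_cusps G)" by blast
next
  let ?S = "{p::nat. prime p \<and> p mod 2520 = 1}"
  have large: "p \<ge> 5" if "p \<in> ?S" for p
  proof (rule ccontr)
    assume "\<not> p \<ge> 5"
    then have "p = 1" using that by simp
    then show False using that by simp
  qed
  have "\<exists>r>0. \<forall>G\<in>{Z5, Z6, Z7, Z8, Z9, Z10, Z12, Z2xZ4, Z2xZ6, Z2xZ8}. c_mult G p = r * real (num_cusps G)"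
    if p: "p \<in> ?S" for p
  proof -
    have "real (p - 1) / real p ^ 2 > 0" using large[OF p] by simp
    then show ?thesis using c_mult_groups_ge_5[of p] p by blast
  qed
  then show "\<exists>S. S \<subseteq> {p. prime p \<and> p \<ge> 5} \<and> (\<exists>\<delta>>0. has_prime_density S \<delta>) \<and>
      (\<forall>p\<in>S. \<exists>r>0. \<forall>G\<in>{Z5, Z6, Z7, Z8, Z9, Z10, Z12, Z2xZ4, Z2xZ6, Z2xZ8}. c_mult G p = r * real (num_cusps G))"
    using prime_density_2520 large by (intro exI[of _ ?S]) auto
qed

end
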